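(* Let $\mathcal{H}$ be a Hopf algebra over a field $C$, let $M$ be a finite-dimensional left $\mathcal{H}$-module, and let $\pi:\mathcal{H}\to M_n(C)$ be a matrix representation associated with $M$. Then the $C$-linear tensor-isomorphism $(\mathcal{H}\text{-}mod)\simeq(comod\text{-}\mathcal{H}^\circ)$ restricts to a $C$-linear tensor-isomorphism $$\{\{M\}\}\simeq(comod\text{-}\mathcal{H}^\circ_\pi).$$
   Context: $\mathcal{H}^\circ=\bigcup_I(\mathcal{H}/I)^*$ ($I$ over co-finite ideals) is the dual Hopf algebra. $(\mathcal{H}\text{-}mod)$ is the category of finite-dimensional left $\mathcal{H}$-modules, and $(comod\text{-}\mathfrak{H})$ the category of finite-dimensional right co-modules over a Hopf algebra $\mathfrak{H}$; both are left rigid abelian tensor categories. The tensor-isomorphism $(\mathcal{H}\text{-}mod)\simeq(comod\text{-}\mathcal{H}^\circ)$ is the identity on underlying vector spaces and relates structures by $hm=\sum m_{(0)}\langle m_{(1)},h\rangle$, where $\rho(m)=\sum m_{(0)}\otimes m_{(1)}$ is the co-action. $\{\{M\}\}$ is the left rigid abelian tensor subcategory of $(\mathcal{H}\text{-}mod)$ generated by $M$: the full subcategory of the objects that are sub-quotients of finite direct sums $L_1\oplus\dots\oplus L_s$ ($s\ge0$) of tensor products $L_i=X_{i1}\otimes\dots\otimes X_{i,t_i}$ ($t_i\ge0$), each $X_{ij}$ being $M$ or some iterated left dual $M^*,M^{**},\dots$ of $M$. For a matrix representation $\pi$, let $c_{ij}=\pi^*(e_{ij}^* )\in\mathcal{H}^\circ$,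 where $\{e^*_{ij}\}$ is the dual basis of the matrix units; these span the coefficient co-algebra $\mathrm{cf}(\pi)=\mathrm{Im}(\pi^* )$. The co-representation Hopf algebra $\mathcal{H}^\circ_\pi$ is the smallest Hopf sub-algebra of $\mathcal{H}^\circ$ including $\mathrm{cf}(\pi)$, i.e. the sub-algebra generated by all $S^k(c_{ij})$, $k\ge0$. $(comod\text{-}\mathcal{H}^\circ_\pi)$ is regarded as a full subcategory of $(comod\text{-}\mathcal{H}^\circ)$. *)

theory Defs
  imports "Jordan_Normal_Form.Matrix" "HOL-Library.Function_Algebras" "HOL-Library.Product_Plus"
begin

section \<open>Vector spaces\<close>

text \<open>A vector space over the field \<open>'k\<close> is a subspace \<open>car V\<close> of an ambient type-level vector space
  (\<open>'v\<close> with scalar multiplication \<open>scl V\<close>).  Throughout, maps defined on a carrier are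
  represented by functions that vanish outside of it, so that equality of such functions is equality of
  maps, and pointwise sums and multiples are again of this form.\<close>

record ('k, 'v) vspace =
  car :: "'v set"
  scl :: "'k \<Rightarrow> 'v \<Rightarrow> 'v"

definition is_vs :: "('k::field, 'v::ab_group_add, 'x) vspace_scheme \<Rightarrow> bool" where
  "is_vs V \<longleftrightarrow> vector_space (scl V) \<and> Modules.module.subspace (scl V) (car V)"

definition fin_dim_vs :: "('k::field, 'v::ab_group_add, 'x) vspace_scheme \<Rightarrow> bool" where
  "fin_dim_vs V \<longleftrightarrow> is_vs V \<and>
     (\<exists>B. finite B \<and> B \<subseteq> car V \<and> Modules.module.span (scl V) B = car V)"

definition lin :: "('k::field, 'v::ab_group_add, 'x) vspace_scheme \<Rightarrow>
    ('k, 'w::ab_group_add, 'y) vspace_scheme \<Rightarrow> ('v \<Rightarrow> 'w) \<Rightarrow> bool" where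
  "lin V W f \<longleftrightarrow> (\<forall>x\<in>car V. f x \<in> car W) \<and>
     (\<forall>x\<in>car V. \<forall>y\<in>car V. f (x + y) = f x + f y) \<and>
     (\<forall>c. \<forall>x\<in>car V. f (scl V c x) = scl W c (f x))"

definition bilin :: "('k::field, 'u::ab_group_add, 'x) vspace_scheme \<Rightarrow>
    ('k, 'v::ab_group_add, 'y) vspace_scheme \<Rightarrow> ('k, 'w::ab_group_add, 'z) vspace_scheme \<Rightarrow>
    ('u \<Rightarrow> 'v \<Rightarrow> 'w) \<Rightarrow> bool" where
  "bilin U V W b \<longleftrightarrow> (\<forall>x\<in>car U. lin V W (b x)) \<and> (\<forall>y\<in>car V. lin U W (\<lambda>x. b x y))"

definition ground :: "('k::field, 'k) vspace" where
  "ground = \<lparr>car = UNIV, scl = (*)\<rparr>"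

definition dual_vs :: "('k::field, 'v::ab_group_add, 'x) vspace_scheme \<Rightarrow> ('k, 'v \<Rightarrow> 'k) vspace" where
  "dual_vs V = \<lparr>car = {f. lin V ground f \<and> (\<forall>x. x \<notin> car V \<longrightarrow> f x = 0)}, scl = (\<lambda>c f x. c * f x)\<rparr>"


section \<open>Tensor products\<close>

text \<open>Over a field, the tensor product \<open>V \<otimes> W\<close> embeds into the bilinear forms on
  \<open>V\<^sup>* \<times> W\<^sup>*\<close>; it is realised here as the span of the pure tensors
  \<open>(f, g) \<mapsto> f v * g w\<close>, where \<open>f\<close>, \<open>g\<close> range over the functionals on the ambient spaces.
  With this choice \<open>V \<otimes> D\<close> is a subset of \<open>V \<otimes> W\<close> whenever \<open>D\<close> is a subspace of \<open>W\<close>.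
  That this is a tensor product is theorem \<open>tensor_universal\<close> below.\<close>

type_synonym ('k, 'v, 'w) tensor = "('v \<Rightarrow> 'k) \<Rightarrow> ('w \<Rightarrow> 'k) \<Rightarrow> 'k"

definition tens :: "('k::field, 'v::ab_group_add, 'x) vspace_scheme \<Rightarrow>
    ('k, 'w::ab_group_add, 'y) vspace_scheme \<Rightarrow> 'v \<Rightarrow> 'w \<Rightarrow> ('k, 'v, 'w) tensor" where
  "tens V W v w = (\<lambda>f g.
     if Vector_Spaces.linear (scl V) (*) f \<and> Vector_Spaces.linear (scl W) (*) g then f v * g w else 0)"

definition tensor_scl :: "'k::field \<Rightarrow> ('k, 'v, 'w) tensor \<Rightarrow> ('k, 'v, 'w) tensor" where
  "tensor_scl c t = (\<lambda>f g. c * t f g)"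

definition tensor_vs :: "('k::field, 'v::ab_group_add, 'x) vspace_scheme \<Rightarrow>
    ('k, 'w::ab_group_add, 'y) vspace_scheme \<Rightarrow> ('k, ('k, 'v, 'w) tensor) vspace" where
  "tensor_vs V W =
     \<lparr>car = Modules.module.span tensor_scl {tens V W v w | v w. v \<in> car V \<and> w \<in> car W},
      scl = tensor_scl\<rparr>"

text \<open>The linear map on \<open>V \<otimes> W\<close> induced by a bilinear map \<open>b\<close>; in Sweedler notation,
  \<open>tlift V W (\<lambda>v w. b v w) t\<close> is \<open>\<Sum> b t\<^sub>1 t\<^sub>2\<close>.\<close>

definition tlift :: "('k::field, 'v::ab_group_add, 'x) vspace_scheme \<Rightarrow>
    ('k, 'w::ab_group_add, 'y) vspace_scheme \<Rightarrow> ('v \<Rightarrow> 'w \<Rightarrow> 'u::ab_group_add) \<Rightarrow>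
    ('k, 'v, 'w) tensor \<Rightarrow> 'u" where
  "tlift V W b t = (THE y. \<exists>(r::nat) v w. (\<forall>i<r. v i \<in> car V \<and> w i \<in> car W) \<and>
     t = (\<Sum>i<r. tens V W (v i) (w i)) \<and> y = (\<Sum>i<r. b (v i) (w i)))"

definition tmap :: "('k::field, 'v::ab_group_add, 'x) vspace_scheme \<Rightarrow>
    ('k, 'w::ab_group_add, 'y) vspace_scheme \<Rightarrow>
    ('k, 'v2::ab_group_add, 'x2) vspace_scheme \<Rightarrow> ('k, 'w2::ab_group_add, 'y2) vspace_scheme \<Rightarrow>
    ('v \<Rightarrow> 'v2) \<Rightarrow> ('w \<Rightarrow> 'w2) \<Rightarrow> ('k, 'v, 'w) tensor \<Rightarrow> ('k, 'v2, 'w2) tensor" where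
  "tmap V W V' W' f g = tlift V W (\<lambda>v w. tens V' W' (f v) (g w))"

definition tassoc :: "('k::field, 'u::ab_group_add, 'x) vspace_scheme \<Rightarrow>
    ('k, 'v::ab_group_add, 'y) vspace_scheme \<Rightarrow> ('k, 'w::ab_group_add, 'z) vspace_scheme \<Rightarrow>
    ('k, ('k, 'u, 'v) tensor, 'w) tensor \<Rightarrow> ('k, 'u, ('k, 'v, 'w) tensor) tensor" where
  "tassoc U V W = tlift (tensor_vs U V) W
     (\<lambda>t w. tlift U V (\<lambda>u v. tens U (tensor_vs V W) u (tens V W v w)) t)"

lemma lin_0:
  assumes V: "is_vs V" and W: "is_vs W" and f: "lin V W f"
  shows "f 0 = 0"
proof -
  interpret V: vector_space "scl V" using V by (simp add: is_vs_def)
  interpret W: vector_space "scl W" using W by (simp add: is_vs_def)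
  have "0 \<in> car V" using V V.subspace_0 by (simp add: is_vs_def)
  then have "f (scl V 0 0) = scl W 0 (f 0)" using f unfolding lin_def by blast
  then show ?thesis by simp
qed

lemma lin_sum:
  assumes V: "is_vs V" and W: "is_vs W" and f: "lin V W f"
    and "finite I" "\<And>i. i \<in> I \<Longrightarrow> x i \<in> car V"
  shows "(\<Sum>i\<in>I. x i) \<in> car V \<and> f (\<Sum>i\<in>I. x i) = (\<Sum>i\<in>I. f (x i))"
  using assms(4,5)
proof (induction I rule: finite_induct)
  case empty
  interpret V: vector_space "scl V" using V by (simp add: is_vs_def)
  show ?case using lin_0[OF V W f] V V.subspace_0 by (simp add: is_vs_def)
next
  case (insert i I)
  interpret V: vector_space "scl V" using V by (simp add: is_vs_def)
  have "x i \<in> car V" "(\<Sum>i\<in>I. x i) \<in> car V" "f (\<Sum>i\<in>I. x i) = (\<Sum>i\<in>I. f (x i))"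
    using insert by auto
  then show ?case
    using insert f V V.subspace_add[of "car V"] unfolding lin_def is_vs_def by simp
qed

lemma linear_separates:
  assumes "vector_space s" and "\<And>g. Vector_Spaces.linear s (*) g \<Longrightarrow> g x = (0::'k::field)"
  shows "x = 0"
proof (rule ccontr)
  interpret vector_space s by fact
  assume "x \<noteq> 0"
  then have ind: "independent {x}" by simp
  define E where "E = extend_basis {x}"
  have E: "independent E" "span E = UNIV" "{x} \<subseteq> E"
    using extend_basis_superset[OF ind] independent_extend_basis[OF ind] span_extend_basis[OF ind]
    by (auto simp: E_def)
  have "Vector_Spaces.linear s (*) (\<lambda>v. representation E v x)"
    using linear_representation[OF E(1,2)] .
  then have "representation E x x = 0" by (rule assms(2))
  moreover have "representation E x x = 1"
    using representation_basis[OF E(1), of x] E(3) by simp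
  ultimately show False by simp
qed

lemma sum_tens_eq_0:
  assumes V: "is_vs V" and W: "is_vs W" and U: "is_vs U" and b: "bilin V W U b"
    and fin: "finite I" and v: "\<And>i. i \<in> I \<Longrightarrow> v i \<in> car V" and w: "\<And>i. i \<in> I \<Longrightarrow> w i \<in> car W"
    and zero: "(\<Sum>i\<in>I. tens V W (v i) (w i)) = 0"
  shows "(\<Sum>i\<in>I. b (v i) (w i)) = 0"
proof -
  interpret V: vector_space "scl V" using V by (simp add: is_vs_def)
  interpret W: vector_space "scl W" using W by (simp add: is_vs_def)
  interpret U: vector_space "scl U" using U by (simp add: is_vs_def)
  have sW: "W.subspace (car W)" using W by (simp add: is_vs_def)
  obtain B where B: "B \<subseteq> car V" "V.independent B" "car V \<subseteq> V.span B"
    using V.maximal_independent_subset by blast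
  define E where "E = V.extend_basis B"
  have E: "V.independent E" "V.span E = UNIV" "B \<subseteq> E"
    using V.extend_basis_superset[OF B(2)] V.independent_extend_basis[OF B(2)]
      V.span_extend_basis[OF B(2)] by (auto simp: E_def)
  define f where "f = (\<lambda>e x. V.representation E x e)"
  have f_lin: "Vector_Spaces.linear (scl V) (*) (f e)" for e
    unfolding f_def using V.linear_representation[OF E(1,2)] .
  have f_rep: "f e x = V.representation B x e" if "x \<in> car V" for e x
  proof -
    have "x \<in> V.span B" using that B(3) by blast
    then show ?thesis unfolding f_def using V.representation_extend[OF E(1) _ E(3)] by simp
  qed
  define F where "F = (\<Union>i\<in>I. {e. V.representation B (v i) e \<noteq> 0})"
  have F: "finite F" "F \<subseteq> B"
    unfolding F_def by (auto intro!: fin V.finite_representation dest: V.representation_ne_zero)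
  have v_eq: "v i = (\<Sum>e\<in>F. scl V (f e (v i)) e)" if "i \<in> I" for i
  proof -
    have "v i = (\<Sum>e | V.representation B (v i) e \<noteq> 0. scl V (V.representation B (v i) e) e)"
      using V.sum_nonzero_representation_eq[OF B(2) subsetD[OF B(3) v[OF that]]] by simp
    also have "\<dots> = (\<Sum>e\<in>F. scl V (V.representation B (v i) e) e)"
      using F(1) that by (intro sum.mono_neutral_left) (auto simp: F_def)
    finally show ?thesis using f_rep v[OF that] by simp
  qed
  have key: "(\<Sum>i\<in>I. scl W (f e (v i)) (w i)) = 0" for e
  proof (rule linear_separates[OF W.vector_space_axioms])
    fix g assume g: "Vector_Spaces.linear (scl W) (*) g"
    interpret g: Vector_Spaces.linear "scl W" "(*)" g by fact
    have app: "(\<Sum>i\<in>J. tens V W (v i) (w i)) (f e) g = (\<Sum>i\<in>J. f e (v i) * g (w i))"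
      if "finite J" for J
      using that by (induction J rule: finite_induct) (auto simp: tens_def f_lin g)
    have "(\<Sum>i\<in>I. f e (v i) * g (w i)) = 0"
      using app[OF fin] zero by simp
    then show "g (\<Sum>i\<in>I. scl W (f e (v i)) (w i)) = 0"
      by (simp add: g.sum g.scale)
  qed
  have "(\<Sum>i\<in>I. b (v i) (w i)) = (\<Sum>i\<in>I. \<Sum>e\<in>F. b e (scl W (f e (v i)) (w i)))"
  proof (rule sum.cong[OF refl])
    fix i assume i: "i \<in> I"
    have l: "lin V U (\<lambda>x. b x (w i))" using b w[OF i] by (simp add: bilin_def)
    have eV: "e \<in> car V" if "e \<in> F" for e using F(2) B(1) that by blast
    have seV: "scl V c e \<in> car V" if "e \<in> F" for e c
      using eV[OF that] V V.subspace_scale by (auto simp: is_vs_def)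
    have "b (v i) (w i) = b (\<Sum>e\<in>F. scl V (f e (v i)) e) (w i)"
      using v_eq[OF i] by simp
    also have "\<dots> = (\<Sum>e\<in>F. b (scl V (f e (v i)) e) (w i))"
      using lin_sum[OF V U l F(1), of "\<lambda>e. scl V (f e (v i)) e"] seV by simp
    also have "\<dots> = (\<Sum>e\<in>F. b e (scl W (f e (v i)) (w i)))"
    proof (rule sum.cong[OF refl])
      fix e assume "e \<in> F"
      then have "e \<in> car V" by (rule eV)
      then show "b (scl V (f e (v i)) e) (w i) = b e (scl W (f e (v i)) (w i))"
        using b w[OF i] l by (simp add: bilin_def lin_def)
    qed
    finally show "b (v i) (w i) = \<dots>" .
  qed
  also have "\<dots> = (\<Sum>e\<in>F. \<Sum>i\<in>I. b e (scl W (f e (v i)) (w i)))"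
    by (rule sum.swap)
  also have "\<dots> = (\<Sum>e\<in>F. b e (\<Sum>i\<in>I. scl W (f e (v i)) (w i)))"
  proof (rule sum.cong[OF refl])
    fix e assume "e \<in> F"
    then have "lin W U (b e)" using b F(2) B(1) by (auto simp: bilin_def)
    moreover have "scl W (f e (v i)) (w i) \<in> car W" if "i \<in> I" for i
      using w[OF that] sW W.subspace_scale by blast
    ultimately show "(\<Sum>i\<in>I. b e (scl W (f e (v i)) (w i))) = b e (\<Sum>i\<in>I. scl W (f e (v i)) (w i))"
      using lin_sum[OF W U _ fin, of "b e" "\<lambda>i. scl W (f e (v i)) (w i)"] by simp
  qed
  also have "\<dots> = 0"
    using key b F(2) B(1) lin_0[OF W U] by (intro sum.neutral) (auto simp: bilin_def)
  finally show ?thesis .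
qed

lemma vector_space_tensor_scl: "vector_space (tensor_scl :: 'k::field \<Rightarrow> ('k, 'v, 'w) tensor \<Rightarrow> _)"
  by unfold_locales (auto simp: tensor_scl_def fun_eq_iff algebra_simps)

lemma is_vs_tensor_vs:
  fixes V :: "('k::field, 'v::ab_group_add, 'x) vspace_scheme"
    and W :: "('k, 'w::ab_group_add, 'y) vspace_scheme"
  shows "is_vs (tensor_vs V W)"
proof -
  interpret T: vector_space "tensor_scl :: 'k \<Rightarrow> ('k, 'v, 'w) tensor \<Rightarrow> _"
    by (rule vector_space_tensor_scl)
  show ?thesis by (simp add: is_vs_def tensor_vs_def vector_space_tensor_scl)
qed

lemma tens_arith:
  shows "tens V W (x + x') y = tens V W x y + tens V W x' y"
    and "tens V W x (y + y') = tens V W x y + tens V W x y'"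
    and "tens V W (scl V c x) y = tensor_scl c (tens V W x y)"
    and "tens V W x (scl W c y) = tensor_scl c (tens V W x y)"
proof -
  have *: "tens V W (x + x') y f g = tens V W x y f g + tens V W x' y f g \<and>
    tens V W x (y + y') f g = tens V W x y f g + tens V W x y' f g \<and>
    tens V W (scl V c x) y f g = c * tens V W x y f g \<and>
    tens V W x (scl W c y) f g = c * tens V W x y f g" for f g
  proof (cases "Vector_Spaces.linear (scl V) (*) f \<and> Vector_Spaces.linear (scl W) (*) g")
    case True
    interpret f: Vector_Spaces.linear "scl V" "(*)" f using True by blast
    interpret g: Vector_Spaces.linear "scl W" "(*)" g using True by blast
    have t: "tens V W a b f g = f a * g b" for a b unfolding tens_def by (rule if_P[OF True])
    show ?thesis unfolding t f.add f.scale g.add g.scale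
      by (intro conjI distrib_left distrib_right mult.assoc mult.left_commute)
  next
    case False
    then have "tens V W a b f g = 0" for a b unfolding tens_def by (rule if_not_P)
    then show ?thesis by simp
  qed
  show "tens V W (x + x') y = tens V W x y + tens V W x' y"
    "tens V W x (y + y') = tens V W x y + tens V W x y'"
    "tens V W (scl V c x) y = tensor_scl c (tens V W x y)"
    "tens V W x (scl W c y) = tensor_scl c (tens V W x y)"
    by (intro ext; simp add: * tensor_scl_def)+
qed

lemma bilin_tens:
  fixes V :: "('k::field, 'v::ab_group_add, 'x) vspace_scheme"
    and W :: "('k, 'w::ab_group_add, 'y) vspace_scheme"
  shows "bilin V W (tensor_vs V W) (tens V W)"
proof -
  interpret T: vector_space "tensor_scl :: 'k \<Rightarrow> ('k, 'v, 'w) tensor \<Rightarrow> _"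
    by (rule vector_space_tensor_scl)
  have "tens V W v w \<in> car (tensor_vs V W)" if "v \<in> car V" "w \<in> car W" for v w
    using that by (auto simp: tensor_vs_def intro!: T.span_base)
  then show ?thesis by (simp add: bilin_def lin_def tens_arith) (simp add: tensor_vs_def)
qed

lemma tensor_sum_exists:
  fixes V :: "('k::field, 'v::ab_group_add, 'x) vspace_scheme"
    and W :: "('k, 'w::ab_group_add, 'y) vspace_scheme"
  assumes V: "is_vs V" and t: "t \<in> car (tensor_vs V W)"
  shows "\<exists>(r::nat) v w. (\<forall>i<r. v i \<in> car V \<and> w i \<in> car W) \<and> t = (\<Sum>i<r. tens V W (v i) (w i))"
proof -
  interpret V: vector_space "scl V" using V by (simp add: is_vs_def)
  interpret T: vector_space "tensor_scl :: 'k \<Rightarrow> ('k, 'v, 'w) tensor \<Rightarrow> _"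
    by (rule vector_space_tensor_scl)
  have "t \<in> T.span {tens V W v w | v w. v \<in> car V \<and> w \<in> car W}"
    using t by (simp add: tensor_vs_def)
  then show ?thesis
  proof (induction rule: T.span_induct_alt)
    case base
    show ?case by (intro exI[of _ 0]) simp
  next
    case (step c x y)
    then obtain v0 w0 r v w where *: "v0 \<in> car V" "w0 \<in> car W" "x = tens V W v0 w0"
      "\<forall>i<(r::nat). v i \<in> car V \<and> w i \<in> car W" "y = (\<Sum>i<r. tens V W (v i) (w i))" by blast
    have cv: "scl V c v0 \<in> car V"
      using V *(1) V.subspace_scale by (auto simp: is_vs_def)
    have "tensor_scl c x = tens V W (scl V c v0) w0"
      unfolding *(3) by (simp add: tens_arith)
    then have "tensor_scl c x + y = (\<Sum>i<Suc r. tens V W ((v(r := scl V c v0)) i) ((w(r := w0)) i))"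
      using *(5) by (simp add: add.commute)
    moreover have "\<forall>i<Suc r. (v(r := scl V c v0)) i \<in> car V \<and> (w(r := w0)) i \<in> car W"
      using *(1,2,4) cv by (auto simp: less_Suc_eq)
    ultimately show ?case by blast
  qed
qed

lemma tlift_sum:
  fixes V :: "('k::field, 'v::ab_group_add, 'x) vspace_scheme"
    and W :: "('k, 'w::ab_group_add, 'y) vspace_scheme"
    and U :: "('k, 'u::ab_group_add, 'z) vspace_scheme"
  assumes V: "is_vs V" and W: "is_vs W" and U: "is_vs U" and b: "bilin V W U b"
    and fin: "finite I" and v: "\<And>i. i \<in> I \<Longrightarrow> v i \<in> car V" and w: "\<And>i. i \<in> I \<Longrightarrow> w i \<in> car W"
  shows "tlift V W b (\<Sum>i\<in>I. tens V W (v i) (w i)) = (\<Sum>i\<in>I. b (v i) (w i))"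
proof -
  interpret V: vector_space "scl V" using V by (simp add: is_vs_def)
  have bt: "bilin V W (tensor_vs V W) (tens V W)" by (rule bilin_tens)
  have neg: "c (- x) y = - c x y" if "bilin V W Z c" "is_vs Z" "x \<in> car V" "y \<in> car W"
    for Z :: "('k, 'p::ab_group_add) vspace" and c x y
  proof -
    interpret Z: vector_space "scl Z" using that by (simp add: is_vs_def)
    have "c (scl V (- 1) x) y = scl Z (- 1) (c x y)"
      using that unfolding bilin_def lin_def by blast
    then show ?thesis by simp
  qed
  have uniq: "y = (\<Sum>i\<in>I. b (v i) (w i))"
    if ex: "\<exists>(r::nat) v' w'. (\<forall>i<r. v' i \<in> car V \<and> w' i \<in> car W) \<and>
      (\<Sum>i\<in>I. tens V W (v i) (w i)) = (\<Sum>i<r. tens V W (v' i) (w' i)) \<and>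
      y = (\<Sum>i<r. b (v' i) (w' i))" for y
  proof -
    obtain r :: nat and v' w' where *: "\<forall>i<r. v' i \<in> car V \<and> w' i \<in> car W"
      "(\<Sum>i\<in>I. tens V W (v i) (w i)) = (\<Sum>i<r. tens V W (v' i) (w' i))"
      "y = (\<Sum>i<r. b (v' i) (w' i))" using ex by blast
    let ?J = "I <+> {..<r}"
    let ?v = "case_sum v (\<lambda>i. - v' i)" and ?w = "case_sum w w'"
    have nV: "- x \<in> car V" if "x \<in> car V" for x
      using V that V.subspace_neg by (auto simp: is_vs_def)
    have split: "(\<Sum>j\<in>?J. c (?v j) (?w j)) = (\<Sum>i\<in>I. c (v i) (w i)) - (\<Sum>i<r. c (v' i) (w' i))"
      if "bilin V W Z c" "is_vs Z" for Z :: "('k, 'p::ab_group_add) vspace" and c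
    proof -
      have "(\<Sum>i<r. c (- v' i) (w' i)) = (\<Sum>i<r. - c (v' i) (w' i))"
        using *(1) by (intro sum.cong refl neg[OF that]) auto
      then show ?thesis
        by (subst sum.Plus) (simp_all add: fin sum_negf del: uminus_apply)
    qed
    have "(\<Sum>j\<in>?J. tens V W (?v j) (?w j)) = 0"
      using split[OF bt is_vs_tensor_vs] *(2) by simp
    then have z: "(\<Sum>j\<in>?J. b (?v j) (?w j)) = 0"
    proof (rule sum_tens_eq_0[OF V W U b, rotated -1])
      show "finite ?J" using fin by simp
      show "?v j \<in> car V" if "j \<in> ?J" for j using that v nV *(1) by (auto split: sum.splits)
      show "?w j \<in> car W" if "j \<in> ?J" for j using that w *(1) by (auto split: sum.splits)
    qed
    define U' where "U' = \<lparr>car = car U, scl = scl U\<rparr>"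
    have "bilin V W U' b" "is_vs U'" using b U by (simp_all add: U'_def bilin_def lin_def is_vs_def)
    then show ?thesis using split[of U' b] z *(3) by simp
  qed
  have "(\<Sum>i\<in>I. tens V W (v i) (w i)) \<in> car (tensor_vs V W)"
    using lin_sum[OF is_vs_tensor_vs is_vs_tensor_vs, of V W V W id I "\<lambda>i. tens V W (v i) (w i)"]
      bt v w fin by (auto simp: lin_def bilin_def)
  then obtain r :: nat and v' w' where *: "\<forall>i<r. v' i \<in> car V \<and> w' i \<in> car W"
      "(\<Sum>i\<in>I. tens V W (v i) (w i)) = (\<Sum>i<r. tens V W (v' i) (w' i))"
    using tensor_sum_exists[OF V] by blast
  show ?thesis
    unfolding tlift_def
  proof (rule the_equality)
    show "\<exists>(r::nat) v' w'. (\<forall>i<r. v' i \<in> car V \<and> w' i \<in> car W) \<and>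
      (\<Sum>i\<in>I. tens V W (v i) (w i)) = (\<Sum>i<r. tens V W (v' i) (w' i)) \<and>
      (\<Sum>i\<in>I. b (v i) (w i)) = (\<Sum>i<r. b (v' i) (w' i))"
    proof (intro exI[of _ r] exI[of _ v'] exI[of _ w'] conjI)
      show "(\<Sum>i\<in>I. b (v i) (w i)) = (\<Sum>i<r. b (v' i) (w' i))"
        by (rule uniq[symmetric], intro exI[of _ r] exI[of _ v'] exI[of _ w'] conjI refl *)
    qed (rule *)+
  qed (rule uniq)
qed

theorem tensor_universal:
  fixes V :: "('k::field, 'v::ab_group_add, 'x) vspace_scheme"
    and W :: "('k, 'w::ab_group_add, 'y) vspace_scheme"
    and U :: "('k, 'u::ab_group_add, 'z) vspace_scheme"
  assumes V: "is_vs V" and W: "is_vs W" and U: "is_vs U" and b: "bilin V W U b"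
  shows "lin (tensor_vs V W) U (tlift V W b)"
    and "v \<in> car V \<Longrightarrow> w \<in> car W \<Longrightarrow> tlift V W b (tens V W v w) = b v w"
    and "lin (tensor_vs V W) U f \<Longrightarrow> (\<And>v w. v \<in> car V \<Longrightarrow> w \<in> car W \<Longrightarrow> f (tens V W v w) = b v w)
           \<Longrightarrow> t \<in> car (tensor_vs V W) \<Longrightarrow> f t = tlift V W b t"
proof -
  interpret V: vector_space "scl V" using V by (simp add: is_vs_def)
  interpret U: vector_space "scl U" using U by (simp add: is_vs_def)
  note ts = tlift_sum[OF V W U b]
  have bt: "bilin V W (tensor_vs V W) (tens V W)" by (rule bilin_tens)
  have bU: "b v w \<in> car U" if "v \<in> car V" "w \<in> car W" for v w
    using b that by (auto simp: bilin_def lin_def)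
  have UU: "lin U U id" by (simp add: lin_def)
  show "tlift V W b (tens V W v w) = b v w" if "v \<in> car V" "w \<in> car W" for v w
    using ts[of "{0::nat}" "\<lambda>_. v" "\<lambda>_. w"] that by simp
  show "f t = tlift V W b t"
    if f: "lin (tensor_vs V W) U f" "\<And>v w. v \<in> car V \<Longrightarrow> w \<in> car W \<Longrightarrow> f (tens V W v w) = b v w"
      and t: "t \<in> car (tensor_vs V W)" for f t
  proof -
    obtain r :: nat and v w where *: "\<forall>i<r. v i \<in> car V \<and> w i \<in> car W"
      "t = (\<Sum>i<r. tens V W (v i) (w i))" using tensor_sum_exists[OF V t] by blast
    have "f t = (\<Sum>i<r. f (tens V W (v i) (w i)))"
      using lin_sum[OF is_vs_tensor_vs U f(1), of "{..<r}" "\<lambda>i. tens V W (v i) (w i)"] *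
        bt by (auto simp: bilin_def lin_def)
    also have "\<dots> = tlift V W b t"
      using ts[of "{..<r}" v w] * f(2) by simp
    finally show ?thesis .
  qed
  show "lin (tensor_vs V W) U (tlift V W b)"
    unfolding lin_def
  proof (intro conjI ballI allI)
    fix t assume "t \<in> car (tensor_vs V W)"
    then obtain r :: nat and v w where *: "\<forall>i<r. v i \<in> car V \<and> w i \<in> car W"
      "t = (\<Sum>i<r. tens V W (v i) (w i))" using tensor_sum_exists[OF V] by blast
    have tl: "tlift V W b t = (\<Sum>i<r. b (v i) (w i))" using ts[of "{..<r}" v w] * by simp
    show "tlift V W b t \<in> car U"
      using tl lin_sum[OF U U UU, of "{..<r}" "\<lambda>i. b (v i) (w i)"] bU *(1) by auto
    fix c
    have cv: "scl V c (v i) \<in> car V" if "i < r" for i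
      using V * that V.subspace_scale by (auto simp: is_vs_def)
    interpret T: vector_space "tensor_scl :: 'k \<Rightarrow> ('k, 'v, 'w) tensor \<Rightarrow> _"
      by (rule vector_space_tensor_scl)
    have "scl (tensor_vs V W) c t = (\<Sum>i<r. tensor_scl c (tens V W (v i) (w i)))"
      unfolding *(2) by (simp add: tensor_vs_def T.scale_sum_right)
    also have "\<dots> = (\<Sum>i<r. tens V W (scl V c (v i)) (w i))"
      using bt *(1) by (intro sum.cong) (auto simp: bilin_def lin_def tensor_vs_def)
    finally have "tlift V W b (scl (tensor_vs V W) c t) = (\<Sum>i<r. b (scl V c (v i)) (w i))"
      using ts[of "{..<r}" "\<lambda>i. scl V c (v i)" w] * cv by simp
    also have "\<dots> = (\<Sum>i<r. scl U c (b (v i) (w i)))"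
      using b *(1) by (intro sum.cong) (auto simp: bilin_def lin_def)
    also have "\<dots> = scl U c (tlift V W b t)"
      by (simp add: tl U.scale_sum_right)
    finally show "tlift V W b (scl (tensor_vs V W) c t) = scl U c (tlift V W b t)" .
  next
    fix s t assume s: "s \<in> car (tensor_vs V W)" and t: "t \<in> car (tensor_vs V W)"
    obtain r :: nat and v w where
      r: "\<forall>i<r. v i \<in> car V \<and> w i \<in> car W" "s = (\<Sum>i<r. tens V W (v i) (w i))"
      using tensor_sum_exists[OF V s] by blast
    obtain q :: nat and v' w' where
      q: "\<forall>i<q. v' i \<in> car V \<and> w' i \<in> car W" "t = (\<Sum>i<q. tens V W (v' i) (w' i))"
      using tensor_sum_exists[OF V t] by blast
    note * = r q
    have st: "s + t = (\<Sum>j\<in>{..<r} <+> {..<q}. tens V W (case_sum v v' j) (case_sum w w' j))"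
      unfolding *(2,4) by (subst sum.Plus) simp_all
    have "tlift V W b (s + t) = (\<Sum>j\<in>{..<r} <+> {..<q}. b (case_sum v v' j) (case_sum w w' j))"
      unfolding st by (rule ts) (use *(1,3) in \<open>auto split: sum.splits\<close>)
    also have "\<dots> = (\<Sum>i<r. b (v i) (w i)) + (\<Sum>i<q. b (v' i) (w' i))"
      by (subst sum.Plus) simp_all
    also have "(\<Sum>i<r. b (v i) (w i)) = tlift V W b s"
      unfolding *(2) by (rule ts[symmetric]) (use *(1) in auto)
    also have "(\<Sum>i<q. b (v' i) (w' i)) = tlift V W b t"
      unfolding *(4) by (rule ts[symmetric]) (use *(3) in auto)
    finally show "tlift V W b (s + t) = tlift V W b s + tlift V W b t" .
  qed
qed


section \<open>Hopf algebras\<close>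

record ('k, 'h) hopf = "('k, 'h) vspace" +
  mul :: "'h \<Rightarrow> 'h \<Rightarrow> 'h"
  unt :: "'h"
  comul :: "'h \<Rightarrow> ('k, 'h, 'h) tensor"
  counit :: "'h \<Rightarrow> 'k"
  antip :: "'h \<Rightarrow> 'h"

definition is_algebra :: "('k::field, 'h::ab_group_add, 'x) hopf_scheme \<Rightarrow> bool" where
  "is_algebra H \<longleftrightarrow> is_vs H \<and> bilin H H H (mul H) \<and> unt H \<in> car H \<and>
     (\<forall>a\<in>car H. mul H (unt H) a = a \<and> mul H a (unt H) = a) \<and>
     (\<forall>a\<in>car H. \<forall>b\<in>car H. \<forall>c\<in>car H. mul H (mul H a b) c = mul H a (mul H b c))"

definition is_coalgebra :: "('k::field, 'h::ab_group_add, 'x) hopf_scheme \<Rightarrow> bool" where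
  "is_coalgebra H \<longleftrightarrow> is_vs H \<and> lin H (tensor_vs H H) (comul H) \<and> lin H ground (counit H) \<and>
     (\<forall>a\<in>car H.
        tassoc H H H (tmap H H (tensor_vs H H) H (comul H) id (comul H a)) =
          tmap H H H (tensor_vs H H) id (comul H) (comul H a) \<and>
        tlift H H (\<lambda>a1 a2. scl H (counit H a1) a2) (comul H a) = a \<and>
        tlift H H (\<lambda>a1 a2. scl H (counit H a2) a1) (comul H a) = a)"

definition tensor_mul :: "('k::field, 'h::ab_group_add, 'x) hopf_scheme \<Rightarrow>
    ('k, 'h, 'h) tensor \<Rightarrow> ('k, 'h, 'h) tensor \<Rightarrow> ('k, 'h, 'h) tensor" where
  "tensor_mul H s t =
     tlift H H (\<lambda>a b. tlift H H (\<lambda>c d. tens H H (mul H a c) (mul H b d)) t) s"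

definition hopf_algebra :: "('k::field, 'h::ab_group_add, 'x) hopf_scheme \<Rightarrow> bool" where
  "hopf_algebra H \<longleftrightarrow> is_algebra H \<and> is_coalgebra H \<and>
     comul H (unt H) = tens H H (unt H) (unt H) \<and> counit H (unt H) = 1 \<and>
     (\<forall>a\<in>car H. \<forall>b\<in>car H.
        comul H (mul H a b) = tensor_mul H (comul H a) (comul H b) \<and>
        counit H (mul H a b) = counit H a * counit H b) \<and>
     lin H H (antip H) \<and>
     (\<forall>a\<in>car H.
        tlift H H (\<lambda>a1 a2. mul H (antip H a1) a2) (comul H a) = scl H (counit H a) (unt H) \<and>
        tlift H H (\<lambda>a1 a2. mul H a1 (antip H a2)) (comul H a) = scl H (counit H a) (unt H))"

definition hopf_subalgebra :: "('k::field, 'h::ab_group_add, 'x) hopf_scheme \<Rightarrow> 'h set \<Rightarrow> bool" where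
  "hopf_subalgebra H A \<longleftrightarrow> A \<subseteq> car H \<and> Modules.module.subspace (scl H) A \<and>
     unt H \<in> A \<and> (\<forall>a\<in>A. \<forall>b\<in>A. mul H a b \<in> A) \<and>
     (\<forall>a\<in>A. comul H a \<in> car (tensor_vs (H\<lparr>car := A\<rparr>) (H\<lparr>car := A\<rparr>))) \<and>
     (\<forall>a\<in>A. antip H a \<in> A)"


section \<open>The dual Hopf algebra\<close>

definition cofinite_ideal :: "('k::field, 'h::ab_group_add, 'x) hopf_scheme \<Rightarrow> 'h set \<Rightarrow> bool" where
  "cofinite_ideal H I \<longleftrightarrow> I \<subseteq> car H \<and> Modules.module.subspace (scl H) I \<and>
     (\<forall>a\<in>car H. \<forall>x\<in>I. mul H a x \<in> I \<and> mul H x a \<in> I) \<and>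
     (\<exists>B. finite B \<and> B \<subseteq> car H \<and> Modules.module.span (scl H) (I \<union> B) = car H)"

text \<open>\<open>(H/I)\<^sup>*\<close> is identified with the functionals on \<open>H\<close> that vanish on \<open>I\<close>.\<close>

definition fin_dual_vs :: "('k::field, 'h::ab_group_add, 'x) hopf_scheme \<Rightarrow> ('k, 'h \<Rightarrow> 'k) vspace" where
  "fin_dual_vs H = \<lparr>car = (\<Union>I\<in>{I. cofinite_ideal H I}. {f \<in> car (dual_vs H). \<forall>x\<in>I. f x = 0}),
     scl = scl (dual_vs H)\<rparr>"

definition fin_dual :: "('k::field, 'h::ab_group_add, 'x) hopf_scheme \<Rightarrow> ('k, 'h \<Rightarrow> 'k) hopf" where
  "fin_dual H = \<lparr>car = car (fin_dual_vs H), scl = scl (fin_dual_vs H),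
     mul = (\<lambda>f g h. if h \<in> car H then tlift H H (\<lambda>h1 h2. f h1 * g h2) (comul H h) else 0),
     unt = (\<lambda>h. if h \<in> car H then counit H h else 0),
     comul = (\<lambda>f. THE t. t \<in> car (tensor_vs (fin_dual_vs H) (fin_dual_vs H)) \<and>
        (\<forall>a\<in>car H. \<forall>b\<in>car H.
           tlift (fin_dual_vs H) (fin_dual_vs H) (\<lambda>f1 f2. f1 a * f2 b) t = f (mul H a b))),
     counit = (\<lambda>f. f (unt H)),
     antip = (\<lambda>f h. if h \<in> car H then f (antip H h) else 0)\<rparr>"


section \<open>Finite-dimensional left modules\<close>

record ('k, 'h, 'v) lmod = "('k, 'v) vspace" +
  act :: "'h \<Rightarrow> 'v \<Rightarrow> 'v"

definition mod_obj :: "('k::field, 'h::ab_group_add, 'x) hopf_scheme \<Rightarrow>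
    ('k, 'h, 'v::ab_group_add) lmod set" where
  "mod_obj H = {X. fin_dim_vs X \<and> bilin H X X (act X) \<and>
     (\<forall>x\<in>car X. act X (unt H) x = x) \<and>
     (\<forall>a\<in>car H. \<forall>b\<in>car H. \<forall>x\<in>car X. act X (mul H a b) x = act X a (act X b x)) \<and>
     (\<forall>a x. a \<notin> car H \<or> x \<notin> car X \<longrightarrow> act X a x = 0)}"

definition mod_hom :: "('k::field, 'h::ab_group_add, 'x) hopf_scheme \<Rightarrow>
    ('k, 'h, 'v::ab_group_add) lmod \<Rightarrow> ('k, 'h, 'w::ab_group_add) lmod \<Rightarrow> ('v \<Rightarrow> 'w) set" where
  "mod_hom H X Y = {f. lin X Y f \<and> (\<forall>a\<in>car H. \<forall>x\<in>car X. f (act X a x) = act Y a (f x)) \<and>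
     (\<forall>x. x \<notin> car X \<longrightarrow> f x = 0)}"

definition mod_iso :: "('k::field, 'h::ab_group_add, 'x) hopf_scheme \<Rightarrow>
    ('k, 'h, 'v::ab_group_add) lmod \<Rightarrow> ('k, 'h, 'w::ab_group_add) lmod \<Rightarrow> bool" where
  "mod_iso H X Y \<longleftrightarrow> (\<exists>f\<in>mod_hom H X Y. bij_betw f (car X) (car Y))"

definition mod_unit :: "('k::field, 'h::ab_group_add, 'x) hopf_scheme \<Rightarrow> ('k, 'h, 'k) lmod" where
  "mod_unit H = \<lparr>car = UNIV, scl = (*),
     act = (\<lambda>h c. if h \<in> car H then counit H h * c else 0)\<rparr>"

definition mod_tensor :: "('k::field, 'h::ab_group_add, 'x) hopf_scheme \<Rightarrow>
    ('k, 'h, 'v::ab_group_add) lmod \<Rightarrow> ('k, 'h, 'w::ab_group_add) lmod \<Rightarrow>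
    ('k, 'h, ('k, 'v, 'w) tensor) lmod" where
  "mod_tensor H X Y = \<lparr>car = car (tensor_vs X Y), scl = scl (tensor_vs X Y),
     act = (\<lambda>h t. if h \<in> car H \<and> t \<in> car (tensor_vs X Y)
       then tlift H H (\<lambda>h1 h2. tmap X Y X Y (act X h1) (act Y h2) t) (comul H h) else 0)\<rparr>"

definition mod_ldual :: "('k::field, 'h::ab_group_add, 'x) hopf_scheme \<Rightarrow>
    ('k, 'h, 'v::ab_group_add) lmod \<Rightarrow> ('k, 'h, 'v \<Rightarrow> 'k) lmod" where
  "mod_ldual H X = \<lparr>car = car (dual_vs X), scl = scl (dual_vs X),
     act = (\<lambda>h f x. if h \<in> car H \<and> f \<in> car (dual_vs X) \<and> x \<in> car X
       then f (act X (antip H h) x) else 0)\<rparr>"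

definition mod_zero :: "('k::field, 'h, 'v::ab_group_add) lmod \<Rightarrow> bool" where
  "mod_zero X \<longleftrightarrow> car X = {0}"

definition mod_sum :: "('k::field, 'h::ab_group_add, 'v::ab_group_add) lmod \<Rightarrow>
    ('k, 'h, 'w::ab_group_add) lmod \<Rightarrow> ('k, 'h, 'v \<times> 'w) lmod" where
  "mod_sum X Y = \<lparr>car = car X \<times> car Y, scl = (\<lambda>c (x, y). (scl X c x, scl Y c y)),
     act = (\<lambda>h (x, y). if x \<in> car X \<and> y \<in> car Y then (act X h x, act Y h y) else 0)\<rparr>"

definition subquotient :: "('k::field, 'h::ab_group_add, 'x) hopf_scheme \<Rightarrow>
    ('k, 'h, 'v::ab_group_add) lmod \<Rightarrow> ('k, 'h, 'w::ab_group_add) lmod \<Rightarrow> bool" where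
  "subquotient H X L \<longleftrightarrow> (\<exists>A :: ('k, 'h, 'w) lmod. A \<in> mod_obj H \<and>
     (\<exists>i\<in>mod_hom H A L. inj_on i (car A)) \<and> (\<exists>q\<in>mod_hom H A X. q ` car A = car X))"


section \<open>The tensor subcategory generated by a module\<close>

text \<open>The constructions above change the type of the underlying space.  Every finite-dimensional
  module is isomorphic to one whose carrier has type \<open>nat \<Rightarrow> 'k\<close>, so the iterated duals, tensor
  products and direct sums are formed up to isomorphism inside this type.\<close>

inductive iter_ldual :: "('k::field, 'h::ab_group_add, 'x) hopf_scheme \<Rightarrow>
    ('k, 'h, 'm::ab_group_add) lmod \<Rightarrow> ('k, 'h, nat \<Rightarrow> 'k) lmod \<Rightarrow> bool" for H M where
  base: "X \<in> mod_obj H \<Longrightarrow> mod_iso H M X \<Longrightarrow> iter_ldual H M X"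
| dual: "iter_ldual H M X \<Longrightarrow> Y \<in> mod_obj H \<Longrightarrow> mod_iso H (mod_ldual H X) Y \<Longrightarrow> iter_ldual H M Y"

inductive tensor_word :: "('k::field, 'h::ab_group_add, 'x) hopf_scheme \<Rightarrow>
    ('k, 'h, 'm::ab_group_add) lmod \<Rightarrow> ('k, 'h, nat \<Rightarrow> 'k) lmod \<Rightarrow> bool" for H M where
  unit: "L \<in> mod_obj H \<Longrightarrow> mod_iso H (mod_unit H) L \<Longrightarrow> tensor_word H M L"
| tensor: "iter_ldual H M X \<Longrightarrow> tensor_word H M Y \<Longrightarrow> L \<in> mod_obj H \<Longrightarrow>
    mod_iso H (mod_tensor H X Y) L \<Longrightarrow> tensor_word H M L"

inductive sum_of_words :: "('k::field, 'h::ab_group_add, 'x) hopf_scheme \<Rightarrow>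
    ('k, 'h, 'm::ab_group_add) lmod \<Rightarrow> ('k, 'h, nat \<Rightarrow> 'k) lmod \<Rightarrow> bool" for H M where
  zero: "L \<in> mod_obj H \<Longrightarrow> mod_zero L \<Longrightarrow> sum_of_words H M L"
| sum: "tensor_word H M X \<Longrightarrow> sum_of_words H M Y \<Longrightarrow> L \<in> mod_obj H \<Longrightarrow>
    mod_iso H (mod_sum X Y) L \<Longrightarrow> sum_of_words H M L"

definition gen_obj :: "('k::field, 'h::ab_group_add, 'x) hopf_scheme \<Rightarrow>
    ('k, 'h, 'm::ab_group_add) lmod \<Rightarrow> ('k, 'h, 'v::ab_group_add) lmod set" where
  "gen_obj H M = {X \<in> mod_obj H. \<exists>L. sum_of_words H M L \<and> subquotient H X L}"


section \<open>Finite-dimensional right comodules\<close>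

record ('k, 'a, 'v) rcomod = "('k, 'v) vspace" +
  coact :: "'v \<Rightarrow> ('k, 'v, 'a) tensor"

definition comod_obj :: "('k::field, 'a::ab_group_add, 'x) hopf_scheme \<Rightarrow>
    ('k, 'a, 'v::ab_group_add) rcomod set" where
  "comod_obj D = {X. fin_dim_vs X \<and> lin X (tensor_vs X D) (coact X) \<and>
     (\<forall>x\<in>car X.
        tassoc X D D (tmap X D (tensor_vs X D) D (coact X) id (coact X x)) =
          tmap X D X (tensor_vs D D) id (comul D) (coact X x) \<and>
        tlift X D (\<lambda>x0 d. scl X (counit D d) x0) (coact X x) = x) \<and>
     (\<forall>x. x \<notin> car X \<longrightarrow> coact X x = 0)}"

definition comod_hom :: "('k::field, 'a::ab_group_add, 'x) hopf_scheme \<Rightarrow>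
    ('k, 'a, 'v::ab_group_add) rcomod \<Rightarrow> ('k, 'a, 'w::ab_group_add) rcomod \<Rightarrow> ('v \<Rightarrow> 'w) set" where
  "comod_hom D X Y = {f. lin X Y f \<and>
     (\<forall>x\<in>car X. coact Y (f x) = tmap X D Y D f id (coact X x)) \<and>
     (\<forall>x. x \<notin> car X \<longrightarrow> f x = 0)}"

definition comod_unit :: "('k::field, 'a::ab_group_add, 'x) hopf_scheme \<Rightarrow> ('k, 'a, 'k) rcomod" where
  "comod_unit D = \<lparr>car = UNIV, scl = (*), coact = (\<lambda>c. tens ground D c (unt D))\<rparr>"

definition comod_tensor :: "('k::field, 'a::ab_group_add, 'x) hopf_scheme \<Rightarrow>
    ('k, 'a, 'v::ab_group_add) rcomod \<Rightarrow> ('k, 'a, 'w::ab_group_add) rcomod \<Rightarrow>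
    ('k, 'a, ('k, 'v, 'w) tensor) rcomod" where
  "comod_tensor D X Y = \<lparr>car = car (tensor_vs X Y), scl = scl (tensor_vs X Y),
     coact = (\<lambda>t. if t \<in> car (tensor_vs X Y)
       then tlift X Y (\<lambda>x y.
              tlift X D (\<lambda>x0 x1.
                tlift Y D (\<lambda>y0 y1. tens (tensor_vs X Y) D (tens X Y x0 y0) (mul D x1 y1)) (coact Y y))
              (coact X x)) t
       else 0)\<rparr>"


section \<open>The tensor isomorphism\<close>

text \<open>On objects; on morphisms the isomorphism is the identity.  The coaction is determined by
  \<open>h x = \<Sum> x\<^sub>0 \<langle>x\<^sub>1, h\<rangle>\<close>.\<close>

definition to_comod :: "('k::field, 'h::ab_group_add, 'x) hopf_scheme \<Rightarrow>
    ('k, 'h, 'v::ab_group_add) lmod \<Rightarrow> ('k, 'h \<Rightarrow> 'k, 'v) rcomod" where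
  "to_comod H X = \<lparr>car = car X, scl = scl X,
     coact = (\<lambda>x. if x \<in> car X
       then (THE t. t \<in> car (tensor_vs X (fin_dual H)) \<and>
               (\<forall>h\<in>car H. act X h x = tlift X (fin_dual H) (\<lambda>x0 x1. scl X (x1 h) x0) t))
       else 0)\<rparr>"


section \<open>Matrix representations and co-representation Hopf algebras\<close>

definition matrix_rep :: "('k::field, 'h::ab_group_add, 'x) hopf_scheme \<Rightarrow> nat \<Rightarrow>
    ('h \<Rightarrow> 'k mat) \<Rightarrow> bool" where
  "matrix_rep H n \<pi> \<longleftrightarrow> (\<forall>a\<in>car H. \<pi> a \<in> carrier_mat n n) \<and>
     (\<forall>a\<in>car H. \<forall>b\<in>car H. \<pi> (a + b) = \<pi> a + \<pi> b \<and> \<pi> (mul H a b) = \<pi> a * \<pi> b) \<and>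
     (\<forall>c. \<forall>a\<in>car H. \<pi> (scl H c a) = c \<cdot>\<^sub>m \<pi> a) \<and> \<pi> (unt H) = 1\<^sub>m n"

definition matrix_rep_of :: "('k::field, 'h::ab_group_add, 'x) hopf_scheme \<Rightarrow>
    ('k, 'h, 'm::ab_group_add) lmod \<Rightarrow> nat \<Rightarrow> ('h \<Rightarrow> 'k mat) \<Rightarrow> bool" where
  "matrix_rep_of H M n \<pi> \<longleftrightarrow> matrix_rep H n \<pi> \<and>
     (\<exists>e. inj_on e {..<n} \<and> \<not> Modules.module.dependent (scl M) (e ` {..<n}) \<and>
        Modules.module.span (scl M) (e ` {..<n}) = car M \<and>
        (\<forall>h\<in>car H. \<forall>j<n. act M h (e j) = (\<Sum>i<n. scl M (\<pi> h $$ (i, j)) (e i))))"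

definition coeff :: "('k::field, 'h::ab_group_add, 'x) hopf_scheme \<Rightarrow> ('h \<Rightarrow> 'k mat) \<Rightarrow>
    nat \<Rightarrow> nat \<Rightarrow> 'h \<Rightarrow> 'k" where
  "coeff H \<pi> i j = (\<lambda>h. if h \<in> car H then \<pi> h $$ (i, j) else 0)"

definition cf :: "('k::field, 'h::ab_group_add, 'x) hopf_scheme \<Rightarrow> nat \<Rightarrow> ('h \<Rightarrow> 'k mat) \<Rightarrow>
    ('h \<Rightarrow> 'k) set" where
  "cf H n \<pi> = Modules.module.span (scl (fin_dual H)) {coeff H \<pi> i j | i j. i < n \<and> j < n}"

definition corep_hopf :: "('k::field, 'h::ab_group_add, 'x) hopf_scheme \<Rightarrow> nat \<Rightarrow>
    ('h \<Rightarrow> 'k mat) \<Rightarrow> ('k, 'h \<Rightarrow> 'k) hopf" where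
  "corep_hopf H n \<pi> =
     (fin_dual H)\<lparr>car := \<Inter>{A. hopf_subalgebra (fin_dual H) A \<and> cf H n \<pi> \<subseteq> A}\<rparr>"

end

theory Submission
  imports Defs
begin

text \<open>
  In a basis \<open>e\<^sub>1, \<dots>, e\<^sub>n\<close> a module \<open>X\<close> is given by a matrix of functionals
  \<open>c i j\<close> on \<open>H\<close>, its coefficients.  The corresponding coaction sends \<open>e\<^sub>j\<close> to
  \<open>\<Sum>\<^sub>i e\<^sub>i \<otimes> c i j\<close>; it is the only map whose evaluation at each \<open>h\<close> is the action of \<open>h\<close>, because
  evaluation at the points of \<open>H\<close> separates the elements of \<open>X \<otimes> H\<degree>\<close>
  (\<open>tensor_eval_unique\<close>).  Uniqueness of this kind gives the statements about morphisms, tensor products and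
  the unit object.  It also shows that \<open>X\<close> is a comodule over a Hopf subalgebra \<open>A\<close> of \<open>H\<degree>\<close>
  exactly if its coefficients lie in \<open>A\<close>.  What has to be proved is therefore that the modules
  generated by \<open>M\<close> are those with coefficients in the co-representation Hopf algebra.

  Let \<open>W\<close> be the span of the coefficients of all words, that is of all tensor products of iterated duals
  of \<open>M\<close> (\<open>word_span\<close>).  The coefficients of a tensor product are spanned by products of
  coefficients, those of a left dual are the images of coefficients under the antipode, and
  \<open>\<Delta> (c i j) = \<Sum>\<^sub>k c i k \<otimes> c k j\<close>.  Hence \<open>W\<close> is contained in every Hopf subalgebra that
  contains the coefficients of \<open>M\<close> (\<open>word_span_least\<close>), and it is itself a Hopf subalgebra
  (\<open>hopf_subalgebra_word_span\<close>), so it is the co-representation Hopf algebra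
  (\<open>car_corep_hopf\<close>).  The critical point is that \<open>W\<close> is closed under the antipode, for which
  \<open>S (f g) = S g \<cdot> S f\<close> is needed.  For coefficients this is linear algebra (\<open>Sd_conv\<close>): the matrix
  \<open>S (c i j)\<close> is the inverse of \<open>c\<close> over the algebra of functionals, and the matrix inverse to the
  one of \<open>X \<otimes> Y\<close> can be computed in two ways.

  Direct sums and subquotients do not enlarge the span of coefficients, so the coefficients of a generated module
  lie in \<open>W\<close> (\<open>gen_obj_coefs\<close>).  Conversely let the coefficients of \<open>X\<close> lie in \<open>W\<close>
  (\<open>gen_objI\<close>).  There are a direct sum \<open>L\<close> of words and vectors
  \<open>l\<^sub>1, \<dots>, l\<^sub>n\<close> of \<open>L\<close> such that \<open>\<Sum> h\<^sub>p l\<^sub>p = 0\<close> forces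
  \<open>h\<^sub>p e\<^sub>p = 0\<close> for all \<open>p\<close>: as each coefficient of \<open>X\<close> is a combination of
  coefficients of words, it suffices to add finitely many words, each with one vector placed at one position.
  Then \<open>X\<close> is the image of the submodule of all \<open>\<Sum> h\<^sub>p l\<^sub>p\<close> under
  \<open>\<Sum> h\<^sub>p l\<^sub>p \<mapsto> \<Sum> h\<^sub>p e\<^sub>p\<close>, hence a subquotient of \<open>L\<close>.
\<close>

section \<open>Vector spaces, linear maps and coordinates\<close>

lemma sum_fun_apply: "(\<Sum>i\<in>I. f i) x = (\<Sum>i\<in>I. f i x)"
  by (induction I rule: infinite_finite_induct) auto

lemma vs_mem:
  assumes "is_vs V"
  shows vs_zero: "0 \<in> car V"
    and vs_add: "x \<in> car V \<Longrightarrow> y \<in> car V \<Longrightarrow> x + y \<in> car V"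
    and vs_diff: "x \<in> car V \<Longrightarrow> y \<in> car V \<Longrightarrow> x - y \<in> car V"
    and vs_scale: "x \<in> car V \<Longrightarrow> scl V c x \<in> car V"
    and vs_sum: "(\<And>i. i \<in> I \<Longrightarrow> z i \<in> car V) \<Longrightarrow> sum z I \<in> car V"
proof -
  interpret V: vector_space "scl V" using assms by (simp add: is_vs_def)
  have s: "V.subspace (car V)" using assms by (simp add: is_vs_def)
  show "0 \<in> car V" "x \<in> car V \<Longrightarrow> y \<in> car V \<Longrightarrow> x + y \<in> car V"
    "x \<in> car V \<Longrightarrow> y \<in> car V \<Longrightarrow> x - y \<in> car V" "x \<in> car V \<Longrightarrow> scl V c x \<in> car V"
    "(\<And>i. i \<in> I \<Longrightarrow> z i \<in> car V) \<Longrightarrow> sum z I \<in> car V"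
    by (rule V.subspace_0[OF s] V.subspace_add[OF s] V.subspace_diff[OF s] V.subspace_scale[OF s]
        V.subspace_sum[OF s]; assumption)+
qed

lemma ground_simps [simp]: "car ground = UNIV" "scl ground = (*)"
  by (simp_all add: ground_def)

lemma vector_space_mult: "vector_space ((*) :: 'k::field \<Rightarrow> 'k \<Rightarrow> 'k)"
  by unfold_locales (auto simp: algebra_simps)

lemma is_vs_ground: "is_vs (ground :: ('k::field, 'k) vspace)"
proof -
  interpret vector_space "(*) :: 'k \<Rightarrow> _" by (rule vector_space_mult)
  show ?thesis by (simp add: is_vs_def vector_space_axioms)
qed

lemma linD:
  assumes "lin V W f"
  shows lin_mem: "x \<in> car V \<Longrightarrow> f x \<in> car W"
    and lin_add: "x \<in> car V \<Longrightarrow> y \<in> car V \<Longrightarrow> f (x + y) = f x + f y"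
    and lin_scale: "x \<in> car V \<Longrightarrow> f (scl V c x) = scl W c (f x)"
  using assms by (auto simp: lin_def)

lemma linI:
  assumes "\<And>x. x \<in> car V \<Longrightarrow> f x \<in> car W"
    and "\<And>x y. x \<in> car V \<Longrightarrow> y \<in> car V \<Longrightarrow> f (x + y) = f x + f y"
    and "\<And>c x. x \<in> car V \<Longrightarrow> f (scl V c x) = scl W c (f x)"
  shows "lin V W f"
  using assms by (auto simp: lin_def)

lemma lin_setsum:
  assumes "is_vs V" "is_vs W" "lin V W f" "\<And>i. i \<in> I \<Longrightarrow> x i \<in> car V"
  shows "f (\<Sum>i\<in>I. x i) = (\<Sum>i\<in>I. f (x i))"
proof (cases "finite I")
  case True
  then show ?thesis using lin_sum[OF assms(1-3)] assms(4) by blast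
qed (simp add: lin_0[OF assms(1-3)])

lemma lin_diff:
  assumes "is_vs V" "lin V W f" "x \<in> car V" "y \<in> car V"
  shows "f (x - y) = f x - f y"
proof -
  have "f ((x - y) + y) = f (x - y) + f y"
    by (rule lin_add[OF assms(2) vs_diff[OF assms(1,3,4)] assms(4)])
  then show ?thesis by (simp add: algebra_simps)
qed

lemma lin_comp:
  assumes "lin U V f" "lin V W g"
  shows "lin U W (\<lambda>x. g (f x))"
  using assms by (auto simp: lin_def)

lemma lin_id: "car V \<subseteq> car W \<Longrightarrow> scl W = scl V \<Longrightarrow> lin V W (\<lambda>x. x)"
  by (auto simp: lin_def)

lemma lin_sum_fun:
  assumes "is_vs W" "\<And>i. i \<in> I \<Longrightarrow> lin V W (f i)"
  shows "lin V W (\<lambda>x. \<Sum>i\<in>I. f i x)"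
proof -
  interpret W: vector_space "scl W" using assms by (simp add: is_vs_def)
  show ?thesis
    using assms
    by (intro linI) (auto simp: lin_def sum.distrib W.scale_sum_right intro!: vs_sum sum.cong)
qed

lemma lin_scale_fun:
  assumes "is_vs W" "lin V W f"
  shows "lin V W (\<lambda>x. scl W c (f x))"
proof -
  interpret W: vector_space "scl W" using assms by (simp add: is_vs_def)
  show ?thesis
    using assms by (intro linI) (auto simp: lin_def W.scale_right_distrib mult.commute intro!: vs_scale)
qed

lemma lin_ground_mult:
  "lin V ground f \<Longrightarrow> lin V ground (\<lambda>x. f x * c)" "lin V ground f \<Longrightarrow> lin V ground (\<lambda>x. c * f x)"
  by (auto simp: lin_def algebra_simps)

lemma lin_ground_scl:
  assumes "is_vs V" "v \<in> car V" "lin U ground f"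
  shows "lin U V (\<lambda>u. scl V (f u) v)"
proof -
  interpret V: vector_space "scl V" using assms by (simp add: is_vs_def)
  show ?thesis using assms by (intro linI) (auto simp: lin_def V.scale_left_distrib intro: vs_scale)
qed

lemma bilinD:
  assumes "bilin U V W b"
  shows bilin_right: "x \<in> car U \<Longrightarrow> lin V W (b x)"
    and bilin_left: "y \<in> car V \<Longrightarrow> lin U W (\<lambda>x. b x y)"
    and bilin_mem: "x \<in> car U \<Longrightarrow> y \<in> car V \<Longrightarrow> b x y \<in> car W"
  using assms by (auto simp: bilin_def lin_def)

lemma bilinI:
  assumes "\<And>x. x \<in> car U \<Longrightarrow> lin V W (b x)" "\<And>y. y \<in> car V \<Longrightarrow> lin U W (\<lambda>x. b x y)"
  shows "bilin U V W b"
  using assms by (auto simp: bilin_def)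

lemma bilin_comp:
  assumes "bilin U V W b" "lin U' U f" "lin V' V g"
  shows "bilin U' V' W (\<lambda>x y. b (f x) (g y))"
  using assms by (auto simp: bilin_def lin_def)

lemma bilin_mono:
  assumes "bilin U' V' W b" "car U \<subseteq> car U'" "car V \<subseteq> car V'" "scl U' = scl U" "scl V' = scl V"
  shows "bilin U V W b"
  using bilin_comp[OF assms(1) lin_id[OF assms(2,4)] lin_id[OF assms(3,5)]] .

lemma lin_bilin:
  assumes "bilin U V W b" "lin W W' f"
  shows "bilin U V W' (\<lambda>x y. f (b x y))"
  using assms by (auto simp: bilin_def lin_def)

lemma bilin_mult:
  "lin U ground f \<Longrightarrow> lin V ground g \<Longrightarrow> bilin U V ground (\<lambda>x y. f x * g y)"
  by (auto simp: bilin_def lin_def algebra_simps)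

lemma bilin_scl:
  assumes "is_vs V" "lin W ground f"
  shows "bilin V W V (\<lambda>v w. scl V (f w) v)"
proof (rule bilinI)
  show "lin V V (\<lambda>v. scl V (f w) v)" for w
    by (rule lin_scale_fun[OF assms(1)]) (simp add: lin_id)
qed (use assms lin_ground_scl in blast)

lemma is_vs_cong: "car V = car W \<Longrightarrow> scl V = scl W \<Longrightarrow> is_vs V = is_vs W"
  by (simp add: is_vs_def)

lemma lin_cong:
  "car V = car V' \<Longrightarrow> scl V = scl V' \<Longrightarrow> car U = car U' \<Longrightarrow> scl U = scl U' \<Longrightarrow> lin V U f = lin V' U' f"
  by (simp add: lin_def)

lemma lin_cong_fun:
  "is_vs V \<Longrightarrow> lin V W g \<Longrightarrow> (\<And>x. x \<in> car V \<Longrightarrow> f x = g x) \<Longrightarrow> lin V W f"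
  using vs_add[of V] vs_scale[of V] by (simp add: lin_def)

lemma bilin_cong_fun:
  assumes "is_vs U" "is_vs V" "bilin U V W b'" "\<And>x y. x \<in> car U \<Longrightarrow> y \<in> car V \<Longrightarrow> b x y = b' x y"
  shows "bilin U V W b"
  by (rule bilinI; rule lin_cong_fun) (use assms bilin_right[OF assms(3)] bilin_left[OF assms(3)] in auto)

text \<open>A basis \<open>e\<close> together with its coordinate functionals \<open>\<phi>\<close>.  Carrying the coordinates
  along makes matrix coefficients explicit; arbitrary index types spare the re-indexing for tensor products and direct
  sums.\<close>

definition coord_basis :: "('k::field, 'v::ab_group_add, 'x) vspace_scheme \<Rightarrow> 'i set \<Rightarrow> ('i \<Rightarrow> 'v) \<Rightarrow>
    ('i \<Rightarrow> 'v \<Rightarrow> 'k) \<Rightarrow> bool" where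
  "coord_basis V I e \<phi> \<longleftrightarrow> finite I \<and> (\<forall>i\<in>I. e i \<in> car V \<and> lin V ground (\<phi> i)) \<and>
     (\<forall>i\<in>I. \<forall>j\<in>I. \<phi> i (e j) = (if i = j then 1 else 0)) \<and>
     (\<forall>x\<in>car V. x = (\<Sum>i\<in>I. scl V (\<phi> i x) (e i)))"

lemma coord_basisD:
  assumes "coord_basis V I e \<phi>"
  shows coord_finite: "finite I" and coord_mem: "i \<in> I \<Longrightarrow> e i \<in> car V"
    and coord_lin: "i \<in> I \<Longrightarrow> lin V ground (\<phi> i)"
    and coord_delta: "i \<in> I \<Longrightarrow> j \<in> I \<Longrightarrow> \<phi> i (e j) = (if i = j then 1 else 0)"
    and coord_expand: "x \<in> car V \<Longrightarrow> x = (\<Sum>i\<in>I. scl V (\<phi> i x) (e i))"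
  using assms unfolding coord_basis_def by blast+

lemma coord_lin_expand:
  assumes "is_vs V" "is_vs W" "coord_basis V I e \<phi>" "lin V W f" "x \<in> car V"
  shows "f x = (\<Sum>i\<in>I. scl W (\<phi> i x) (f (e i)))"
proof -
  have "f x = f (\<Sum>i\<in>I. scl V (\<phi> i x) (e i))" by (rule arg_cong[OF coord_expand[OF assms(3,5)]])
  also have "\<dots> = (\<Sum>i\<in>I. f (scl V (\<phi> i x) (e i)))"
    using assms by (intro lin_setsum[OF assms(1,2,4)] vs_scale coord_mem)
  also have "\<dots> = (\<Sum>i\<in>I. scl W (\<phi> i x) (f (e i)))"
    using lin_scale[OF assms(4)] coord_mem[OF assms(3)] by (intro sum.cong) auto
  finally show ?thesis .
qed

lemma lin_eq_on_basis:
  assumes "is_vs V" "is_vs W" "coord_basis V I e \<phi>" "lin V W f" "lin V W g"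
    "\<And>i. i \<in> I \<Longrightarrow> f (e i) = g (e i)" "x \<in> car V"
  shows "f x = g x"
  unfolding coord_lin_expand[OF assms(1-4,7)] coord_lin_expand[OF assms(1-3,5,7)]
  using assms(6) by simp

lemma coord_basis_fin_dim:
  assumes "is_vs V" "coord_basis V I e \<phi>"
  shows "fin_dim_vs V"
proof -
  interpret V: vector_space "scl V" using assms by (simp add: is_vs_def)
  have "V.span (e ` I) = car V"
  proof
    show "V.span (e ` I) \<subseteq> car V"
      using assms coord_mem[OF assms(2)] by (intro V.span_minimal) (auto simp: is_vs_def)
    show "car V \<subseteq> V.span (e ` I)"
    proof
      fix x assume "x \<in> car V"
      then have "x = (\<Sum>i\<in>I. scl V (\<phi> i x) (e i))" using coord_expand[OF assms(2)] by blast
      also have "\<dots> \<in> V.span (e ` I)"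
        by (intro V.span_sum V.span_scale V.span_base) auto
      finally show "x \<in> V.span (e ` I)" .
    qed
  qed
  then show ?thesis
    using assms(1) coord_mem[OF assms(2)] coord_finite[OF assms(2)] unfolding fin_dim_vs_def
    by (intro conjI exI[of _ "e ` I"]) auto
qed

lemma coord_basis_of_independent:
  assumes V: "is_vs V" and I: "finite I" "inj_on e I" "\<not> Modules.module.dependent (scl V) (e ` I)"
    "Modules.module.span (scl V) (e ` I) = car V"
  obtains \<phi> where "coord_basis V I e \<phi>"
proof
  interpret V: vector_space "scl V" using V by (simp add: is_vs_def)
  define \<phi> where "\<phi> = (\<lambda>i x. V.representation (e ` I) x (e i))"
  have m: "e i \<in> car V" if "i \<in> I" for i using I(4) V.span_base that by blast
  have "\<phi> i (e j) = (if i = j then 1 else 0)" if "i \<in> I" "j \<in> I" for i j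
    using V.representation_basis[OF I(3), of "e j"] that I(2) by (auto simp: \<phi>_def inj_on_def)
  moreover have "lin V ground (\<phi> i)" for i
    using I(3,4) V.representation_add V.representation_scale
    by (intro linI) (auto simp: \<phi>_def)
  moreover have "x = (\<Sum>i\<in>I. scl V (\<phi> i x) (e i))" if "x \<in> car V" for x
  proof -
    have "(\<Sum>b\<in>e ` I. scl V (V.representation (e ` I) x b) b) = x"
      using I that by (intro V.sum_representation_eq) auto
    then show ?thesis using I(2) by (simp add: sum.reindex \<phi>_def)
  qed
  ultimately show "coord_basis V I e \<phi>"
    unfolding coord_basis_def using I(1) m by blast
qed

lemma fin_dim_coord_basis:
  assumes "fin_dim_vs V"
  obtains n e \<phi> where "coord_basis V {..<n::nat} e \<phi>"
proof -
  have V: "is_vs V" using assms by (simp add: fin_dim_vs_def)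
  interpret V: vector_space "scl V" using V by (simp add: is_vs_def)
  obtain S where S: "finite S" "S \<subseteq> car V" "V.span S = car V"
    using assms by (auto simp: fin_dim_vs_def)
  obtain B where B: "B \<subseteq> car V" "V.independent B" "car V \<subseteq> V.span B"
    using V.maximal_independent_subset by blast
  have fB: "finite B" using V.independent_span_bound[OF S(1) B(2)] B(1) S(3) by blast
  have "V.span B = car V"
    using V by (intro equalityI V.span_minimal B) (simp add: is_vs_def)
  moreover obtain e where e: "bij_betw e {..<card B} B"
    using ex_bij_betw_nat_finite[OF fB] atLeast0LessThan by metis
  ultimately have "inj_on e {..<card B}" "\<not> V.dependent (e ` {..<card B})"
    "V.span (e ` {..<card B}) = car V" using B(2) by (auto simp: bij_betw_def)
  from coord_basis_of_independent[OF V finite_lessThan this] that show ?thesis by blast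
qed

text \<open>The images of a basis under an injective map are independent, so their values can be prescribed.
  This is what lets coefficients of a submodule be read off from the whole module.\<close>

lemma lin_extend_inj:
  assumes X: "is_vs X" and Y: "is_vs Y" and c: "coord_basis X I e \<phi>" and f: "lin X Y f"
    and inj: "inj_on f (car X)" and p: "lin X ground \<psi>"
  obtains \<chi> where "lin Y ground \<chi>" "\<And>x. x \<in> car X \<Longrightarrow> \<chi> (f x) = \<psi> x"
proof -
  interpret X: vector_space "scl X" using X by (simp add: is_vs_def)
  interpret Y: vector_space "scl Y" using Y by (simp add: is_vs_def)
  interpret YK: vector_space_pair "scl Y" "(*)"
    using Y by (simp add: vector_space_pair_def is_vs_def vector_space_mult)
  let ?E = "(\<lambda>i. f (e i)) ` I"
  have inv: "inv_into (car X) f (f x) = x" if "x \<in> car X" for x by (rule inv_into_f_f[OF inj that])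
  have ij: "inj_on (\<lambda>i. f (e i)) I"
  proof (rule inj_onI)
    fix i j assume i: "i \<in> I" and j: "j \<in> I" and eq: "f (e i) = f (e j)"
    then have "e i = e j" using inj_onD[OF inj eq] coord_mem[OF c] by blast
    then show "i = j" using coord_delta[OF c i i] coord_delta[OF c i j] by (simp split: if_splits)
  qed
  have ind: "Y.independent ?E"
  proof (rule Y.independent_if_scalars_zero)
    show "finite ?E" using coord_finite[OF c] by simp
    fix u y assume z: "(\<Sum>y\<in>?E. scl Y (u y) y) = 0" and y: "y \<in> ?E"
    define v where "v = (\<Sum>i\<in>I. scl X (u (f (e i))) (e i))"
    have s: "scl X (u (f (e i))) (e i) \<in> car X" if "i \<in> I" for i by (rule vs_scale[OF X coord_mem[OF c that]])
    have v: "v \<in> car X" unfolding v_def by (rule vs_sum[OF X s])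
    have "f v = (\<Sum>i\<in>I. f (scl X (u (f (e i))) (e i)))" unfolding v_def by (rule lin_setsum[OF X Y f s])
    also have "\<dots> = (\<Sum>y\<in>?E. scl Y (u y) y)"
      using lin_scale[OF f coord_mem[OF c]] by (simp add: sum.reindex[OF ij])
    finally have "v = 0" using z inj_onD[OF inj _ v vs_zero[OF X]] lin_0[OF X Y f] by simp
    obtain j where j: "j \<in> I" "y = f (e j)" using y by blast
    have "\<phi> j v = (\<Sum>i\<in>I. \<phi> j (scl X (u (f (e i))) (e i)))"
      unfolding v_def by (rule lin_setsum[OF X is_vs_ground coord_lin[OF c j(1)] s])
    also have "\<dots> = (\<Sum>i\<in>I. if j = i then u (f (e i)) else 0)"
      using lin_scale[OF coord_lin[OF c j(1)] coord_mem[OF c]] coord_delta[OF c j(1)] by (intro sum.cong) auto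
    also have "\<dots> = u y" using j coord_finite[OF c] by simp
    finally show "u y = 0" using \<open>v = 0\<close> lin_0[OF X is_vs_ground coord_lin[OF c j(1)]] by simp
  qed
  (* off the basis vectors the prescribed values are irrelevant; inv_into supplies some *)
  obtain g where g: "Vector_Spaces.linear (scl Y) (*) g" "\<And>y. y \<in> ?E \<Longrightarrow> g y = \<psi> (inv_into (car X) f y)"
    using YK.linear_independent_extend[OF ind, of "\<lambda>y. \<psi> (inv_into (car X) f y)"] by auto
  interpret g: Vector_Spaces.linear "scl Y" "(*)" g by fact
  have gl: "lin Y ground g" by (simp add: lin_def g.add g.scale)
  have "g (f x) = \<psi> x" if "x \<in> car X" for x
    by (rule lin_eq_on_basis[OF X is_vs_ground c lin_comp[OF f gl] p _ that])
      (simp add: g(2) inv coord_mem[OF c])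
  then show ?thesis using that gl by blast
qed

lemma coord_basis_cong:
  "car V = car W \<Longrightarrow> scl V = scl W \<Longrightarrow> coord_basis V I e \<phi> = coord_basis W I e \<phi>"
  by (simp add: coord_basis_def lin_def)

lemma fin_dim_subspace:
  assumes V: "fin_dim_vs V" and S: "Modules.module.subspace (scl V) S" "S \<subseteq> car V"
  obtains B where "finite B" "B \<subseteq> S" "Modules.module.span (scl V) B = S"
proof -
  interpret V: vector_space "scl V" using V by (simp add: fin_dim_vs_def is_vs_def)
  obtain A where A: "finite A" "A \<subseteq> car V" "V.span A = car V" using V by (auto simp: fin_dim_vs_def)
  obtain B where B: "B \<subseteq> S" "V.independent B" "S \<subseteq> V.span B"
    using V.maximal_independent_subset by blast
  have "finite B" using V.independent_span_bound[OF A(1) B(2)] B(1) S(2) A(3) by blast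
  moreover have "V.span B = S" by (intro equalityI V.span_minimal B S)
  ultimately show ?thesis using that B(1) by blast
qed

lemma sum_Pair: "(\<Sum>i\<in>I. (f i, g i)) = (\<Sum>i\<in>I. f i, \<Sum>i\<in>I. g i)"
  by (induction I rule: infinite_finite_induct) (auto simp: zero_prod_def)

lemma is_vs_prod:
  assumes V: "is_vs V" and W: "is_vs W"
  shows "is_vs \<lparr>car = car V \<times> car W, scl = (\<lambda>c (x, y). (scl V c x, scl W c y))\<rparr>" (is "is_vs ?P")
proof -
  interpret V: vector_space "scl V" using V by (simp add: is_vs_def)
  interpret W: vector_space "scl W" using W by (simp add: is_vs_def)
  interpret P: vector_space "scl ?P"
    by unfold_locales (auto simp: V.scale_right_distrib W.scale_right_distrib V.scale_left_distrib W.scale_left_distrib)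
  have "P.subspace (car ?P)"
    by (rule P.subspaceI) (auto simp: zero_prod_def intro: vs_zero[OF V] vs_zero[OF W] vs_add[OF V] vs_add[OF W]
        vs_scale[OF V] vs_scale[OF W])
  then show ?thesis using P.vector_space_axioms by (simp add: is_vs_def)
qed

lemma coord_basis_prod:
  assumes V: "is_vs V" and W: "is_vs W" and c: "coord_basis V I e \<phi>" and d: "coord_basis W J f \<psi>"
  shows "coord_basis \<lparr>car = car V \<times> car W, scl = (\<lambda>c (x, y). (scl V c x, scl W c y))\<rparr> (I <+> J)
    (case_sum (\<lambda>i. (e i, 0)) (\<lambda>j. (0, f j))) (case_sum (\<lambda>i p. \<phi> i (fst p)) (\<lambda>j p. \<psi> j (snd p)))"
    (is "coord_basis ?P _ ?e ?p")
proof -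
  interpret V: vector_space "scl V" using V by (simp add: is_vs_def)
  interpret W: vector_space "scl W" using W by (simp add: is_vs_def)
  have z: "\<phi> i 0 = 0" if "i \<in> I" for i by (rule lin_0[OF V is_vs_ground coord_lin[OF c that]])
  have z': "\<psi> i 0 = 0" if "i \<in> J" for i by (rule lin_0[OF W is_vs_ground coord_lin[OF d that]])
  have ex: "x = (\<Sum>i\<in>I <+> J. scl ?P (?p i x) (?e i))" if x: "x \<in> car ?P" for x
  proof -
    have "(\<Sum>i\<in>I <+> J. scl ?P (?p i x) (?e i)) =
      (\<Sum>i\<in>I. (scl V (\<phi> i (fst x)) (e i), 0)) + (\<Sum>j\<in>J. (0, scl W (\<psi> j (snd x)) (f j)))"
      using coord_finite[OF c] coord_finite[OF d] by (subst sum.Plus) simp_all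
    also have "\<dots> = (\<Sum>i\<in>I. scl V (\<phi> i (fst x)) (e i), \<Sum>j\<in>J. scl W (\<psi> j (snd x)) (f j))"
      by (simp add: sum_Pair)
    also have "\<dots> = (fst x, snd x)"
      using x coord_expand[OF c, of "fst x"] coord_expand[OF d, of "snd x"] by auto
    finally show ?thesis by simp
  qed
  show ?thesis
    unfolding coord_basis_def
  proof (intro conjI ballI)
    show "finite (I <+> J)" using coord_finite[OF c] coord_finite[OF d] by simp
    fix i assume i: "i \<in> I <+> J"
    show "?e i \<in> car ?P" using i coord_mem[OF c] coord_mem[OF d] vs_zero[OF V] vs_zero[OF W] by auto
    show "lin ?P ground (?p i)"
      using i coord_lin[OF c] coord_lin[OF d] by (auto simp: lin_def)
    fix j assume j: "j \<in> I <+> J"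
    show "?p i (?e j) = (if i = j then 1 else 0)"
      using i j z z' coord_delta[OF c] coord_delta[OF d] by (auto split: if_splits)
  qed (rule ex)
qed

section \<open>Tensor products\<close>

lemma tens_cong: "scl V = scl V' \<Longrightarrow> scl W = scl W' \<Longrightarrow> tens V W = tens V' W'"
  unfolding tens_def by simp

lemma tensor_vs_simps [simp]: "scl (tensor_vs V W) = tensor_scl"
  by (simp add: tensor_vs_def)

lemma tens_mem: "v \<in> car V \<Longrightarrow> w \<in> car W \<Longrightarrow> tens V W v w \<in> car (tensor_vs V W)"
  using bilin_mem[OF bilin_tens] .

lemma tens_sum_mem:
  "(\<And>i. i \<in> I \<Longrightarrow> v i \<in> car V) \<Longrightarrow> (\<And>i. i \<in> I \<Longrightarrow> w i \<in> car W) \<Longrightarrow>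
    (\<Sum>i\<in>I. tens V W (v i) (w i)) \<in> car (tensor_vs V W)"
  by (intro vs_sum[OF is_vs_tensor_vs] tens_mem)

lemma tensor_decomp:
  assumes "is_vs V" "t \<in> car (tensor_vs V W)"
  obtains r :: nat and v w where "\<And>i. i < r \<Longrightarrow> v i \<in> car V" "\<And>i. i < r \<Longrightarrow> w i \<in> car W"
    "t = (\<Sum>i<r. tens V W (v i) (w i))"
  using tensor_sum_exists[OF assms] by blast

lemma tensor_lin_eq:
  assumes "is_vs V" "is_vs W" "is_vs U" "lin (tensor_vs V W) U f" "lin (tensor_vs V W) U g"
    and "\<And>v w. v \<in> car V \<Longrightarrow> w \<in> car W \<Longrightarrow> f (tens V W v w) = g (tens V W v w)"
    and "t \<in> car (tensor_vs V W)"
  shows "f t = g t"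
proof -
  obtain r :: nat and v w where d: "\<And>i. i < r \<Longrightarrow> v i \<in> car V" "\<And>i. i < r \<Longrightarrow> w i \<in> car W"
    "t = (\<Sum>i<r. tens V W (v i) (w i))" using tensor_decomp[OF assms(1,7)] by blast
  have "f t = (\<Sum>i<r. f (tens V W (v i) (w i)))" "g t = (\<Sum>i<r. g (tens V W (v i) (w i)))"
    unfolding d(3) using d(1,2)
    by (auto intro!: lin_setsum[OF is_vs_tensor_vs assms(3,4)] lin_setsum[OF is_vs_tensor_vs assms(3,5)] tens_mem)
  then show ?thesis using assms(6) d by simp
qed

lemma tensor_car_mono:
  assumes "is_vs V" "car V \<subseteq> car V'" "car W \<subseteq> car W'" "scl V = scl V'" "scl W = scl W'"
  shows "car (tensor_vs V W) \<subseteq> car (tensor_vs V' W')"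
proof
  fix t assume "t \<in> car (tensor_vs V W)"
  then obtain r :: nat and v w where d: "\<And>i. i < r \<Longrightarrow> v i \<in> car V" "\<And>i. i < r \<Longrightarrow> w i \<in> car W"
    "t = (\<Sum>i<r. tens V W (v i) (w i))" using tensor_decomp[OF assms(1)] by blast
  show "t \<in> car (tensor_vs V' W')"
    unfolding d(3) tens_cong[OF assms(4,5)] using d assms by (intro tens_sum_mem) auto
qed

text \<open>The tensor product of subspaces lies inside the tensor product of the whole spaces, and induced maps
  agree there.  This relates comodules over a Hopf subalgebra to comodules over \<open>H\<degree>\<close>.\<close>

lemma tlift_mono:
  assumes "is_vs V" "is_vs W" "is_vs V'" "is_vs W'" "is_vs U" "bilin V' W' U b"
    "car V \<subseteq> car V'" "car W \<subseteq> car W'" "scl V = scl V'" "scl W = scl W'" "t \<in> car (tensor_vs V W)"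
  shows "tlift V' W' b t = tlift V W b t"
proof -
  obtain r :: nat and v w where d: "\<And>i. i < r \<Longrightarrow> v i \<in> car V" "\<And>i. i < r \<Longrightarrow> w i \<in> car W"
    "t = (\<Sum>i<r. tens V W (v i) (w i))" using tensor_decomp[OF assms(1,11)] by blast
  have b: "bilin V W U b" by (rule bilin_mono[OF assms(6-8)]) (use assms(9,10) in auto)
  have "tlift V W b t = (\<Sum>i<r. b (v i) (w i))"
    unfolding d(3) using d by (intro tlift_sum[OF assms(1,2,5) b]) auto
  moreover have "tlift V' W' b t = (\<Sum>i<r. b (v i) (w i))"
    unfolding d(3) tens_cong[OF assms(9,10)] using d assms by (intro tlift_sum[OF assms(3,4,5,6)]) auto
  ultimately show ?thesis by simp
qed

lemma tens_expand:
  assumes V: "is_vs V" and W: "is_vs W" and cV: "coord_basis V I e \<phi>" and cW: "coord_basis W J f \<psi>"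
    and vw: "v \<in> car V" "w \<in> car W"
  shows "tens V W v w = (\<Sum>p\<in>I\<times>J. tensor_scl (\<phi> (fst p) v * \<psi> (snd p) w)
    (tens V W (e (fst p)) (f (snd p))))"
proof -
  interpret V: vector_space "scl V" using V by (simp add: is_vs_def)
  interpret W: vector_space "scl W" using W by (simp add: is_vs_def)
  have "tens V W v w = tens V W (\<Sum>i\<in>I. scl V (\<phi> i v) (e i)) w"
    by (rule arg_cong[OF coord_expand[OF cV vw(1)]])
  also have "\<dots> = (\<Sum>i\<in>I. tens V W (scl V (\<phi> i v) (e i)) w)"
    using coord_mem[OF cV] by (intro lin_setsum[OF V is_vs_tensor_vs[of V W]
          bilin_left[OF bilin_tens vw(2)]] vs_scale[OF V])
  also have "\<dots> = (\<Sum>i\<in>I. tens V W (scl V (\<phi> i v) (e i)) (\<Sum>j\<in>J. scl W (\<psi> j w) (f j)))"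
    by (intro sum.cong refl arg_cong[OF coord_expand[OF cW vw(2)]])
  also have "\<dots> = (\<Sum>i\<in>I. \<Sum>j\<in>J. tens V W (scl V (\<phi> i v) (e i)) (scl W (\<psi> j w) (f j)))"
    using coord_mem[OF cV] coord_mem[OF cW] by (intro sum.cong refl lin_setsum[OF W is_vs_tensor_vs[of V W]
          bilin_right[OF bilin_tens]] vs_scale[OF W] vs_scale[OF V])
  also have "\<dots> = (\<Sum>i\<in>I. \<Sum>j\<in>J. tensor_scl (\<phi> i v * \<psi> j w) (tens V W (e i) (f j)))"
    by (simp add: tens_arith) (simp add: tensor_scl_def mult.assoc mult.left_commute)
  also have "\<dots> = (\<Sum>p\<in>I\<times>J. tensor_scl (\<phi> (fst p) v * \<psi> (snd p) w)
    (tens V W (e (fst p)) (f (snd p))))"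
    by (simp add: sum.cartesian_product split_beta)
  finally show ?thesis .
qed

lemma coord_basis_tensor:
  assumes V: "is_vs V" and W: "is_vs W" and cV: "coord_basis V I e \<phi>" and cW: "coord_basis W J f \<psi>"
  shows "coord_basis (tensor_vs V W) (I \<times> J) (\<lambda>(i,j). tens V W (e i) (f j))
    (\<lambda>(i,j). tlift V W (\<lambda>x y. \<phi> i x * \<psi> j y))"
proof -
  have bl: "bilin V W ground (\<lambda>x y. \<phi> i x * \<psi> j y)" if "i \<in> I" "j \<in> J" for i j
    using that coord_lin[OF cV] coord_lin[OF cW] by (intro bilin_mult) auto
  note tl = tensor_universal[OF V W is_vs_ground bl]
  have exp: "t = (\<Sum>p\<in>I\<times>J. tensor_scl (tlift V W (\<lambda>x y. \<phi> (fst p) x * \<psi> (snd p) y) t)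
      (tens V W (e (fst p)) (f (snd p))))" (is "t = ?R t") if "t \<in> car (tensor_vs V W)" for t
  proof (rule tensor_lin_eq[OF V W is_vs_tensor_vs[of V W] _ _ _ that])
    show "lin (tensor_vs V W) (tensor_vs V W) (\<lambda>t. t)" by (simp add: lin_id)
    show "lin (tensor_vs V W) (tensor_vs V W) ?R"
    proof (rule lin_sum_fun[OF is_vs_tensor_vs])
      fix p assume p: "p \<in> I \<times> J"
      have m: "tens V W (e (fst p)) (f (snd p)) \<in> car (tensor_vs V W)"
        using p coord_mem[OF cV] coord_mem[OF cW] by (intro tens_mem) auto
      show "lin (tensor_vs V W) (tensor_vs V W)
          (\<lambda>t. tensor_scl (tlift V W (\<lambda>x y. \<phi> (fst p) x * \<psi> (snd p) y) t)
            (tens V W (e (fst p)) (f (snd p))))"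
        using lin_ground_scl[OF is_vs_tensor_vs m tl(1)] p by auto
    qed
    fix v w assume vw: "v \<in> car V" "w \<in> car W"
    have "tens V W v w = (\<Sum>p\<in>I\<times>J. tensor_scl (\<phi> (fst p) v * \<psi> (snd p) w)
        (tens V W (e (fst p)) (f (snd p))))"
      by (rule tens_expand[OF V W cV cW vw])
    also have "\<dots> = ?R (tens V W v w)"
      by (intro sum.cong refl) (use vw tl(2) in auto)
    finally show "tens V W v w = ?R (tens V W v w)" .
  qed
  show ?thesis
    unfolding coord_basis_def
  proof (intro conjI ballI)
    show "finite (I \<times> J)" using coord_finite[OF cV] coord_finite[OF cW] by simp
    fix p assume p: "p \<in> I \<times> J"
    show "(case p of (i, j) \<Rightarrow> tens V W (e i) (f j)) \<in> car (tensor_vs V W)"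
      using p coord_mem[OF cV] coord_mem[OF cW] by (auto intro!: tens_mem)
    show "lin (tensor_vs V W) ground (case p of (i, j) \<Rightarrow> tlift V W (\<lambda>x y. \<phi> i x * \<psi> j y))"
      using p tl(1) by auto
    fix q assume q: "q \<in> I \<times> J"
    show "(case p of (i, j) \<Rightarrow> tlift V W (\<lambda>x y. \<phi> i x * \<psi> j y)) (case q of (i, j) \<Rightarrow> tens V W (e i) (f j))
       = (if p = q then 1 else 0)"
      using p q tl(2) coord_mem[OF cV] coord_mem[OF cW] coord_delta[OF cV] coord_delta[OF cW]
      by (auto split: if_splits)
  next
    fix t assume "t \<in> car (tensor_vs V W)"
    then show "t = (\<Sum>p\<in>I \<times> J. scl (tensor_vs V W)
        ((case p of (i, j) \<Rightarrow> tlift V W (\<lambda>x y. \<phi> i x * \<psi> j y)) t) (case p of (i, j) \<Rightarrow> tens V W (e i) (f j)))"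
      unfolding split_beta tensor_vs_simps by (rule exp)
  qed
qed

text \<open>An element \<open>\<Sum> v\<^sub>i \<otimes> w\<^sub>i\<close> of \<open>V \<otimes> W\<close>, where \<open>W\<close> consists of
  functions, is determined by the vectors \<open>\<Sum> w\<^sub>i(h) v\<^sub>i\<close>: if they vanish, then so does each
  function \<open>\<Sum> f(v\<^sub>i) w\<^sub>i\<close>, for every functional \<open>f\<close> on \<open>V\<close>.\<close>

lemma tensor_eval_unique:
  fixes V :: "('k::field, 'v::ab_group_add, 'x) vspace_scheme"
    and W :: "('k, 'h \<Rightarrow> 'k, 'y) vspace_scheme"
  assumes V: "is_vs V" and W: "is_vs W" and sW: "scl W = (\<lambda>c f x. c * f x)"
    and vanish: "\<And>w h. w \<in> car W \<Longrightarrow> h \<notin> S \<Longrightarrow> w h = 0"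
    and st: "s \<in> car (tensor_vs V W)" "t \<in> car (tensor_vs V W)"
    and eq: "\<And>h. h \<in> S \<Longrightarrow> tlift V W (\<lambda>v w. scl V (w h) v) s = tlift V W (\<lambda>v w. scl V (w h) v) t"
  shows "s = t"
proof -
  interpret V: vector_space "scl V" using V by (simp add: is_vs_def)
  have bl: "bilin V W V (\<lambda>v w. scl V (w h) v)" for h
    by (rule bilin_scl[OF V]) (simp add: lin_def sW)
  define d where "d = s - t"
  have d: "d \<in> car (tensor_vs V W)" using st by (simp add: d_def vs_diff[OF is_vs_tensor_vs])
  have z: "tlift V W (\<lambda>v w. scl V (w h) v) d = 0" if "h \<in> S" for h
    unfolding d_def using lin_diff[OF is_vs_tensor_vs tensor_universal(1)[OF V W V bl] st] eq[OF that] by simp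
  obtain r :: nat and v w where dd: "\<And>i. i < r \<Longrightarrow> v i \<in> car V" "\<And>i. i < r \<Longrightarrow> w i \<in> car W"
    "d = (\<Sum>i<r. tens V W (v i) (w i))" using tensor_decomp[OF V d] by blast
  have zero: "(\<Sum>i<r. scl V (w i h) (v i)) = 0" for h
  proof (cases "h \<in> S")
    case True
    have "tlift V W (\<lambda>v w. scl V (w h) v) d = (\<Sum>i<r. scl V (w i h) (v i))"
      unfolding dd(3) using dd by (intro tlift_sum[OF V W V bl]) auto
    then show ?thesis using z[OF True] by simp
  next
    case False
    then show ?thesis using vanish dd(2) by (intro sum.neutral) auto
  qed
  have "d f g = 0" for f g
  proof (cases "Vector_Spaces.linear (scl V) (*) f \<and> Vector_Spaces.linear (scl W) (*) g")
    case True
    interpret f: Vector_Spaces.linear "scl V" "(*)" f using True by blast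
    interpret g: Vector_Spaces.linear "scl W" "(*)" g using True by blast
    have app: "(\<Sum>i\<in>J. tens V W (v i) (w i)) f g = (\<Sum>i\<in>J. f (v i) * g (w i))" if "finite J" for J
      using that by (induction J rule: finite_induct) (use True in \<open>auto simp: tens_def\<close>)
    have "d f g = g (\<Sum>i<r. scl W (f (v i)) (w i))"
      by (simp add: dd(3) app g.sum g.scale)
    moreover have app': "(\<Sum>i\<in>J. scl W (f (v i)) (w i)) h = f (\<Sum>i\<in>J. scl V (w i h) (v i))"
      if "finite J" for h J
      using that by (induction J rule: finite_induct) (auto simp: sW f.add f.scale f.zero)
    have "(\<Sum>i<r. scl W (f (v i)) (w i)) = 0"
      using zero app'[of "{..<r}"] by (simp add: fun_eq_iff f.zero)
    ultimately show ?thesis by (simp add: g.zero)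
  next
    case False
    have "(\<Sum>i\<in>J. tens V W (v i) (w i)) f g = 0" if "finite J" for J
      using that by (induction J rule: finite_induct) (use False in \<open>auto simp: tens_def\<close>)
    then show ?thesis using dd(3) by simp
  qed
  then have "d = 0" by (simp add: fun_eq_iff)
  then show ?thesis by (simp add: d_def)
qed

lemma tensor_basis_expand:
  assumes V: "is_vs V" and W: "is_vs W" and c: "coord_basis V I e \<phi>" and t: "t \<in> car (tensor_vs V W)"
  shows "t = (\<Sum>i\<in>I. tens V W (e i) (tlift V W (\<lambda>v w. scl W (\<phi> i v) w) t))" (is "t = ?R t")
    and "i \<in> I \<Longrightarrow> tlift V W (\<lambda>v w. scl W (\<phi> i v) w) t \<in> car W"
proof -
  have bl: "bilin V W W (\<lambda>v w. scl W (\<phi> i v) w)" if "i \<in> I" for i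
    using bilin_scl[OF W coord_lin[OF c that]] by (auto simp: bilin_def)
  note tl = tensor_universal[OF V W W bl]
  show "i \<in> I \<Longrightarrow> tlift V W (\<lambda>v w. scl W (\<phi> i v) w) t \<in> car W" by (rule lin_mem[OF tl(1) t])
  show "t = ?R t"
  proof (rule tensor_lin_eq[OF V W is_vs_tensor_vs[of V W] _ _ _ t])
    show "lin (tensor_vs V W) (tensor_vs V W) (\<lambda>t. t)" by (simp add: lin_id)
    show "lin (tensor_vs V W) (tensor_vs V W) ?R"
      by (intro lin_sum_fun[OF is_vs_tensor_vs] lin_comp[OF tl(1) bilin_right[OF bilin_tens coord_mem[OF c]]])
    fix v w assume v: "v \<in> car V" and w: "w \<in> car W"
    have "tens V W v w = tens V W (\<Sum>i\<in>I. scl V (\<phi> i v) (e i)) w"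
      by (rule arg_cong[OF coord_expand[OF c v]])
    also have "\<dots> = (\<Sum>i\<in>I. tens V W (scl V (\<phi> i v) (e i)) w)"
      by (intro lin_setsum[OF V is_vs_tensor_vs[of V W] bilin_left[OF bilin_tens w]] vs_scale[OF V] coord_mem[OF c])
    also have "\<dots> = ?R (tens V W v w)"
      using tl(2)[OF _ v w] by (intro sum.cong) (simp_all add: tens_arith)
    finally show "tens V W v w = ?R (tens V W v w)" .
  qed
qed

lemma tmap_sum:
  assumes "is_vs V" "is_vs W" "lin V V' f" "lin W W' g"
    "finite I" "\<And>i. i \<in> I \<Longrightarrow> v i \<in> car V" "\<And>i. i \<in> I \<Longrightarrow> w i \<in> car W"
  shows "tmap V W V' W' f g (\<Sum>i\<in>I. tens V W (v i) (w i)) = (\<Sum>i\<in>I. tens V' W' (f (v i)) (g (w i)))"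
  unfolding tmap_def
  by (rule tlift_sum[OF assms(1,2) is_vs_tensor_vs[of V' W'] bilin_comp[OF bilin_tens assms(3,4)] assms(5-7)])

lemma lin_tmap:
  assumes "is_vs V" "is_vs W" "lin V V' f" "lin W W' g"
  shows "lin (tensor_vs V W) (tensor_vs V' W') (tmap V W V' W' f g)"
  unfolding tmap_def
  by (rule tensor_universal(1)[OF assms(1,2) is_vs_tensor_vs[of V' W'] bilin_comp[OF bilin_tens assms(3,4)]])

lemma tassoc_sum:
  assumes U: "is_vs U" and V: "is_vs V" and W: "is_vs W" and I: "finite I"
    "\<And>i. i \<in> I \<Longrightarrow> finite (J i)"
    "\<And>i j. i \<in> I \<Longrightarrow> j \<in> J i \<Longrightarrow> u i j \<in> car U" "\<And>i j. i \<in> I \<Longrightarrow> j \<in> J i \<Longrightarrow> v i j \<in> car V"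
    "\<And>i. i \<in> I \<Longrightarrow> w i \<in> car W"
  shows "tassoc U V W (\<Sum>i\<in>I. tens (tensor_vs U V) W (\<Sum>j\<in>J i. tens U V (u i j) (v i j)) (w i))
    = (\<Sum>i\<in>I. \<Sum>j\<in>J i. tens U (tensor_vs V W) (u i j) (tens V W (v i j) (w i)))"
proof -
  let ?T = "tensor_vs U (tensor_vs V W)"
  have b1: "bilin U V ?T (\<lambda>u v. tens U (tensor_vs V W) u (tens V W v w))" if "w \<in> car W" for w
    by (rule bilin_comp[OF bilin_tens lin_id bilin_left[OF bilin_tens that]]) auto
  note tl = tlift_sum[OF U V is_vs_tensor_vs[of U "tensor_vs V W"] b1]
  have b2: "bilin (tensor_vs U V) W ?T (\<lambda>t w. tlift U V (\<lambda>u v. tens U (tensor_vs V W) u (tens V W v w)) t)"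
  proof (rule bilinI)
    show "lin (tensor_vs U V) ?T (\<lambda>t. tlift U V (\<lambda>u v. tens U (tensor_vs V W) u (tens V W v w)) t)"
      if "w \<in> car W" for w
      by (rule tensor_universal(1)[OF U V is_vs_tensor_vs[of U "tensor_vs V W"] b1[OF that]])
    fix t assume "t \<in> car (tensor_vs U V)"
    then obtain r :: nat and x y where d: "\<And>i. i < r \<Longrightarrow> x i \<in> car U" "\<And>i. i < r \<Longrightarrow> y i \<in> car V"
      "t = (\<Sum>i<r. tens U V (x i) (y i))" using tensor_decomp[OF U] by blast
    have e: "tlift U V (\<lambda>u v. tens U (tensor_vs V W) u (tens V W v w)) t =
      (\<Sum>i<r. tens U (tensor_vs V W) (x i) (tens V W (y i) w))" if "w \<in> car W" for w
      unfolding d(3) by (rule tl) (use that d in auto)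
    have "lin W ?T (\<lambda>w. \<Sum>i<r. tens U (tensor_vs V W) (x i) (tens V W (y i) w))"
    proof (rule lin_sum_fun[OF is_vs_tensor_vs])
      fix i assume "i \<in> {..<r}"
      then have i: "x i \<in> car U" "y i \<in> car V" using d by auto
      show "lin W ?T (\<lambda>w. tens U (tensor_vs V W) (x i) (tens V W (y i) w))"
        by (rule lin_comp[OF bilin_right[OF bilin_tens i(2)] bilin_right[OF bilin_tens i(1)]])
    qed
    then show "lin W ?T (\<lambda>w. tlift U V (\<lambda>u v. tens U (tensor_vs V W) u (tens V W v w)) t)"
      using W e by (auto simp: lin_def vs_add vs_scale)
  qed
  have "tassoc U V W (\<Sum>i\<in>I. tens (tensor_vs U V) W (\<Sum>j\<in>J i. tens U V (u i j) (v i j)) (w i)) =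
    (\<Sum>i\<in>I. tlift U V (\<lambda>u v. tens U (tensor_vs V W) u (tens V W v (w i))) (\<Sum>j\<in>J i. tens U V (u i j) (v i j)))"
    unfolding tassoc_def
    by (rule tlift_sum[OF is_vs_tensor_vs W is_vs_tensor_vs[of U "tensor_vs V W"] b2]) (use I in \<open>auto intro!: tens_sum_mem\<close>)
  also have "\<dots> = (\<Sum>i\<in>I. \<Sum>j\<in>J i. tens U (tensor_vs V W) (u i j) (tens V W (v i j) (w i)))"
    using I by (intro sum.cong refl tl) auto
  finally show ?thesis .
qed

text \<open>The two sides of the coassociativity law as explicit double sums are given by this lemma and the next
  one; they serve for the coproduct of \<open>H\<close> and for coactions alike.\<close>

lemma tassoc_tmap_sum:
  assumes X: "is_vs X" and D: "is_vs D" and r: "lin X (tensor_vs X D) r" and I: "finite I"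
    and x: "\<And>i. i \<in> I \<Longrightarrow> x i \<in> car X" and d: "\<And>i. i \<in> I \<Longrightarrow> d i \<in> car D"
    and J: "\<And>i. i \<in> I \<Longrightarrow> finite (J i)" "\<And>i j. i \<in> I \<Longrightarrow> j \<in> J i \<Longrightarrow> y i j \<in> car X"
      "\<And>i j. i \<in> I \<Longrightarrow> j \<in> J i \<Longrightarrow> c i j \<in> car D"
    and rx: "\<And>i. i \<in> I \<Longrightarrow> r (x i) = (\<Sum>j\<in>J i. tens X D (y i j) (c i j))"
  shows "tassoc X D D (tmap X D (tensor_vs X D) D r id (\<Sum>i\<in>I. tens X D (x i) (d i)))
    = (\<Sum>i\<in>I. \<Sum>j\<in>J i. tens X (tensor_vs D D) (y i j) (tens D D (c i j) (d i)))"
proof -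
  have lid: "lin D D id" by (simp add: lin_def)
  have "tmap X D (tensor_vs X D) D r id (\<Sum>i\<in>I. tens X D (x i) (d i)) =
    (\<Sum>i\<in>I. tens (tensor_vs X D) D (r (x i)) (id (d i)))"
    by (rule tmap_sum[OF X D r lid I x d])
  also have "\<dots> = (\<Sum>i\<in>I. tens (tensor_vs X D) D (\<Sum>j\<in>J i. tens X D (y i j) (c i j)) (d i))"
    using rx by simp
  finally show ?thesis
    using tassoc_sum[OF X D D I J d] by simp
qed

lemma tmap_right_sum:
  assumes X: "is_vs X" and D: "is_vs D" and r: "lin D (tensor_vs D D) r" and I: "finite I"
    and x: "\<And>i. i \<in> I \<Longrightarrow> x i \<in> car X" and d: "\<And>i. i \<in> I \<Longrightarrow> d i \<in> car D"
    and J: "\<And>i j. i \<in> I \<Longrightarrow> j \<in> J i \<Longrightarrow> y i j \<in> car D" "\<And>i j. i \<in> I \<Longrightarrow> j \<in> J i \<Longrightarrow> c i j \<in> car D"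
    and rd: "\<And>i. i \<in> I \<Longrightarrow> r (d i) = (\<Sum>j\<in>J i. tens D D (y i j) (c i j))"
  shows "tmap X D X (tensor_vs D D) id r (\<Sum>i\<in>I. tens X D (x i) (d i))
    = (\<Sum>i\<in>I. \<Sum>j\<in>J i. tens X (tensor_vs D D) (x i) (tens D D (y i j) (c i j)))"
proof -
  have lid: "lin X X id" by (simp add: lin_def)
  have "tmap X D X (tensor_vs D D) id r (\<Sum>i\<in>I. tens X D (x i) (d i)) =
    (\<Sum>i\<in>I. tens X (tensor_vs D D) (id (x i)) (r (d i)))"
    by (rule tmap_sum[OF X D lid r I x d])
  also have "\<dots> = (\<Sum>i\<in>I. \<Sum>j\<in>J i. tens X (tensor_vs D D) (x i) (tens D D (y i j) (c i j)))"
  proof (rule sum.cong[OF refl])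
    fix i assume i: "i \<in> I"
    show "tens X (tensor_vs D D) (id (x i)) (r (d i)) =
      (\<Sum>j\<in>J i. tens X (tensor_vs D D) (x i) (tens D D (y i j) (c i j)))"
      unfolding rd[OF i] id_apply using i J
      by (intro lin_setsum[OF is_vs_tensor_vs is_vs_tensor_vs[of X "tensor_vs D D"]
            bilin_right[OF bilin_tens x[OF i]]] tens_mem)
  qed
  finally show ?thesis .
qed

text \<open>Coassociativity is an equality in a threefold tensor product; it is exploited by applying a trilinear
  map to both sides.\<close>

lemma tlift3_sum:
  assumes U: "is_vs U" and V: "is_vs V" and W: "is_vs W" and Z: "is_vs Z"
    and F: "\<And>u. u \<in> car U \<Longrightarrow> bilin V W Z (F u)"
      "\<And>v w. v \<in> car V \<Longrightarrow> w \<in> car W \<Longrightarrow> lin U Z (\<lambda>u. F u v w)"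
    and I: "finite I" "\<And>i. i \<in> I \<Longrightarrow> finite (J i)"
    "\<And>i j. i \<in> I \<Longrightarrow> j \<in> J i \<Longrightarrow> u i j \<in> car U" "\<And>i j. i \<in> I \<Longrightarrow> j \<in> J i \<Longrightarrow> v i j \<in> car V"
    "\<And>i j. i \<in> I \<Longrightarrow> j \<in> J i \<Longrightarrow> w i j \<in> car W"
  shows "tlift U (tensor_vs V W) (\<lambda>u t. tlift V W (F u) t)
      (\<Sum>i\<in>I. \<Sum>j\<in>J i. tens U (tensor_vs V W) (u i j) (tens V W (v i j) (w i j)))
    = (\<Sum>i\<in>I. \<Sum>j\<in>J i. F (u i j) (v i j) (w i j))"
proof -
  note tl = tensor_universal[OF V W Z F(1)]
  have b: "bilin U (tensor_vs V W) Z (\<lambda>u t. tlift V W (F u) t)"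
  proof (rule bilinI)
    show "lin (tensor_vs V W) Z (tlift V W (F u))" if "u \<in> car U" for u by (rule tl(1)[OF that])
    fix t assume "t \<in> car (tensor_vs V W)"
    then obtain r :: nat and x y where d: "\<And>i. i < r \<Longrightarrow> x i \<in> car V" "\<And>i. i < r \<Longrightarrow> y i \<in> car W"
      "t = (\<Sum>i<r. tens V W (x i) (y i))" using tensor_decomp[OF V] by blast
    have e: "tlift V W (F u) t = (\<Sum>i<r. F u (x i) (y i))" if "u \<in> car U" for u
      unfolding d(3) using d that by (intro tlift_sum[OF V W Z F(1)]) auto
    have "lin U Z (\<lambda>u. \<Sum>i<r. F u (x i) (y i))"
      using d F by (intro lin_sum_fun[OF Z]) auto
    then show "lin U Z (\<lambda>u. tlift V W (F u) t)"
      using U e by (auto simp: lin_def vs_add vs_scale)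
  qed
  have "tlift U (tensor_vs V W) (\<lambda>u t. tlift V W (F u) t)
      (\<Sum>p\<in>Sigma I J. tens U (tensor_vs V W) (u (fst p) (snd p)) (tens V W (v (fst p) (snd p)) (w (fst p) (snd p))))
     = (\<Sum>p\<in>Sigma I J. tlift V W (F (u (fst p) (snd p))) (tens V W (v (fst p) (snd p)) (w (fst p) (snd p))))"
    using I by (intro tlift_sum[OF U is_vs_tensor_vs Z b]) (auto intro!: tens_mem)
  also have "\<dots> = (\<Sum>p\<in>Sigma I J. F (u (fst p) (snd p)) (v (fst p) (snd p)) (w (fst p) (snd p)))"
    using I tl(2) by (intro sum.cong) auto
  finally show ?thesis
    using I by (simp add: sum.Sigma split_beta)
qed

lemma tensor_vs_cong: "car V = car V' \<Longrightarrow> scl V = scl V' \<Longrightarrow> car W = car W' \<Longrightarrow> scl W = scl W' \<Longrightarrow>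
    tensor_vs V W = tensor_vs V' W'"
  unfolding tensor_vs_def using tens_cong[of V V' W W'] by simp

lemma tlift_cong: "car V = car V' \<Longrightarrow> scl V = scl V' \<Longrightarrow> car W = car W' \<Longrightarrow> scl W = scl W' \<Longrightarrow>
    tlift V W = tlift V' W'"
  unfolding tlift_def[abs_def] using tens_cong[of V V' W W'] by simp

lemma tmap_cong: "car V = car V' \<Longrightarrow> scl V = scl V' \<Longrightarrow> car W = car W' \<Longrightarrow> scl W = scl W' \<Longrightarrow>
    scl U = scl U' \<Longrightarrow> scl Z = scl Z' \<Longrightarrow> tmap V W U Z = tmap V' W' U' Z'"
  unfolding tmap_def[abs_def] by (simp add: tens_cong[of U U' Z Z'] tlift_cong[of V V' W W'])

lemma tassoc_cong: "car V = car V' \<Longrightarrow> scl V = scl V' \<Longrightarrow> tassoc V W Z = tassoc V' W Z"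
  unfolding tassoc_def[abs_def]
  by (simp add: tens_cong[of V V' "tensor_vs W Z" "tensor_vs W Z"] tensor_vs_cong[of V V' W W] tlift_cong[of V V' W W])

text \<open>In a matrix algebra a left inverse agrees with a right inverse.  Associativity of \<open>m\<close> is only
  demanded for the entries that occur, since convolution is associative on linear functionals but not on arbitrary
  functions.\<close>

lemma matrix_inverse_unique:
  fixes m :: "'f::ab_group_add \<Rightarrow> 'f \<Rightarrow> 'f" and I :: "'i set"
  assumes I: "finite I"
    and dist: "\<And>(J :: 'i set) f g. m (\<Sum>j\<in>J. f j) g = (\<Sum>j\<in>J. m (f j) g)"
      "\<And>(J :: 'i set) f g. m g (\<Sum>j\<in>J. f j) = (\<Sum>j\<in>J. m g (f j))"
    and assoc: "\<And>i j k p. i \<in> I \<Longrightarrow> j \<in> I \<Longrightarrow> k \<in> I \<Longrightarrow> p \<in> I \<Longrightarrow>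
      m (m (l i j) (c j k)) (r k p) = m (l i j) (m (c j k) (r k p))"
    and lc: "\<And>i k. i \<in> I \<Longrightarrow> k \<in> I \<Longrightarrow> (\<Sum>j\<in>I. m (l i j) (c j k)) = (if i = k then u else 0)"
    and cr: "\<And>i k. i \<in> I \<Longrightarrow> k \<in> I \<Longrightarrow> (\<Sum>j\<in>I. m (c i j) (r j k)) = (if i = k then u else 0)"
    and unit: "\<And>i k. i \<in> I \<Longrightarrow> k \<in> I \<Longrightarrow> m u (r i k) = r i k"
      "\<And>i k. i \<in> I \<Longrightarrow> k \<in> I \<Longrightarrow> m (l i k) u = l i k"
    and i: "i \<in> I" and k: "k \<in> I"
  shows "l i k = r i k"
proof -
  have z: "m 0 g = 0" "m g 0 = 0" for g
    using dist(1)[of "\<lambda>_. 0" "{}" g] dist(2)[of g "\<lambda>_. 0" "{}"] by simp_all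
  have "l i k = (\<Sum>j\<in>I. m (l i j) (if j = k then u else 0))"
    using I k i unit(2) by (simp add: if_distrib z sum.delta cong: if_cong)
  also have "\<dots> = (\<Sum>j\<in>I. m (l i j) (\<Sum>p\<in>I. m (c j p) (r p k)))"
    using cr k by simp
  also have "\<dots> = (\<Sum>j\<in>I. \<Sum>p\<in>I. m (m (l i j) (c j p)) (r p k))"
    using assoc i k by (simp add: dist)
  also have "\<dots> = (\<Sum>p\<in>I. m (\<Sum>j\<in>I. m (l i j) (c j p)) (r p k))"
    by (subst sum.swap) (simp add: dist)
  also have "\<dots> = (\<Sum>p\<in>I. m (if i = p then u else 0) (r p k))"
    using lc i by simp
  also have "\<dots> = r i k"
    using I k i unit(1) by (simp add: if_distrib[where f="\<lambda>x. m x _"] z sum.delta' cong: if_cong)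
  finally show ?thesis .
qed

section \<open>Sweedler sums in a Hopf algebra\<close>

locale hopf_alg =
  fixes H :: "('k::field, 'h::ab_group_add) hopf"
  assumes hopf: "hopf_algebra H"
begin

lemma vs_H: "is_vs H" and bilin_mul: "bilin H H H (mul H)" and unt_mem: "unt H \<in> car H"
  and mul_unt_left: "a \<in> car H \<Longrightarrow> mul H (unt H) a = a"
  and mul_unt_right: "a \<in> car H \<Longrightarrow> mul H a (unt H) = a"
  and mul_assoc: "a \<in> car H \<Longrightarrow> b \<in> car H \<Longrightarrow> c \<in> car H \<Longrightarrow>
    mul H (mul H a b) c = mul H a (mul H b c)"
  using hopf unfolding hopf_algebra_def is_algebra_def by blast+

lemma mul_mem: "a \<in> car H \<Longrightarrow> b \<in> car H \<Longrightarrow> mul H a b \<in> car H"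
  by (rule bilin_mem[OF bilin_mul])

lemma lin_comul: "lin H (tensor_vs H H) (comul H)" and lin_counit: "lin H ground (counit H)"
  and lin_antip: "lin H H (antip H)" and counit_unt: "counit H (unt H) = 1"
  and counit_mul: "a \<in> car H \<Longrightarrow> b \<in> car H \<Longrightarrow> counit H (mul H a b) = counit H a * counit H b"
  using hopf unfolding hopf_algebra_def is_coalgebra_def by blast+

lemma antip_mem: "a \<in> car H \<Longrightarrow> antip H a \<in> car H"
  by (rule lin_mem[OF lin_antip])

lemma lin_mul_left: "b \<in> car H \<Longrightarrow> lin H H (\<lambda>a. mul H a b)"
  and lin_mul_right: "a \<in> car H \<Longrightarrow> lin H H (mul H a)"
  by (rule bilin_left[OF bilin_mul], simp) (rule bilin_right[OF bilin_mul], simp)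

text \<open>For every element \<open>h\<close> one decomposition of its coproduct into \<open>swn h\<close> pure tensors is
  chosen.  Expressions that are bilinear in the coproduct then become ordinary finite sums.\<close>

definition swd :: "'h \<Rightarrow> nat \<times> (nat \<Rightarrow> 'h) \<times> (nat \<Rightarrow> 'h)" where
  "swd h = (SOME (r, v, w). (\<forall>i<r. v i \<in> car H \<and> w i \<in> car H) \<and>
     comul H h = (\<Sum>i<r. tens H H (v i) (w i)))"

definition swn :: "'h \<Rightarrow> nat" where "swn h = fst (swd h)"

definition swl :: "'h \<Rightarrow> nat \<Rightarrow> 'h" where "swl h = fst (snd (swd h))"

definition swr :: "'h \<Rightarrow> nat \<Rightarrow> 'h" where "swr h = snd (snd (swd h))"

text \<open>In Sweedler notation this is \<open>\<Sum> b h\<^sub>1 h\<^sub>2\<close>.\<close>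

definition swsum :: "('h \<Rightarrow> 'h \<Rightarrow> 'u::comm_monoid_add) \<Rightarrow> 'h \<Rightarrow> 'u" where
  "swsum b h = (\<Sum>i<swn h. b (swl h i) (swr h i))"

lemma
  assumes "h \<in> car H"
  shows swl_mem: "i < swn h \<Longrightarrow> swl h i \<in> car H" and swr_mem: "i < swn h \<Longrightarrow> swr h i \<in> car H"
    and comul_sum: "comul H h = (\<Sum>i<swn h. tens H H (swl h i) (swr h i))"
proof -
  have "\<exists>x :: nat \<times> _. case x of (r, v, w) \<Rightarrow> (\<forall>i<r. v i \<in> car H \<and> w i \<in> car H) \<and>
     comul H h = (\<Sum>i<r. tens H H (v i) (w i))"
    using tensor_sum_exists[OF vs_H lin_mem[OF lin_comul assms]]
    unfolding split_paired_Ex case_prod_conv .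
  from someI_ex[OF this] have "case swd h of (r, v, w) \<Rightarrow> (\<forall>i<r. v i \<in> car H \<and> w i \<in> car H) \<and>
     comul H h = (\<Sum>i<r. tens H H (v i) (w i))"
    unfolding swd_def .
  then have *: "(\<forall>i<swn h. swl h i \<in> car H \<and> swr h i \<in> car H) \<and>
     comul H h = (\<Sum>i<swn h. tens H H (swl h i) (swr h i))"
    by (simp add: swn_def swl_def swr_def split_beta)
  show "i < swn h \<Longrightarrow> swl h i \<in> car H" "i < swn h \<Longrightarrow> swr h i \<in> car H"
    "comul H h = (\<Sum>i<swn h. tens H H (swl h i) (swr h i))" using * by auto
qed

lemma swsum_cong:
  assumes "h \<in> car H" "\<And>x y. x \<in> car H \<Longrightarrow> y \<in> car H \<Longrightarrow> b x y = b' x y"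
  shows "swsum b h = swsum b' h"
  unfolding swsum_def using assms swl_mem swr_mem by (intro sum.cong) auto

lemma tlift_comul:
  assumes "is_vs U" "bilin H H U b" "h \<in> car H"
  shows "tlift H H b (comul H h) = swsum b h"
  unfolding swsum_def comul_sum[OF assms(3)]
  using swl_mem swr_mem assms by (intro tlift_sum[OF vs_H vs_H assms(1,2)]) auto

lemma lin_swsum:
  assumes "is_vs U" "bilin H H U b"
  shows "lin H U (swsum b)"
proof -
  have l: "lin H U (\<lambda>h. tlift H H b (comul H h))"
    by (rule lin_comp[OF lin_comul tensor_universal(1)[OF vs_H vs_H assms]])
  show ?thesis
    using l vs_add[OF vs_H] vs_scale[OF vs_H] by (simp add: lin_def tlift_comul[OF assms])
qed

lemma lin_swsum_param:
  assumes "is_vs U" "h \<in> car H" "\<And>x y. x \<in> car H \<Longrightarrow> y \<in> car H \<Longrightarrow> lin V U (\<lambda>u. b u x y)"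
  shows "lin V U (\<lambda>u. swsum (b u) h)"
  unfolding swsum_def using assms swl_mem swr_mem by (intro lin_sum_fun) auto

lemma lin_swsum_fun:
  assumes "is_vs U" "is_vs W" "bilin H H U b" "lin U W f" "h \<in> car H"
  shows "f (swsum b h) = swsum (\<lambda>x y. f (b x y)) h"
  unfolding swsum_def using assms swl_mem swr_mem
  by (intro lin_setsum[OF assms(1,2,4)] bilin_mem[OF assms(3)]) auto

lemma swsum_swap: "swsum (\<lambda>x y. swsum (\<lambda>u v. F x y u v) b) a = swsum (\<lambda>u v. swsum (\<lambda>x y. F x y u v) a) b"
  unfolding swsum_def by (rule sum.swap)

lemma swsum_sum: "swsum (\<lambda>x y. \<Sum>i\<in>I. F i x y) a = (\<Sum>i\<in>I. swsum (F i) a)"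
  unfolding swsum_def by (rule sum.swap)

lemma swsum_mult:
  fixes b :: "'h \<Rightarrow> 'h \<Rightarrow> 'k"
  shows "swsum b h * c = swsum (\<lambda>x y. b x y * c) h" "c * swsum b h = swsum (\<lambda>x y. c * b x y) h"
  unfolding swsum_def by (rule sum_distrib_right, rule sum_distrib_left)

lemma swsum_counit_left:
  assumes "lin H ground f" "h \<in> car H"
  shows "swsum (\<lambda>x y. counit H x * f y) h = f h"
proof -
  have b: "bilin H H H (\<lambda>x y. scl H (counit H x) y)"
    using bilin_scl[OF vs_H lin_counit] by (auto simp: bilin_def)
  have "f h = f (swsum (\<lambda>x y. scl H (counit H x) y) h)"
    using hopf assms(2) tlift_comul[OF vs_H b assms(2)]
    unfolding hopf_algebra_def is_coalgebra_def by simp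
  also have "\<dots> = swsum (\<lambda>x y. f (scl H (counit H x) y)) h"
    by (rule lin_swsum_fun[OF vs_H is_vs_ground b assms])
  also have "\<dots> = swsum (\<lambda>x y. counit H x * f y) h"
    using lin_scale[OF assms(1)] by (intro swsum_cong[OF assms(2)]) simp
  finally show ?thesis by simp
qed

lemma swsum_counit_right:
  assumes "lin H ground f" "h \<in> car H"
  shows "swsum (\<lambda>x y. f x * counit H y) h = f h"
proof -
  have b: "bilin H H H (\<lambda>x y. scl H (counit H y) x)"
    using bilin_scl[OF vs_H lin_counit] .
  have "f h = f (swsum (\<lambda>x y. scl H (counit H y) x) h)"
    using hopf assms(2) tlift_comul[OF vs_H b assms(2)]
    unfolding hopf_algebra_def is_coalgebra_def by simp
  also have "\<dots> = swsum (\<lambda>x y. f (scl H (counit H y) x)) h"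
    by (rule lin_swsum_fun[OF vs_H is_vs_ground b assms])
  also have "\<dots> = swsum (\<lambda>x y. f x * counit H y) h"
    using lin_scale[OF assms(1)] by (intro swsum_cong[OF assms(2)]) (simp add: mult.commute)
  finally show ?thesis by simp
qed

lemma swsum_coassoc:
  fixes F :: "'h \<Rightarrow> 'h \<Rightarrow> 'h \<Rightarrow> 'k"
  assumes F1: "\<And>y z. y \<in> car H \<Longrightarrow> z \<in> car H \<Longrightarrow> lin H ground (\<lambda>x. F x y z)"
    and F2: "\<And>x z. x \<in> car H \<Longrightarrow> z \<in> car H \<Longrightarrow> lin H ground (\<lambda>y. F x y z)"
    and F3: "\<And>x y. x \<in> car H \<Longrightarrow> y \<in> car H \<Longrightarrow> lin H ground (\<lambda>z. F x y z)"
    and h: "h \<in> car H"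
  shows "swsum (\<lambda>a c. swsum (\<lambda>x y. F x y c) a) h = swsum (\<lambda>a c. swsum (\<lambda>x y. F a x y) c) h"
proof -
  let ?T = "tensor_vs H (tensor_vs H H)"
  have bF: "bilin H H ground (F u)" if "u \<in> car H" for u
    by (rule bilinI) (use that F2 F3 in auto)
  note t3 = tlift3_sum[OF vs_H vs_H vs_H is_vs_ground bF F1]
  have "tassoc H H H (tmap H H (tensor_vs H H) H (comul H) id (comul H h)) =
      (\<Sum>i<swn h. \<Sum>j<swn (swl h i). tens H (tensor_vs H H) (swl (swl h i) j) (tens H H (swr (swl h i) j) (swr h i)))"
    unfolding comul_sum[OF h] by (rule tassoc_tmap_sum[OF vs_H vs_H lin_comul])
      (use h swl_mem swr_mem comul_sum in auto)
  moreover have "tlift H (tensor_vs H H) (\<lambda>u t. tlift H H (F u) t) \<dots> = swsum (\<lambda>a c. swsum (\<lambda>x y. F x y c) a) h"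
    unfolding swsum_def by (rule t3) (use h swl_mem swr_mem in auto)
  moreover have "tmap H H H (tensor_vs H H) id (comul H) (comul H h) = (\<Sum>i<swn h. \<Sum>j<swn (swr h i).
      tens H (tensor_vs H H) (swl h i) (tens H H (swl (swr h i) j) (swr (swr h i) j)))"
    unfolding comul_sum[OF h] by (rule tmap_right_sum[OF vs_H vs_H lin_comul])
      (use h swl_mem swr_mem comul_sum in auto)
  moreover have "tlift H (tensor_vs H H) (\<lambda>u t. tlift H H (F u) t) \<dots> = swsum (\<lambda>a c. swsum (\<lambda>x y. F a x y) c) h"
    unfolding swsum_def by (rule t3) (use h swl_mem swr_mem in auto)
  moreover have "tassoc H H H (tmap H H (tensor_vs H H) H (comul H) id (comul H h)) =
      tmap H H H (tensor_vs H H) id (comul H) (comul H h)"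
    using hopf h unfolding hopf_algebra_def is_coalgebra_def by blast
  ultimately show ?thesis by simp
qed

text \<open>Multiplicativity of the coproduct.\<close>

lemma swsum_mul:
  assumes U: "is_vs U" and b: "bilin H H U b" and a: "a \<in> car H" and a': "a' \<in> car H"
  shows "swsum b (mul H a a') = swsum (\<lambda>x y. swsum (\<lambda>x' y'. b (mul H x x') (mul H y y')) a') a"
proof -
  have b1: "bilin H H (tensor_vs H H) (\<lambda>c d. tens H H (mul H x c) (mul H y d))"
    if "x \<in> car H" "y \<in> car H" for x y
    by (rule bilin_comp[OF bilin_tens lin_mul_right lin_mul_right]) (use that in auto)
  have e: "tlift H H (\<lambda>c d. tens H H (mul H x c) (mul H y d)) (comul H a') =
      swsum (\<lambda>c d. tens H H (mul H x c) (mul H y d)) a'" if "x \<in> car H" "y \<in> car H" for x y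
    by (rule tlift_comul[OF is_vs_tensor_vs b1[OF that] a'])
  have b2: "bilin H H (tensor_vs H H) (\<lambda>x y. tlift H H (\<lambda>c d. tens H H (mul H x c) (mul H y d)) (comul H a'))"
  proof (rule bilinI)
    fix x assume x: "x \<in> car H"
    have "lin H (tensor_vs H H) (\<lambda>y. swsum (\<lambda>c d. tens H H (mul H x c) (mul H y d)) a')"
      using x by (intro lin_swsum_param[OF is_vs_tensor_vs a'] lin_comp[OF lin_mul_left bilin_right[OF bilin_tens]] mul_mem)
    then show "lin H (tensor_vs H H) (\<lambda>y. tlift H H (\<lambda>c d. tens H H (mul H x c) (mul H y d)) (comul H a'))"
      using x e vs_add[OF vs_H] vs_scale[OF vs_H] by (simp add: lin_def)
  next
    fix y assume y: "y \<in> car H"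
    have "lin H (tensor_vs H H) (\<lambda>x. swsum (\<lambda>c d. tens H H (mul H x c) (mul H y d)) a')"
      using y by (intro lin_swsum_param[OF is_vs_tensor_vs a'] lin_comp[OF lin_mul_left bilin_left[OF bilin_tens]] mul_mem)
    then show "lin H (tensor_vs H H) (\<lambda>x. tlift H H (\<lambda>c d. tens H H (mul H x c) (mul H y d)) (comul H a'))"
      using y e vs_add[OF vs_H] vs_scale[OF vs_H] by (simp add: lin_def)
  qed
  have "comul H (mul H a a') = tensor_mul H (comul H a) (comul H a')"
    using hopf a a' unfolding hopf_algebra_def by blast
  also have "\<dots> = swsum (\<lambda>x y. tlift H H (\<lambda>c d. tens H H (mul H x c) (mul H y d)) (comul H a')) a"
    unfolding tensor_mul_def by (rule tlift_comul[OF is_vs_tensor_vs b2 a])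
  also have "\<dots> = swsum (\<lambda>x y. swsum (\<lambda>c d. tens H H (mul H x c) (mul H y d)) a') a"
    by (rule swsum_cong[OF a e])
  finally have "comul H (mul H a a') = (\<Sum>p\<in>{..<swn a} \<times> {..<swn a'}.
      tens H H (mul H (swl a (fst p)) (swl a' (snd p))) (mul H (swr a (fst p)) (swr a' (snd p))))"
    by (simp add: swsum_def sum.cartesian_product split_beta)
  then have "tlift H H b (comul H (mul H a a')) = (\<Sum>p\<in>{..<swn a} \<times> {..<swn a'}.
      b (mul H (swl a (fst p)) (swl a' (snd p))) (mul H (swr a (fst p)) (swr a' (snd p))))"
    by (simp only:, intro tlift_sum[OF vs_H vs_H U b]) (use a a' swl_mem swr_mem in \<open>auto intro: mul_mem\<close>)
  then show ?thesis
    by (simp add: tlift_comul[OF U b mul_mem[OF a a']] swsum_def sum.cartesian_product split_beta)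
qed

lemma swsum_unt:
  assumes "is_vs U" "bilin H H U b"
  shows "swsum b (unt H) = b (unt H) (unt H)"
proof -
  have "comul H (unt H) = tens H H (unt H) (unt H)" using hopf unfolding hopf_algebra_def by blast
  then show ?thesis
    using tlift_comul[OF assms unt_mem] tensor_universal(2)[OF vs_H vs_H assms unt_mem unt_mem] by simp
qed

lemma swsum_antip:
  assumes f: "lin H ground f" and h: "h \<in> car H"
  shows swsum_antip_left: "swsum (\<lambda>x y. f (mul H (antip H x) y)) h = counit H h * f (unt H)"
    and swsum_antip_right: "swsum (\<lambda>x y. f (mul H x (antip H y))) h = counit H h * f (unt H)"
proof -
  have lid: "lin H H (\<lambda>x. x)" by (simp add: lin_id)
  have b1: "bilin H H H (\<lambda>x y. mul H (antip H x) y)" by (rule bilin_comp[OF bilin_mul lin_antip lid])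
  have b2: "bilin H H H (\<lambda>x y. mul H x (antip H y))" by (rule bilin_comp[OF bilin_mul lid lin_antip])
  have "swsum (\<lambda>x y. mul H (antip H x) y) h = scl H (counit H h) (unt H)"
    "swsum (\<lambda>x y. mul H x (antip H y)) h = scl H (counit H h) (unt H)"
    using hopf h tlift_comul[OF vs_H b1 h] tlift_comul[OF vs_H b2 h] unfolding hopf_algebra_def by auto
  then show "swsum (\<lambda>x y. f (mul H (antip H x) y)) h = counit H h * f (unt H)"
    "swsum (\<lambda>x y. f (mul H x (antip H y))) h = counit H h * f (unt H)"
    using lin_swsum_fun[OF vs_H is_vs_ground b1 f h] lin_swsum_fun[OF vs_H is_vs_ground b2 f h]
      lin_scale[OF f unt_mem] by auto
qed

lemma swsum_product:
  fixes A B :: "'h \<Rightarrow> 'h \<Rightarrow> 'k"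
  shows "swsum A a * swsum B b = swsum (\<lambda>x y. swsum (\<lambda>x' y'. A x y * B x' y') b) a"
  unfolding swsum_def by (rule sum_product)

text \<open>The antipode is anti-multiplicative; the equality is stated after applying a functional so that all
  Sweedler sums take values in the field.  In Sweedler notation,
  \<open>S b \<cdot> S a = \<Sum> \<epsilon>(a\<^sub>1 b\<^sub>1) S b\<^sub>2 \<cdot> S a\<^sub>2
    = \<Sum> S(a\<^sub>1 b\<^sub>1) a\<^sub>2 b\<^sub>2 \<cdot> S b\<^sub>3 \<cdot> S a\<^sub>3\<close>, and here \<open>b\<^sub>2 \<cdot> S b\<^sub>3\<close>
  and then \<open>a\<^sub>2 \<cdot> S a\<^sub>3\<close> collapse, which leaves \<open>S(a b)\<close>.\<close>

lemma antip_mul: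
  assumes f: "lin H ground f" and a: "a \<in> car H" and b: "b \<in> car H"
  shows "f (antip H (mul H a b)) = f (mul H (antip H b) (antip H a))"
proof -
  let ?S = "antip H" and ?m = "mul H"
  define G where "G = (\<lambda>x y x' y' u v. f (?m (?m (?S (?m x y)) (?m x' y')) (?m (?S v) (?S u))))"
  note mem = mul_mem antip_mem
  have G: "lin H ground (\<lambda>x. G x y x' y' u v)" "lin H ground (\<lambda>y. G x y x' y' u v)"
    "lin H ground (\<lambda>x'. G x y x' y' u v)" "lin H ground (\<lambda>y'. G x y x' y' u v)"
    "lin H ground (\<lambda>u. G x y x' y' u v)" "lin H ground (\<lambda>v. G x y x' y' u v)"
    if "x \<in> car H" "y \<in> car H" "x' \<in> car H" "y' \<in> car H" "u \<in> car H" "v \<in> car H" for x y x' y' u v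
    unfolding G_def using that
    by (auto intro!: lin_comp[OF lin_comp[OF lin_comp[OF lin_comp[OF lin_mul_left lin_antip] lin_mul_left] lin_mul_left] f]
      lin_comp[OF lin_comp[OF lin_comp[OF lin_comp[OF lin_mul_right lin_antip] lin_mul_left] lin_mul_left] f]
      lin_comp[OF lin_comp[OF lin_comp[OF lin_mul_left lin_mul_right] lin_mul_left] f]
      lin_comp[OF lin_comp[OF lin_comp[OF lin_mul_right lin_mul_right] lin_mul_left] f]
      lin_comp[OF lin_comp[OF lin_comp[OF lin_antip lin_mul_right] lin_mul_right] f]
      lin_comp[OF lin_comp[OF lin_comp[OF lin_antip lin_mul_left] lin_mul_right] f] mem)
  have sw: "lin V ground (\<lambda>w. swsum (B w) h)"
    if "\<And>x y. x \<in> car H \<Longrightarrow> y \<in> car H \<Longrightarrow> lin V ground (\<lambda>w. B w x y)" "h \<in> car H"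
    for V :: "('k, 'h) hopf" and B h
    using that by (intro lin_swsum_param[OF is_vs_ground])
  have "f (?m (?S b) (?S a)) = swsum (\<lambda>x u. counit H x * f (?m (?S b) (?S u))) a"
    using a b by (intro swsum_counit_left[symmetric] lin_comp[OF lin_comp[OF lin_antip lin_mul_right] f]) (auto intro: mem)
  also have "\<dots> = swsum (\<lambda>x u. swsum (\<lambda>y v. counit H x * (counit H y * f (?m (?S v) (?S u)))) b) a"
    using b by (intro swsum_cong[OF a], subst swsum_counit_left[symmetric, where h = b])
      (auto simp: swsum_mult intro!: lin_comp[OF lin_comp[OF lin_antip lin_mul_left] f] mem)
  (* the antipode axiom for the product x y, whose coproduct is the product of the coproducts *)
  also have "\<dots> = swsum (\<lambda>x u. swsum (\<lambda>y v. swsum (\<lambda>p p'. swsum (\<lambda>q q'. G p q p' q' u v) y) x) b) a"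
  proof (intro swsum_cong a b)
    fix x u y v assume m: "x \<in> car H" "u \<in> car H" "y \<in> car H" "v \<in> car H"
    have l: "lin H ground (\<lambda>w. f (?m w (?m (?S v) (?S u))))"
      using m by (intro lin_comp[OF lin_mul_left f]) (auto intro: mem)
    have bl: "bilin H H ground (\<lambda>p q. f (?m (?m (?S p) q) (?m (?S v) (?S u))))"
      by (rule bilin_comp[OF lin_bilin[OF bilin_mul l] lin_antip lin_id]) auto
    have "counit H x * (counit H y * f (?m (?S v) (?S u))) =
      swsum (\<lambda>p q. f (?m (?m (?S p) q) (?m (?S v) (?S u)))) (?m x y)"
      using m swsum_antip_left[OF l mul_mem[OF m(1,3)]] by (simp add: counit_mul mul_unt_left mem)
    also have "\<dots> = swsum (\<lambda>p p'. swsum (\<lambda>q q'. G p q p' q' u v) y) x"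
      unfolding G_def by (rule swsum_mul[OF is_vs_ground bl m(1,3)])
    finally show "counit H x * (counit H y * f (?m (?S v) (?S u))) = \<dots>" .
  qed
  also have "\<dots> = swsum (\<lambda>x u. swsum (\<lambda>p p'. swsum (\<lambda>y v. swsum (\<lambda>q q'. G p q p' q' u v) y) b) x) a"
    by (subst swsum_swap) (rule refl)
  (* coassociativity for b, then for a *)
  also have "\<dots> = swsum (\<lambda>x u. swsum (\<lambda>p p'. swsum (\<lambda>q w. swsum (\<lambda>q' v. G p q p' q' u v) w) b) x) a"
    using a b by (intro swsum_cong swsum_coassoc G) auto
  also have "\<dots> = swsum (\<lambda>p z. swsum (\<lambda>p' u. swsum (\<lambda>q w. swsum (\<lambda>q' v. G p q p' q' u v) w) b) z) a"
    using a b by (intro swsum_coassoc sw G) auto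
  also have "\<dots> = swsum (\<lambda>p z. swsum (\<lambda>p' u. swsum (\<lambda>q w. f (?m (?S (?m p q)) (?m p' (?S u))) * counit H w) b) z) a"
  proof (intro swsum_cong a b)
    fix p z p' u q w
    assume m: "p \<in> car H" "z \<in> car H" "p' \<in> car H" "u \<in> car H" "q \<in> car H" "w \<in> car H"
    have l: "lin H ground (\<lambda>t. f (?m (?m (?S (?m p q)) p') (?m t (?S u))))"
      using m by (intro lin_comp[OF lin_comp[OF lin_mul_left lin_mul_right] f]) (auto intro: mem)
    have "swsum (\<lambda>q' v. G p q p' q' u v) w = swsum (\<lambda>q' v. f (?m (?m (?S (?m p q)) p') (?m (?m q' (?S v)) (?S u)))) w"
      unfolding G_def using m by (intro swsum_cong) (simp_all add: mul_assoc mem)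
    then show "swsum (\<lambda>q' v. G p q p' q' u v) w = f (?m (?S (?m p q)) (?m p' (?S u))) * counit H w"
      using swsum_antip_right[OF l m(6)] m by (simp add: mul_assoc mul_unt_left mem)
  qed
  also have "\<dots> = swsum (\<lambda>p z. swsum (\<lambda>p' u. f (?m (?S (?m p b)) (?m p' (?S u)))) z) a"
    using a b by (intro swsum_cong swsum_counit_right
        lin_comp[OF lin_comp[OF lin_comp[OF lin_mul_right lin_antip] lin_mul_left] f]) (auto intro: mem)
  also have "\<dots> = swsum (\<lambda>p z. f (?S (?m p b)) * counit H z) a"
    using a b swsum_antip_right[OF lin_comp[OF lin_mul_right f]]
    by (intro swsum_cong) (auto simp: mul_unt_right mem)
  also have "\<dots> = f (?S (?m a b))"
    using a b by (intro swsum_counit_right lin_comp[OF lin_comp[OF lin_mul_left lin_antip] f])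
  finally show ?thesis by simp
qed

lemma antip_unt:
  assumes f: "lin H ground f"
  shows "f (antip H (unt H)) = f (unt H)"
proof -
  have b: "bilin H H ground (\<lambda>x y. f (mul H (antip H x) y))"
    by (rule bilin_comp[OF lin_bilin[OF bilin_mul f] lin_antip lin_id]) auto
  show ?thesis
    using swsum_antip_left[OF f unt_mem] swsum_unt[OF is_vs_ground b] unt_mem
    by (simp add: counit_unt mul_unt_right antip_mem)
qed

section \<open>The convolution algebra of linear functionals\<close>

abbreviation Hd :: "('h \<Rightarrow> 'k) set" where "Hd \<equiv> car (dual_vs H)"

lemma Hd_iff: "f \<in> Hd \<longleftrightarrow> lin H ground f \<and> (\<forall>h. h \<notin> car H \<longrightarrow> f h = 0)"
  by (simp add: dual_vs_def)

lemma Hd_lin: "f \<in> Hd \<Longrightarrow> lin H ground f" and Hd_zero: "f \<in> Hd \<Longrightarrow> h \<notin> car H \<Longrightarrow> f h = 0"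
  by (simp_all add: Hd_iff)

text \<open>The product dual to the coproduct.  On linear functionals it is the multiplication of the finite dual;
  as a finite sum of products it is additive in both arguments for arbitrary functions.\<close>

definition conv :: "('h \<Rightarrow> 'k) \<Rightarrow> ('h \<Rightarrow> 'k) \<Rightarrow> 'h \<Rightarrow> 'k" where
  "conv f g = (\<lambda>h. if h \<in> car H then swsum (\<lambda>x y. f x * g y) h else 0)"

text \<open>The counit, which is the unit element for convolution.\<close>

definition eps :: "'h \<Rightarrow> 'k" where "eps = (\<lambda>h. if h \<in> car H then counit H h else 0)"

text \<open>The antipode acting on functionals.\<close>

definition Sd :: "('h \<Rightarrow> 'k) \<Rightarrow> 'h \<Rightarrow> 'k" where
  "Sd f = (\<lambda>h. if h \<in> car H then f (antip H h) else 0)"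

lemma restrict_Hd: "lin H ground f \<Longrightarrow> (\<lambda>h. if h \<in> car H then f h else 0) \<in> Hd"
  using vs_add[OF vs_H] vs_scale[OF vs_H] by (simp add: Hd_iff lin_def)

lemma conv_Hd: "f \<in> Hd \<Longrightarrow> g \<in> Hd \<Longrightarrow> conv f g \<in> Hd"
  unfolding conv_def by (intro restrict_Hd lin_swsum[OF is_vs_ground] bilin_mult Hd_lin)

lemma eps_Hd: "eps \<in> Hd"
  unfolding eps_def by (intro restrict_Hd lin_counit)

lemma Sd_Hd: "f \<in> Hd \<Longrightarrow> Sd f \<in> Hd"
  unfolding Sd_def by (intro restrict_Hd lin_comp[OF lin_antip] Hd_lin)

lemma mul_fin_dual: "f \<in> Hd \<Longrightarrow> g \<in> Hd \<Longrightarrow> mul (fin_dual H) f g = conv f g"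
  by (auto simp: fin_dual_def conv_def fun_eq_iff intro!: tlift_comul[OF is_vs_ground] bilin_mult Hd_lin)

lemma unt_fin_dual: "unt (fin_dual H) = eps"
  by (simp add: fin_dual_def eps_def)

lemma antip_fin_dual: "antip (fin_dual H) f = Sd f"
  by (simp add: fin_dual_def Sd_def)

lemma conv_sum_left: "conv (\<Sum>i\<in>I. f i) g = (\<Sum>i\<in>I. conv (f i) g)"
  and conv_sum_right: "conv g (\<Sum>i\<in>I. f i) = (\<Sum>i\<in>I. conv g (f i))"
  by (auto simp: conv_def fun_eq_iff sum_fun_apply sum_distrib_left sum_distrib_right swsum_sum)

lemma conv_add_left: "conv (f + f') g = conv f g + conv f' g"
  and conv_add_right: "conv g (f + f') = conv g f + conv g f'"
  by (auto simp: conv_def fun_eq_iff swsum_def algebra_simps sum.distrib)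

lemma conv_scale_left: "conv (\<lambda>x. c * f x) g = (\<lambda>x. c * conv f g x)"
  and conv_scale_right: "conv f (\<lambda>x. c * g x) = (\<lambda>x. c * conv f g x)"
  by (auto simp: conv_def fun_eq_iff swsum_def algebra_simps sum_distrib_left)

lemma conv_zero_left: "conv (\<lambda>_. 0) g = (\<lambda>_. 0)" and conv_zero_right: "conv g (\<lambda>_. 0) = (\<lambda>_. 0)"
  by (auto simp: conv_def fun_eq_iff swsum_def)

lemma conv_eps_left: "f \<in> Hd \<Longrightarrow> conv eps f = f"
proof (rule ext)
  fix h assume f: "f \<in> Hd"
  show "conv eps f h = f h"
  proof (cases "h \<in> car H")
    case True
    then have "swsum (\<lambda>x y. eps x * f y) h = swsum (\<lambda>x y. counit H x * f y) h"
      by (intro swsum_cong) (auto simp: eps_def)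
    then show ?thesis using swsum_counit_left[OF Hd_lin[OF f] True] True by (simp add: conv_def)
  qed (use f in \<open>simp add: conv_def Hd_zero\<close>)
qed

lemma conv_eps_right: "f \<in> Hd \<Longrightarrow> conv f eps = f"
proof (rule ext)
  fix h assume f: "f \<in> Hd"
  show "conv f eps h = f h"
  proof (cases "h \<in> car H")
    case True
    then have "swsum (\<lambda>x y. f x * eps y) h = swsum (\<lambda>x y. f x * counit H y) h"
      by (intro swsum_cong) (auto simp: eps_def)
    then show ?thesis using swsum_counit_right[OF Hd_lin[OF f] True] True by (simp add: conv_def)
  qed (use f in \<open>simp add: conv_def Hd_zero\<close>)
qed

lemma conv_assoc:
  assumes "f \<in> Hd" "g \<in> Hd" "k \<in> Hd"
  shows "conv (conv f g) k = conv f (conv g k)"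
proof (rule ext)
  fix h
  show "conv (conv f g) k h = conv f (conv g k) h"
  proof (cases "h \<in> car H")
    case True
    have "conv (conv f g) k h = swsum (\<lambda>a c. swsum (\<lambda>x y. f x * g y * k c) a) h"
      using True by (auto simp: conv_def swsum_mult intro!: swsum_cong)
    also have "\<dots> = swsum (\<lambda>a c. swsum (\<lambda>x y. f a * g x * k y) c) h"
      using assms True by (intro swsum_coassoc lin_ground_mult Hd_lin)
    also have "\<dots> = conv f (conv g k) h"
      using True by (auto simp: conv_def swsum_mult mult.assoc intro!: swsum_cong)
    finally show ?thesis .
  qed (simp add: conv_def)
qed

lemma Sd_add: "Sd (u + v) = Sd u + Sd v"
  and Sd_scale: "Sd (\<lambda>x. k * u x) = (\<lambda>x. k * Sd u x)"
  and Sd_zero: "Sd 0 = 0"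
  by (auto simp: Sd_def)

lemma conv_0: "conv 0 g = 0" "conv g 0 = 0"
  using conv_zero_left[of g] conv_zero_right[of g] by (auto simp: zero_fun_def)

section \<open>Matrices of functionals and the antipode\<close>

text \<open>A matrix of functionals is the coefficient matrix of a representation in the basis indexed by
  \<open>I\<close>.\<close>

definition rep_mat :: "'i set \<Rightarrow> ('i \<Rightarrow> 'i \<Rightarrow> 'h \<Rightarrow> 'k) \<Rightarrow> bool" where
  "rep_mat I c \<longleftrightarrow> finite I \<and> (\<forall>i\<in>I. \<forall>j\<in>I. c i j \<in> Hd \<and> c i j (unt H) = (if i = j then 1 else 0) \<and>
     (\<forall>a\<in>car H. \<forall>b\<in>car H. c i j (mul H a b) = (\<Sum>k\<in>I. c i k a * c k j b)))"

lemma rep_matD: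
  assumes "rep_mat I c"
  shows rep_finite: "finite I" and rep_Hd: "i \<in> I \<Longrightarrow> j \<in> I \<Longrightarrow> c i j \<in> Hd"
    and rep_unt: "i \<in> I \<Longrightarrow> j \<in> I \<Longrightarrow> c i j (unt H) = (if i = j then 1 else 0)"
    and rep_mul: "i \<in> I \<Longrightarrow> j \<in> I \<Longrightarrow> a \<in> car H \<Longrightarrow> b \<in> car H \<Longrightarrow>
      c i j (mul H a b) = (\<Sum>k\<in>I. c i k a * c k j b)"
  using assms by (auto simp: rep_mat_def)

lemma rep_lin: "rep_mat I c \<Longrightarrow> i \<in> I \<Longrightarrow> j \<in> I \<Longrightarrow> lin H ground (c i j)"
  by (rule Hd_lin[OF rep_Hd])

text \<open>Apply \<open>c i j\<close> to the antipode axioms \<open>\<Sum> S h\<^sub>1 \<cdot> h\<^sub>2 = \<epsilon>(h) 1\<close> and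
  \<open>\<Sum> h\<^sub>1 \<cdot> S h\<^sub>2 = \<epsilon>(h) 1\<close> and expand the product.\<close>

lemma rep_inverse:
  assumes c: "rep_mat I c" and i: "i \<in> I" and j: "j \<in> I"
  shows rep_inverse_left: "(\<Sum>k\<in>I. conv (Sd (c i k)) (c k j)) = (if i = j then eps else 0)"
    and rep_inverse_right: "(\<Sum>k\<in>I. conv (c i k) (Sd (c k j))) = (if i = j then eps else 0)"
proof -
  have "(\<Sum>k\<in>I. conv (Sd (c i k)) (c k j)) h = (if i = j then eps else 0) h \<and>
    (\<Sum>k\<in>I. conv (c i k) (Sd (c k j))) h = (if i = j then eps else 0) h" for h
  proof (cases "h \<in> car H")
    case True
    have "(\<Sum>k\<in>I. conv (Sd (c i k)) (c k j)) h = swsum (\<lambda>x y. \<Sum>k\<in>I. Sd (c i k) x * c k j y) h"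
      using True by (simp add: sum_fun_apply conv_def swsum_sum)
    also have "\<dots> = swsum (\<lambda>x y. c i j (mul H (antip H x) y)) h"
      using True by (intro swsum_cong) (auto simp: Sd_def rep_mul[OF c i j] antip_mem)
    also have "\<dots> = (if i = j then eps else 0) h"
      using swsum_antip_left[OF rep_lin[OF c i j] True] rep_unt[OF c i j] True by (simp add: eps_def)
    finally have 1: "(\<Sum>k\<in>I. conv (Sd (c i k)) (c k j)) h = (if i = j then eps else 0) h" .
    have "(\<Sum>k\<in>I. conv (c i k) (Sd (c k j))) h = swsum (\<lambda>x y. \<Sum>k\<in>I. c i k x * Sd (c k j) y) h"
      using True by (simp add: sum_fun_apply conv_def swsum_sum)
    also have "\<dots> = swsum (\<lambda>x y. c i j (mul H x (antip H y))) h"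
      using True by (intro swsum_cong) (auto simp: Sd_def rep_mul[OF c i j] antip_mem)
    also have "\<dots> = (if i = j then eps else 0) h"
      using swsum_antip_right[OF rep_lin[OF c i j] True] rep_unt[OF c i j] True by (simp add: eps_def)
    finally show ?thesis using 1 by simp
  qed (simp add: sum_fun_apply conv_def eps_def)
  then show "(\<Sum>k\<in>I. conv (Sd (c i k)) (c k j)) = (if i = j then eps else 0)"
    "(\<Sum>k\<in>I. conv (c i k) (Sd (c k j))) = (if i = j then eps else 0)" by (blast intro: ext)+
qed

text \<open>The contragredient representation.\<close>

lemma rep_mat_dual:
  assumes c: "rep_mat I c"
  shows "rep_mat I (\<lambda>i j. Sd (c j i))"
  unfolding rep_mat_def
proof (intro conjI ballI)
  show "finite I" by (rule rep_finite[OF c])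
  fix i j assume ij: "i \<in> I" "j \<in> I"
  show "Sd (c j i) \<in> Hd" using ij by (intro Sd_Hd rep_Hd[OF c])
  show "Sd (c j i) (unt H) = (if i = j then 1 else 0)"
    using antip_unt[OF rep_lin[OF c ij(2,1)]] rep_unt[OF c ij(2,1)] unt_mem by (auto simp: Sd_def)
  fix a b assume ab: "a \<in> car H" "b \<in> car H"
  then show "Sd (c j i) (mul H a b) = (\<Sum>k\<in>I. Sd (c k i) a * Sd (c j k) b)"
    using antip_mul[OF rep_lin[OF c ij(2,1)] ab] rep_mul[OF c ij(2,1)]
    by (simp add: Sd_def mul_mem antip_mem mult.commute)
qed

lemma rep_mat_eps: "rep_mat {()} (\<lambda>_ _. eps)"
  using eps_Hd unt_mem by (auto simp: rep_mat_def eps_def counit_unt counit_mul mul_mem)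

text \<open>The counit is a one by one matrix; the formula for the inverse matrix gives \<open>S \<epsilon> \<cdot> \<epsilon> = \<epsilon>\<close>.\<close>

lemma Sd_eps: "Sd eps = eps"
  using rep_inverse_left[OF rep_mat_eps, of "()" "()"] conv_eps_right[OF Sd_Hd[OF eps_Hd]] by simp

text \<open>The matrix of a tensor product of representations; it is multiplicative because the coproduct of
  \<open>H\<close> is.\<close>

lemma rep_mat_conv:
  assumes c: "rep_mat I c" and d: "rep_mat J d"
  shows "rep_mat (I \<times> J) (\<lambda>p q. conv (c (fst p) (fst q)) (d (snd p) (snd q)))"
  unfolding rep_mat_def
proof (intro conjI ballI)
  show "finite (I \<times> J)" using rep_finite[OF c] rep_finite[OF d] by simp
  fix p q assume pq: "p \<in> I \<times> J" "q \<in> I \<times> J"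
  then have m: "fst p \<in> I" "snd p \<in> J" "fst q \<in> I" "snd q \<in> J" by auto
  let ?cd = "conv (c (fst p) (fst q)) (d (snd p) (snd q))"
  have bl: "bilin H H ground (\<lambda>x y. c (fst p) (fst q) x * d (snd p) (snd q) y)"
    using m by (intro bilin_mult rep_lin[OF c] rep_lin[OF d])
  show "?cd \<in> Hd" using m by (intro conv_Hd rep_Hd[OF c] rep_Hd[OF d])
  show "?cd (unt H) = (if p = q then 1 else 0)"
    using m unt_mem swsum_unt[OF is_vs_ground bl]
    by (auto simp: conv_def rep_unt[OF c] rep_unt[OF d] prod_eq_iff)
  fix a b assume ab: "a \<in> car H" "b \<in> car H"
  have "?cd (mul H a b) = swsum (\<lambda>x y. swsum (\<lambda>x' y'. c (fst p) (fst q) (mul H x x') * d (snd p) (snd q) (mul H y y')) b) a"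
    using ab swsum_mul[OF is_vs_ground bl ab] by (simp add: conv_def mul_mem)
  also have "\<dots> = swsum (\<lambda>x y. swsum (\<lambda>x' y'. \<Sum>r\<in>I\<times>J. (c (fst p) (fst r) x * d (snd p) (snd r) y) *
      (c (fst r) (fst q) x' * d (snd r) (snd q) y')) b) a"
  proof (intro swsum_cong ab)
    fix x y x' y' assume xy: "x \<in> car H" "y \<in> car H" "x' \<in> car H" "y' \<in> car H"
    have "c (fst p) (fst q) (mul H x x') * d (snd p) (snd q) (mul H y y') =
      (\<Sum>i\<in>I. \<Sum>j\<in>J. (c (fst p) i x * c i (fst q) x') * (d (snd p) j y * d j (snd q) y'))"
      using m xy by (simp add: rep_mul[OF c] rep_mul[OF d] sum_product)
    also have "\<dots> = (\<Sum>r\<in>I\<times>J. (c (fst p) (fst r) x * d (snd p) (snd r) y) *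
      (c (fst r) (fst q) x' * d (snd r) (snd q) y'))"
      by (simp add: sum.cartesian_product split_beta mult_ac)
    finally show "c (fst p) (fst q) (mul H x x') * d (snd p) (snd q) (mul H y y') = \<dots>" .
  qed
  also have "\<dots> = (\<Sum>r\<in>I\<times>J. conv (c (fst p) (fst r)) (d (snd p) (snd r)) a *
      conv (c (fst r) (fst q)) (d (snd r) (snd q)) b)"
    using ab by (simp add: swsum_sum conv_def swsum_product)
  finally show "?cd (mul H a b) = \<dots>" .
qed

text \<open>The antipode reverses products of coefficients.  The matrix of all \<open>c i k \<cdot> d j l\<close> belongs to a
  representation, so applying the antipode to its entries gives the inverse matrix.  On the other hand the products
  \<open>S (d j l) \<cdot> S (c i k)\<close> form a right inverse, as one sees by cancelling first \<open>d\<close> and then \<open>c\<close>.\<close>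

lemma Sd_conv:
  assumes c: "rep_mat I c" and d: "rep_mat J d" and m: "i \<in> I" "k \<in> I" "j \<in> J" "l \<in> J"
  shows "Sd (conv (c i k) (d j l)) = conv (Sd (d j l)) (Sd (c i k))"
proof -
  let ?C = "\<lambda>p q. conv (c (fst p) (fst q)) (d (snd p) (snd q))"
  let ?R = "\<lambda>p q. conv (Sd (d (snd p) (snd q))) (Sd (c (fst p) (fst q)))"
  note C = rep_mat_conv[OF c d]
  note rc = rep_Hd[OF c] and rd = rep_Hd[OF d]
  have "Sd (?C (i, j) (k, l)) = ?R (i, j) (k, l)"
  proof (rule matrix_inverse_unique[where m = conv and c = ?C and u = eps and I = "I \<times> J" and r = ?R
        and l = "\<lambda>p q. Sd (?C p q)"])
    show "finite (I \<times> J)" by (rule rep_finite[OF C])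
    show "conv (conv (Sd (?C p q)) (?C q r)) (?R r s) = conv (Sd (?C p q)) (conv (?C q r) (?R r s))"
      if "p \<in> I \<times> J" "q \<in> I \<times> J" "r \<in> I \<times> J" "s \<in> I \<times> J" for p q r s
      by (rule conv_assoc; intro Sd_Hd conv_Hd rc rd) (use that in auto)
    show "(\<Sum>q\<in>I \<times> J. conv (Sd (?C p q)) (?C q r)) = (if p = r then eps else 0)"
      if "p \<in> I \<times> J" "r \<in> I \<times> J" for p r by (rule rep_inverse_left[OF C that])
    show "(\<Sum>q\<in>I \<times> J. conv (?C p q) (?R q r)) = (if p = r then eps else 0)"
      if pr: "p \<in> I \<times> J" "r \<in> I \<times> J" for p r
    proof -
      have m: "fst p \<in> I" "snd p \<in> J" "fst r \<in> I" "snd r \<in> J" using pr by auto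
      have step: "(\<Sum>l\<in>J. conv (conv (c (fst p) k) (d (snd p) l)) (conv (Sd (d l (snd r))) (Sd (c k (fst r))))) =
          (if snd p = snd r then conv (c (fst p) k) (Sd (c k (fst r))) else 0)" if k: "k \<in> I" for k
      proof -
        have "(\<Sum>l\<in>J. conv (conv (c (fst p) k) (d (snd p) l)) (conv (Sd (d l (snd r))) (Sd (c k (fst r))))) =
          (\<Sum>l\<in>J. conv (c (fst p) k) (conv (conv (d (snd p) l) (Sd (d l (snd r)))) (Sd (c k (fst r)))))"
          using m k by (intro sum.cong refl) (simp add: conv_assoc conv_Hd Sd_Hd rc rd)
        also have "\<dots> = conv (c (fst p) k) (conv (\<Sum>l\<in>J. conv (d (snd p) l) (Sd (d l (snd r)))) (Sd (c k (fst r))))"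
          by (simp add: conv_sum_left conv_sum_right)
        also have "\<dots> = (if snd p = snd r then conv (c (fst p) k) (Sd (c k (fst r))) else 0)"
          using m k unfolding rep_inverse_right[OF d m(2,4)]
          by (simp add: conv_eps_left Sd_Hd rc zero_fun_def conv_zero_left conv_zero_right)
        finally show ?thesis .
      qed
      have "(\<Sum>q\<in>I \<times> J. conv (?C p q) (?R q r)) =
        (\<Sum>k\<in>I. \<Sum>l\<in>J. conv (conv (c (fst p) k) (d (snd p) l)) (conv (Sd (d l (snd r))) (Sd (c k (fst r)))))"
        by (simp add: sum.cartesian_product split_beta)
      also have "\<dots> = (\<Sum>k\<in>I. if snd p = snd r then conv (c (fst p) k) (Sd (c k (fst r))) else 0)"
        using step by simp
      also have "\<dots> = (if p = r then eps else 0)"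
        using rep_inverse_right[OF c m(1,3)] by (cases "snd p = snd r") (auto simp: prod_eq_iff)
      finally show ?thesis .
    qed
    show "conv eps (?R p q) = ?R p q" if "p \<in> I \<times> J" "q \<in> I \<times> J" for p q
      by (rule conv_eps_left; intro Sd_Hd conv_Hd rc rd) (use that in auto)
    show "conv (Sd (?C p q)) eps = Sd (?C p q)" if "p \<in> I \<times> J" "q \<in> I \<times> J" for p q
      by (rule conv_eps_right; intro Sd_Hd conv_Hd rc rd) (use that in auto)
  qed (use m in \<open>simp_all add: conv_sum_left conv_sum_right\<close>)
  then show ?thesis by simp
qed

end

section \<open>Spaces of functions\<close>

lemma vector_space_fun: "vector_space (\<lambda>(c::'k::field) f (x::'a). c * f x)"
  by unfold_locales (auto simp: fun_eq_iff algebra_simps)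

text \<open>Spans and subspaces of the space of all functions with the pointwise operations; all functionals on
  \<open>H\<close> are treated as elements of this one space.\<close>

interpretation funs: vector_space "\<lambda>(c::'k::field) f (x::'a). c * f x"
  by (rule vector_space_fun)

lemma is_vs_dual:
  assumes "is_vs V"
  shows "is_vs (dual_vs V)"
proof -
  have s: "funs.subspace (car (dual_vs V))"
    using vs_add[OF assms] vs_scale[OF assms]
    by (intro funs.subspaceI) (auto simp: dual_vs_def lin_def algebra_simps)
  show ?thesis using s vector_space_fun by (simp add: is_vs_def dual_vs_def)
qed

lemma coord_basis_dual:
  assumes V: "is_vs V" and c: "coord_basis V I e \<phi>"
  shows "coord_basis (dual_vs V) I (\<lambda>i x. if x \<in> car V then \<phi> i x else 0) (\<lambda>i f. f (e i))"
proof -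
  have m: "(\<lambda>x. if x \<in> car V then \<phi> i x else 0) \<in> car (dual_vs V)" if "i \<in> I" for i
    using coord_lin[OF c that] vs_add[OF V] vs_scale[OF V] by (simp add: dual_vs_def lin_def)
  have ex: "f = (\<Sum>i\<in>I. scl (dual_vs V) (f (e i)) (\<lambda>x. if x \<in> car V then \<phi> i x else 0))"
    if f: "f \<in> car (dual_vs V)" for f
  proof
    fix x
    show "f x = (\<Sum>i\<in>I. scl (dual_vs V) (f (e i)) (\<lambda>x. if x \<in> car V then \<phi> i x else 0)) x"
    proof (cases "x \<in> car V")
      case True
      have "lin V ground f" using f by (simp add: dual_vs_def)
      from coord_lin_expand[OF V is_vs_ground c this True]
      have "f x = (\<Sum>i\<in>I. \<phi> i x * f (e i))" by simp
      then show ?thesis using True by (simp add: sum_fun_apply dual_vs_def mult.commute)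
    qed (use f in \<open>simp add: sum_fun_apply dual_vs_def\<close>)
  qed
  show ?thesis
    unfolding coord_basis_def
    using coord_finite[OF c] m ex coord_delta[OF c] coord_mem[OF c]
    by (auto simp: lin_def dual_vs_def[of V])
qed

text \<open>The model of \<open>n\<close>-dimensional space inside the type in which words are formed.\<close>

definition fin_space :: "nat \<Rightarrow> ('k::field, nat \<Rightarrow> 'k) vspace" where
  "fin_space n = \<lparr>car = {v. \<forall>i\<ge>n. v i = 0}, scl = (\<lambda>c v i. c * v i)\<rparr>"

lemma is_vs_fin_space: "is_vs (fin_space n :: ('k::field, nat \<Rightarrow> 'k) vspace)"
proof -
  have "funs.subspace {v :: nat \<Rightarrow> 'k. \<forall>i\<ge>n. v i = 0}" by (rule funs.subspaceI) auto
  then show ?thesis using vector_space_fun by (simp add: is_vs_def fin_space_def)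
qed

lemma coord_basis_fin_space:
  "coord_basis (fin_space n :: ('k::field, nat \<Rightarrow> 'k) vspace) {..<n} (\<lambda>i j. if j = i then 1 else 0) (\<lambda>i v. v i)"
  unfolding coord_basis_def
  by (auto simp: fin_space_def lin_def sum_fun_apply fun_eq_iff if_distrib sum.delta cong: if_cong)

section \<open>Coefficients of modules\<close>

context hopf_alg
begin

lemma
  assumes "X \<in> mod_obj H"
  shows mod_fin_dim: "fin_dim_vs X" and mod_vs: "is_vs X"
    and mod_unt: "x \<in> car X \<Longrightarrow> act X (unt H) x = x"
    and mod_mul: "a \<in> car H \<Longrightarrow> b \<in> car H \<Longrightarrow> x \<in> car X \<Longrightarrow> act X (mul H a b) x = act X a (act X b x)"
    and mod_outside: "a \<notin> car H \<or> x \<notin> car X \<Longrightarrow> act X a x = 0"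
    and mod_act_mem: "a \<in> car H \<Longrightarrow> x \<in> car X \<Longrightarrow> act X a x \<in> car X"
    and mod_act_lin: "a \<in> car H \<Longrightarrow> lin X X (act X a)"
    and mod_act_lin_left: "x \<in> car X \<Longrightarrow> lin H X (\<lambda>a. act X a x)"
proof -
  have *: "fin_dim_vs X" "bilin H X X (act X)"
     "\<forall>x\<in>car X. act X (unt H) x = x"
     "\<forall>a\<in>car H. \<forall>b\<in>car H. \<forall>x\<in>car X. act X (mul H a b) x = act X a (act X b x)"
     "\<forall>a x. a \<notin> car H \<or> x \<notin> car X \<longrightarrow> act X a x = 0"
    using assms unfolding mod_obj_def by blast+
  show "fin_dim_vs X" "is_vs X" using * by (simp_all add: fin_dim_vs_def)
  show "x \<in> car X \<Longrightarrow> act X (unt H) x = x"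
    "a \<in> car H \<Longrightarrow> b \<in> car H \<Longrightarrow> x \<in> car X \<Longrightarrow> act X (mul H a b) x = act X a (act X b x)"
    "a \<notin> car H \<or> x \<notin> car X \<Longrightarrow> act X a x = 0" using * by auto
  show "a \<in> car H \<Longrightarrow> x \<in> car X \<Longrightarrow> act X a x \<in> car X" "a \<in> car H \<Longrightarrow> lin X X (act X a)"
    "x \<in> car X \<Longrightarrow> lin H X (\<lambda>a. act X a x)"
    using bilin_mem[OF *(2)] bilin_right[OF *(2)] bilin_left[OF *(2)] by auto
qed

lemma mod_basis:
  assumes "X \<in> mod_obj H"
  obtains n e \<phi> where "coord_basis X {..<n::nat} e \<phi>"
  using fin_dim_coord_basis[OF mod_fin_dim[OF assms]] .

text \<open>The coefficient \<open>h \<mapsto> \<psi> (h x)\<close>, extended by zero so that it belongs to the dual of \<open>H\<close>.\<close>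

definition mcoef :: "('k, 'h, 'v::ab_group_add) lmod \<Rightarrow> ('v \<Rightarrow> 'k) \<Rightarrow> 'v \<Rightarrow> 'h \<Rightarrow> 'k" where
  "mcoef X \<psi> x = (\<lambda>h. if h \<in> car H then \<psi> (act X h x) else 0)"

definition coefs :: "('k, 'h, 'v::ab_group_add) lmod \<Rightarrow> ('h \<Rightarrow> 'k) set" where
  "coefs X = {mcoef X \<psi> x | \<psi> x. lin X ground \<psi> \<and> x \<in> car X}"

lemma mcoef_coefs: "lin X ground \<psi> \<Longrightarrow> x \<in> car X \<Longrightarrow> mcoef X \<psi> x \<in> coefs X"
  by (auto simp: coefs_def)

lemma mcoef_Hd: "X \<in> mod_obj H \<Longrightarrow> lin X ground \<psi> \<Longrightarrow> x \<in> car X \<Longrightarrow> mcoef X \<psi> x \<in> Hd"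
  unfolding mcoef_def by (rule restrict_Hd[OF lin_comp[OF mod_act_lin_left]])

lemma coefs_Hd: "X \<in> mod_obj H \<Longrightarrow> coefs X \<subseteq> Hd"
  by (auto simp: coefs_def mcoef_Hd)

lemma act_expand:
  assumes X: "X \<in> mod_obj H" and c: "coord_basis X I e \<phi>" and h: "h \<in> car H" and x: "x \<in> car X"
  shows "act X h x = (\<Sum>i\<in>I. scl X (mcoef X (\<phi> i) x h) (e i))"
proof -
  have "act X h x = (\<Sum>i\<in>I. scl X (\<phi> i (act X h x)) (e i))"
    by (rule coord_expand[OF c mod_act_mem[OF X h x]])
  then show ?thesis using h by (simp add: mcoef_def)
qed

text \<open>Insert the expansion of \<open>b x\<close> in a basis.  Read as a statement about functionals, this is the
  coproduct of a coefficient.\<close>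

lemma mcoef_mul:
  assumes X: "X \<in> mod_obj H" and c: "coord_basis X I e \<phi>" and p: "lin X ground \<psi>" and x: "x \<in> car X"
    and ab: "a \<in> car H" "b \<in> car H"
  shows "mcoef X \<psi> x (mul H a b) = (\<Sum>k\<in>I. mcoef X \<psi> (e k) a * mcoef X (\<phi> k) x b)"
proof -
  have "\<psi> (act X a (act X b x)) = (\<Sum>k\<in>I. \<phi> k (act X b x) * \<psi> (act X a (e k)))"
    using coord_lin_expand[OF mod_vs[OF X] is_vs_ground c lin_comp[OF mod_act_lin[OF X ab(1)] p]
        mod_act_mem[OF X ab(2) x]] by simp
  then show ?thesis
    using ab x by (simp add: mcoef_def mul_mem mod_mul[OF X] mult.commute)
qed

lemma mod_rep_mat:
  assumes X: "X \<in> mod_obj H" and c: "coord_basis X I e \<phi>"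
  shows "rep_mat I (\<lambda>i j. mcoef X (\<phi> i) (e j))"
  unfolding rep_mat_def
proof (intro conjI ballI)
  show "finite I" by (rule coord_finite[OF c])
  fix i j assume ij: "i \<in> I" "j \<in> I"
  show "mcoef X (\<phi> i) (e j) \<in> Hd" by (rule mcoef_Hd[OF X coord_lin[OF c ij(1)] coord_mem[OF c ij(2)]])
  show "mcoef X (\<phi> i) (e j) (unt H) = (if i = j then 1 else 0)"
    using ij unt_mem coord_delta[OF c] mod_unt[OF X] coord_mem[OF c] by (simp add: mcoef_def)
  fix a b assume "a \<in> car H" "b \<in> car H"
  then show "mcoef X (\<phi> i) (e j) (mul H a b) = (\<Sum>k\<in>I. mcoef X (\<phi> i) (e k) a * mcoef X (\<phi> k) (e j) b)"
    by (rule mcoef_mul[OF X c coord_lin[OF c ij(1)] coord_mem[OF c ij(2)]])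
qed

text \<open>The entries of one coefficient matrix span all coefficients.\<close>

lemma coefs_basis_subset:
  assumes X: "X \<in> mod_obj H" and c: "coord_basis X I e \<phi>" and A: "funs.subspace A"
    and m: "\<And>i j. i \<in> I \<Longrightarrow> j \<in> I \<Longrightarrow> mcoef X (\<phi> i) (e j) \<in> A"
  shows "coefs X \<subseteq> A"
proof
  fix f assume "f \<in> coefs X"
  then obtain \<psi> x where f: "f = mcoef X \<psi> x" "lin X ground \<psi>" "x \<in> car X" by (auto simp: coefs_def)
  have "f = (\<Sum>j\<in>I. \<Sum>i\<in>I. (\<lambda>h. (\<phi> j x * \<psi> (e i)) * mcoef X (\<phi> i) (e j) h))"
  proof
    fix h show "f h = (\<Sum>j\<in>I. \<Sum>i\<in>I. (\<lambda>h. (\<phi> j x * \<psi> (e i)) * mcoef X (\<phi> i) (e j) h)) h"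
    proof (cases "h \<in> car H")
      case True
      have "\<psi> (act X h x) = (\<Sum>j\<in>I. \<phi> j x * \<psi> (act X h (e j)))"
        using coord_lin_expand[OF mod_vs[OF X] is_vs_ground c lin_comp[OF mod_act_lin[OF X True] f(2)] f(3)]
        by simp
      also have "\<dots> = (\<Sum>j\<in>I. \<phi> j x * (\<Sum>i\<in>I. \<phi> i (act X h (e j)) * \<psi> (e i)))"
        using coord_lin_expand[OF mod_vs[OF X] is_vs_ground c f(2) mod_act_mem[OF X True coord_mem[OF c]]]
        by simp
      also have "\<dots> = (\<Sum>j\<in>I. \<Sum>i\<in>I. (\<phi> j x * \<psi> (e i)) * mcoef X (\<phi> i) (e j) h)"
        unfolding sum_distrib_left by (intro sum.cong refl) (simp add: mcoef_def True)
      finally have "\<psi> (act X h x) = \<dots>" .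
      moreover have "f h = \<psi> (act X h x)" unfolding f(1) mcoef_def by (rule if_P[OF True])
      ultimately show ?thesis unfolding sum_fun_apply by (rule trans[rotated])
    qed (simp add: f(1) mcoef_def sum_fun_apply)
  qed
  also have "\<dots> \<in> A"
    using m by (intro funs.subspace_sum[OF A] funs.subspace_scale[OF A])
  finally show "f \<in> A" .
qed

text \<open>To recognise a module it is enough to know the action on a basis, where the module axioms are the
  properties of a representation matrix.\<close>

lemma mod_objI:
  assumes V: "is_vs X" and c: "coord_basis X I e \<phi>" and r: "rep_mat I m"
    and lin: "\<And>h. h \<in> car H \<Longrightarrow> lin X X (act X h)"
    and act: "\<And>h j. h \<in> car H \<Longrightarrow> j \<in> I \<Longrightarrow> act X h (e j) = (\<Sum>i\<in>I. scl X (m i j h) (e i))"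
    and out: "\<And>a x. a \<notin> car H \<or> x \<notin> car X \<Longrightarrow> act X a x = 0"
  shows "X \<in> mod_obj H"
proof -
  interpret X: vector_space "scl X" using V by (simp add: is_vs_def)
  have expand: "act X h x = (\<Sum>j\<in>I. scl X (\<phi> j x) (act X h (e j)))" if "h \<in> car H" "x \<in> car X" for h x
    by (rule coord_lin_expand[OF V V c lin]) (use that in auto)
  have bas: "lin H X (\<lambda>h. act X h (e j))" if "j \<in> I" for j
  proof -
    have "lin H X (\<lambda>h. \<Sum>i\<in>I. scl X (m i j h) (e i))"
      using that by (intro lin_sum_fun[OF V] lin_ground_scl[OF V coord_mem[OF c]] rep_lin[OF r])
    then show ?thesis using that act vs_add[OF vs_H] vs_scale[OF vs_H] by (simp add: lin_def)
  qed
  have lin2: "lin H X (\<lambda>h. act X h x)" if "x \<in> car X" for x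
  proof -
    have "lin H X (\<lambda>h. \<Sum>j\<in>I. scl X (\<phi> j x) (act X h (e j)))"
      by (intro lin_sum_fun[OF V] lin_scale_fun[OF V] bas)
    then show ?thesis using that expand vs_add[OF vs_H] vs_scale[OF vs_H] by (simp add: lin_def)
  qed
  have ue: "act X (unt H) (e j) = e j" if "j \<in> I" for j
    using that unt_mem coord_finite[OF c]
    by (simp add: act rep_unt[OF r] if_distrib[where f="\<lambda>z. scl X z _"] sum.delta cong: if_cong)
  have u: "act X (unt H) x = x" if "x \<in> car X" for x
    using lin_eq_on_basis[OF V V c lin[OF unt_mem] lin_id[of X X] ue that] by simp
  have me: "act X (mul H a b) (e j) = act X a (act X b (e j))" if "a \<in> car H" "b \<in> car H" "j \<in> I" for a b j
  proof -
    have "act X a (act X b (e j)) = (\<Sum>i\<in>I. act X a (scl X (m i j b) (e i)))"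
      using that by (simp add: act[of b]) (intro lin_setsum[OF V V lin] vs_scale[OF V] coord_mem[OF c])
    also have "\<dots> = (\<Sum>i\<in>I. scl X (m i j b) (act X a (e i)))"
      using that lin_scale[OF lin[OF that(1)]] coord_mem[OF c] by (intro sum.cong) auto
    also have "\<dots> = (\<Sum>i\<in>I. \<Sum>k\<in>I. scl X (m k i a * m i j b) (e k))"
      using that act by (simp add: X.scale_sum_right mult.commute)
    also have "\<dots> = (\<Sum>k\<in>I. scl X (\<Sum>i\<in>I. m k i a * m i j b) (e k))"
      by (subst sum.swap) (simp add: X.scale_sum_left)
    also have "\<dots> = act X (mul H a b) (e j)"
      using that by (simp add: act mul_mem rep_mul[OF r])
    finally show ?thesis by simp
  qed
  have mm: "act X (mul H a b) x = act X a (act X b x)" if "a \<in> car H" "b \<in> car H" "x \<in> car X" for a b x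
    by (rule lin_eq_on_basis[OF V V c lin[OF mul_mem[OF that(1,2)]] lin_comp[OF lin lin] me]) (use that in auto)
  show ?thesis
    unfolding mod_obj_def using coord_basis_fin_dim[OF V c] u mm out bilinI[of H X X "act X"] lin lin2 by blast
qed

lemma mod_homD:
  assumes "f \<in> mod_hom H X Y"
  shows hom_lin: "lin X Y f" and hom_act: "a \<in> car H \<Longrightarrow> x \<in> car X \<Longrightarrow> f (act X a x) = act Y a (f x)"
  using assms by (auto simp: mod_hom_def)

text \<open>Quotients and submodules have no new coefficients.\<close>

lemma coefs_surj:
  assumes X: "X \<in> mod_obj H" and f: "f \<in> mod_hom H X Y" and surj: "car Y \<subseteq> f ` car X"
  shows "coefs Y \<subseteq> coefs X"
proof
  fix g assume "g \<in> coefs Y"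
  then obtain \<psi> y where g: "g = mcoef Y \<psi> y" "lin Y ground \<psi>" "y \<in> car Y" by (auto simp: coefs_def)
  then obtain x where x: "x \<in> car X" "y = f x" using surj by blast
  have "g = mcoef X (\<lambda>x. \<psi> (f x)) x"
    using hom_act[OF f _ x(1)] by (auto simp: g(1) x(2) mcoef_def)
  then show "g \<in> coefs X" using mcoef_coefs[OF lin_comp[OF hom_lin[OF f] g(2)] x(1)] by simp
qed

lemma coefs_inj:
  assumes X: "X \<in> mod_obj H" and Y: "is_vs Y" and f: "f \<in> mod_hom H X Y" and inj: "inj_on f (car X)"
  shows "coefs X \<subseteq> coefs Y"
proof
  obtain n e \<phi> where c: "coord_basis X {..<n::nat} e \<phi>" using mod_basis[OF X] .
  fix g assume "g \<in> coefs X"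
  then obtain \<psi> x where g: "g = mcoef X \<psi> x" "lin X ground \<psi>" "x \<in> car X" by (auto simp: coefs_def)
  obtain \<chi> where chi: "lin Y ground \<chi>" "\<And>y. y \<in> car X \<Longrightarrow> \<chi> (f y) = \<psi> y"
    using lin_extend_inj[OF mod_vs[OF X] Y c hom_lin[OF f] inj g(2)] by blast
  have "g = mcoef Y \<chi> (f x)"
    by (rule ext) (simp add: g(1) mcoef_def hom_act[OF f _ g(3), symmetric] chi(2) mod_act_mem[OF X _ g(3)])
  then show "g \<in> coefs Y" using mcoef_coefs[OF chi(1)] lin_mem[OF hom_lin[OF f] g(3)] by simp
qed

lemma coefs_iso:
  assumes "X \<in> mod_obj H" "is_vs Y" "mod_iso H X Y"
  shows "coefs X = coefs Y"
proof -
  obtain f where f: "f \<in> mod_hom H X Y" "bij_betw f (car X) (car Y)" using assms(3) by (auto simp: mod_iso_def)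
  have "coefs X \<subseteq> coefs Y" by (rule coefs_inj[OF assms(1,2) f(1)]) (use f(2) in \<open>simp add: bij_betw_def\<close>)
  moreover have "coefs Y \<subseteq> coefs X" by (rule coefs_surj[OF assms(1) f(1)]) (use f(2) in \<open>simp add: bij_betw_def\<close>)
  ultimately show ?thesis by blast
qed

lemma coefs_subquotient:
  fixes L :: "('k, 'h, 'w::ab_group_add) lmod"
  assumes L: "L \<in> mod_obj H" and s: "subquotient H X L"
  shows "coefs X \<subseteq> coefs L"
proof -
  obtain A :: "('k, 'h, 'w) lmod" and i q where A: "A \<in> mod_obj H" "i \<in> mod_hom H A L" "inj_on i (car A)" "q \<in> mod_hom H A X"
    "q ` car A = car X" using s unfolding subquotient_def by blast
  have "coefs X \<subseteq> coefs A" by (rule coefs_surj[OF A(1,4)]) (simp add: A(5))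
  also have "\<dots> \<subseteq> coefs L" by (rule coefs_inj[OF A(1) mod_vs[OF L] A(2,3)])
  finally show ?thesis .
qed

section \<open>Tensor products, duals and direct sums of modules\<close>

text \<open>On a fixed tensor the action is bilinear in the two factors of the coproduct, so the chosen
  decomposition of the coproduct computes it.\<close>

lemma tensor_act:
  assumes X: "X \<in> mod_obj H" and Y: "Y \<in> mod_obj H" and h: "h \<in> car H" and t: "t \<in> car (tensor_vs X Y)"
  shows "act (mod_tensor H X Y) h t = swsum (\<lambda>a b. tmap X Y X Y (act X a) (act Y b) t) h"
proof -
  obtain r :: nat and x y where d: "\<And>i. i < r \<Longrightarrow> x i \<in> car X" "\<And>i. i < r \<Longrightarrow> y i \<in> car Y"
    "t = (\<Sum>i<r. tens X Y (x i) (y i))" using tensor_decomp[OF mod_vs[OF X] t] by blast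
  have e: "tmap X Y X Y (act X a) (act Y b) t = (\<Sum>i<r. tens X Y (act X a (x i)) (act Y b (y i)))"
    if "a \<in> car H" "b \<in> car H" for a b
    unfolding d(3) using d that
    by (intro tmap_sum mod_vs[OF X] mod_vs[OF Y] mod_act_lin[OF X] mod_act_lin[OF Y]) auto
  have b0: "bilin H H (tensor_vs X Y) (\<lambda>a b. \<Sum>i<r. tens X Y (act X a (x i)) (act Y b (y i)))"
  proof (rule bilinI; rule lin_sum_fun[OF is_vs_tensor_vs])
    fix a i assume "a \<in> car H" "i \<in> {..<r}"
    then show "lin H (tensor_vs X Y) (\<lambda>b. tens X Y (act X a (x i)) (act Y b (y i)))"
      using d by (intro lin_comp[OF mod_act_lin_left[OF Y] bilin_right[OF bilin_tens]] mod_act_mem[OF X]) auto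
  next
    fix b i assume "b \<in> car H" "i \<in> {..<r}"
    then show "lin H (tensor_vs X Y) (\<lambda>a. tens X Y (act X a (x i)) (act Y b (y i)))"
      using d by (intro lin_comp[OF mod_act_lin_left[OF X] bilin_left[OF bilin_tens]] mod_act_mem[OF Y]) auto
  qed
  have "bilin H H (tensor_vs X Y) (\<lambda>a b. tmap X Y X Y (act X a) (act Y b) t)"
    using b0 e vs_add[OF vs_H] vs_scale[OF vs_H] by (simp add: bilin_def lin_def)
  from tlift_comul[OF is_vs_tensor_vs this h] show ?thesis using h t by (simp add: mod_tensor_def)
qed

lemma tensor_act_tens:
  assumes X: "X \<in> mod_obj H" and Y: "Y \<in> mod_obj H" and h: "h \<in> car H" and xy: "x \<in> car X" "y \<in> car Y"
  shows "act (mod_tensor H X Y) h (tens X Y x y) = swsum (\<lambda>a b. tens X Y (act X a x) (act Y b y)) h"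
  unfolding tensor_act[OF X Y h tens_mem[OF xy]] tmap_def
proof (rule swsum_cong[OF h])
  fix a b assume ab: "a \<in> car H" "b \<in> car H"
  show "tlift X Y (\<lambda>v w. tens X Y (act X a v) (act Y b w)) (tens X Y x y) = tens X Y (act X a x) (act Y b y)"
    by (rule tensor_universal(2)[OF mod_vs[OF X] mod_vs[OF Y] is_vs_tensor_vs[of X Y]
          bilin_comp[OF bilin_tens mod_act_lin[OF X ab(1)] mod_act_lin[OF Y ab(2)]] xy])
qed

lemma mod_tensor_car [simp]: "car (mod_tensor H X Y) = car (tensor_vs X Y)"
  "scl (mod_tensor H X Y) = tensor_scl"
  by (simp_all add: mod_tensor_def)

lemma mod_tensor_lin:
  assumes X: "X \<in> mod_obj H" and Y: "Y \<in> mod_obj H" and h: "h \<in> car H"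
  shows "lin (tensor_vs X Y) (tensor_vs X Y) (act (mod_tensor H X Y) h)"
proof -
  have "lin (tensor_vs X Y) (tensor_vs X Y) (\<lambda>t. swsum (\<lambda>a b. tmap X Y X Y (act X a) (act Y b) t) h)"
    by (intro lin_swsum_param[OF is_vs_tensor_vs h] lin_tmap mod_vs[OF X] mod_vs[OF Y]
        mod_act_lin[OF X] mod_act_lin[OF Y])
  then show ?thesis
    using tensor_act[OF X Y h] vs_add[OF is_vs_tensor_vs[of X Y]] vs_scale[OF is_vs_tensor_vs[of X Y]]
    by (simp add: lin_def)
qed

lemma coord_basis_mod_tensor:
  assumes X: "X \<in> mod_obj H" and Y: "Y \<in> mod_obj H"
    and c: "coord_basis X I e \<phi>" and d: "coord_basis Y J f \<psi>"
  shows "coord_basis (mod_tensor H X Y) (I \<times> J) (\<lambda>(i,j). tens X Y (e i) (f j))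
    (\<lambda>(i,j). tlift X Y (\<lambda>x y. \<phi> i x * \<psi> j y))"
  using coord_basis_tensor[OF mod_vs[OF X] mod_vs[OF Y] c d]
  by (simp add: coord_basis_cong[of "mod_tensor H X Y" "tensor_vs X Y"])

lemma mod_tensor_obj:
  assumes X: "X \<in> mod_obj H" and Y: "Y \<in> mod_obj H"
  shows "mod_tensor H X Y \<in> mod_obj H"
proof -
  obtain n e \<phi> where c: "coord_basis X {..<n::nat} e \<phi>" using mod_basis[OF X] .
  obtain m f \<psi> where d: "coord_basis Y {..<m::nat} f \<psi>" using mod_basis[OF Y] .
  note r = rep_mat_conv[OF mod_rep_mat[OF X c] mod_rep_mat[OF Y d]]
  note tv = is_vs_cong[of "mod_tensor H X Y" "tensor_vs X Y"]
    lin_cong[of "mod_tensor H X Y" "tensor_vs X Y" "mod_tensor H X Y" "tensor_vs X Y"]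
  show ?thesis
  proof (rule mod_objI[OF _ coord_basis_mod_tensor[OF X Y c d] r])
    show "is_vs (mod_tensor H X Y)" using is_vs_tensor_vs[of X Y] by (simp add: tv)
    fix h assume h: "h \<in> car H"
    show "lin (mod_tensor H X Y) (mod_tensor H X Y) (act (mod_tensor H X Y) h)"
      using mod_tensor_lin[OF X Y h] by (simp add: tv)
    fix q assume q: "q \<in> {..<n} \<times> {..<m}"
    then have m: "e (fst q) \<in> car X" "f (snd q) \<in> car Y" using coord_mem[OF c] coord_mem[OF d] by auto
    have "act (mod_tensor H X Y) h (tens X Y (e (fst q)) (f (snd q))) =
      swsum (\<lambda>a b. tens X Y (act X a (e (fst q))) (act Y b (f (snd q)))) h"
      by (rule tensor_act_tens[OF X Y h m])
    also have "\<dots> = swsum (\<lambda>a b. \<Sum>p\<in>{..<n} \<times> {..<m}. tensor_scl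
        (mcoef X (\<phi> (fst p)) (e (fst q)) a * mcoef Y (\<psi> (snd p)) (f (snd q)) b) (tens X Y (e (fst p)) (f (snd p)))) h"
      using tens_expand[OF mod_vs[OF X] mod_vs[OF Y] c d mod_act_mem[OF X _ m(1)] mod_act_mem[OF Y _ m(2)]]
      by (intro swsum_cong[OF h]) (simp add: mcoef_def)
    also have "\<dots> = (\<Sum>p\<in>{..<n} \<times> {..<m}. tensor_scl (conv (mcoef X (\<phi> (fst p)) (e (fst q)))
        (mcoef Y (\<psi> (snd p)) (f (snd q))) h) (tens X Y (e (fst p)) (f (snd p))))"
      using h by (simp add: swsum_sum conv_def) (simp add: swsum_def fun_eq_iff tensor_scl_def sum_fun_apply sum_distrib_right)
    finally show "act (mod_tensor H X Y) h (case q of (i, j) \<Rightarrow> tens X Y (e i) (f j)) =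
      (\<Sum>p\<in>{..<n} \<times> {..<m}. scl (mod_tensor H X Y) (conv (mcoef X (\<phi> (fst p)) (e (fst q)))
        (mcoef Y (\<psi> (snd p)) (f (snd q))) h) (case p of (i, j) \<Rightarrow> tens X Y (e i) (f j)))"
      by (simp add: split_beta)
  next
    fix a x assume "a \<notin> car H \<or> x \<notin> car (mod_tensor H X Y)"
    then show "act (mod_tensor H X Y) a x = 0" by (auto simp: mod_tensor_def)
  qed
qed

text \<open>Coefficients of a tensor product are products of coefficients.\<close>

lemma conv_mcoef:
  assumes X: "X \<in> mod_obj H" and Y: "Y \<in> mod_obj H" and p: "lin X ground \<phi>" "lin Y ground \<psi>"
    and xy: "x \<in> car X" "y \<in> car Y"
  shows "conv (mcoef X \<phi> x) (mcoef Y \<psi> y) =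
    mcoef (mod_tensor H X Y) (tlift X Y (\<lambda>x y. \<phi> x * \<psi> y)) (tens X Y x y)"
proof
  fix h
  note tl = tensor_universal[OF mod_vs[OF X] mod_vs[OF Y] is_vs_ground bilin_mult[OF p]]
  show "conv (mcoef X \<phi> x) (mcoef Y \<psi> y) h =
    mcoef (mod_tensor H X Y) (tlift X Y (\<lambda>x y. \<phi> x * \<psi> y)) (tens X Y x y) h"
  proof (cases "h \<in> car H")
    case True
    have "bilin H H (tensor_vs X Y) (\<lambda>a b. tens X Y (act X a x) (act Y b y))"
      by (intro bilin_comp[OF bilin_tens] mod_act_lin_left[OF X] mod_act_lin_left[OF Y] xy)
    from lin_swsum_fun[OF is_vs_tensor_vs is_vs_ground this tl(1) True]
    have "tlift X Y (\<lambda>x y. \<phi> x * \<psi> y) (act (mod_tensor H X Y) h (tens X Y x y)) =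
      swsum (\<lambda>a b. tlift X Y (\<lambda>x y. \<phi> x * \<psi> y) (tens X Y (act X a x) (act Y b y))) h"
      by (simp add: tensor_act_tens[OF X Y True xy])
    also have "\<dots> = swsum (\<lambda>a b. mcoef X \<phi> x a * mcoef Y \<psi> y b) h"
      using tl(2) xy by (intro swsum_cong[OF True]) (simp add: mcoef_def mod_act_mem[OF X] mod_act_mem[OF Y])
    finally show ?thesis using True by (simp add: mcoef_def[of "mod_tensor H X Y"] conv_def)
  qed (simp add: conv_def mcoef_def)
qed

lemma conv_coefs_tensor:
  assumes X: "X \<in> mod_obj H" and Y: "Y \<in> mod_obj H" and f: "f \<in> coefs X" and g: "g \<in> coefs Y"
  shows "conv f g \<in> coefs (mod_tensor H X Y)"
proof -
  obtain \<phi> x where f: "f = mcoef X \<phi> x" "lin X ground \<phi>" "x \<in> car X" using f by (auto simp: coefs_def)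
  obtain \<psi> y where g: "g = mcoef Y \<psi> y" "lin Y ground \<psi>" "y \<in> car Y" using g by (auto simp: coefs_def)
  have "lin (mod_tensor H X Y) ground (tlift X Y (\<lambda>x y. \<phi> x * \<psi> y))"
    using tensor_universal(1)[OF mod_vs[OF X] mod_vs[OF Y] is_vs_ground bilin_mult[OF f(2) g(2)]]
    by (simp add: lin_cong[of "mod_tensor H X Y" "tensor_vs X Y" ground ground])
  moreover have "tens X Y x y \<in> car (mod_tensor H X Y)" using tens_mem f(3) g(3) by simp
  ultimately show ?thesis
    unfolding f(1) g(1) conv_mcoef[OF X Y f(2) g(2) f(3) g(3)] by (rule mcoef_coefs)
qed

lemma coefs_tensor_subset:
  assumes X: "X \<in> mod_obj H" and Y: "Y \<in> mod_obj H" and A: "funs.subspace A"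
    and cl: "\<And>f g. f \<in> coefs X \<Longrightarrow> g \<in> coefs Y \<Longrightarrow> conv f g \<in> A"
  shows "coefs (mod_tensor H X Y) \<subseteq> A"
proof -
  obtain n e \<phi> where c: "coord_basis X {..<n::nat} e \<phi>" using mod_basis[OF X] .
  obtain m f \<psi> where d: "coord_basis Y {..<m::nat} f \<psi>" using mod_basis[OF Y] .
  show ?thesis
  proof (rule coefs_basis_subset[OF mod_tensor_obj[OF X Y] coord_basis_mod_tensor[OF X Y c d] A])
    fix p q assume "p \<in> {..<n} \<times> {..<m}" "q \<in> {..<n} \<times> {..<m}"
    then have m: "lin X ground (\<phi> (fst p))" "lin Y ground (\<psi> (snd p))" "e (fst q) \<in> car X" "f (snd q) \<in> car Y"
      using coord_mem[OF c] coord_mem[OF d] coord_lin[OF c] coord_lin[OF d] by auto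
    have "conv (mcoef X (\<phi> (fst p)) (e (fst q))) (mcoef Y (\<psi> (snd p)) (f (snd q))) \<in> A"
      using m by (intro cl mcoef_coefs)
    then show "mcoef (mod_tensor H X Y) (case p of (i, j) \<Rightarrow> tlift X Y (\<lambda>x y. \<phi> i x * \<psi> j y))
      (case q of (i, j) \<Rightarrow> tens X Y (e i) (f j)) \<in> A"
      unfolding conv_mcoef[OF X Y m] by (simp add: split_beta)
  qed
qed

text \<open>Both sides are bilinear in \<open>f\<close> and \<open>g\<close>, so the formula passes from matrix entries to all
  coefficients.\<close>

lemma Sd_conv_coefs:
  assumes X: "X \<in> mod_obj H" and Y: "Y \<in> mod_obj H" and f: "f \<in> coefs X" and g: "g \<in> coefs Y"
  shows "Sd (conv f g) = conv (Sd g) (Sd f)"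
proof -
  obtain n e \<phi> where c: "coord_basis X {..<n::nat} e \<phi>" using mod_basis[OF X] .
  obtain m d \<psi> where d: "coord_basis Y {..<m::nat} d \<psi>" using mod_basis[OF Y] .
  have "coefs Y \<subseteq> {g. Sd (conv (mcoef X (\<phi> i) (e k)) g) = conv (Sd g) (Sd (mcoef X (\<phi> i) (e k)))}"
    if "i < n" "k < n" for i k
    using that Sd_conv[OF mod_rep_mat[OF X c] mod_rep_mat[OF Y d]]
    by (intro coefs_basis_subset[OF Y d] funs.subspaceI)
      (auto simp: conv_add_left conv_add_right conv_scale_left conv_scale_right conv_0 Sd_add Sd_scale Sd_zero)
  then have "coefs X \<subseteq> {f. Sd (conv f g) = conv (Sd g) (Sd f)}"
    using g by (intro coefs_basis_subset[OF X c] funs.subspaceI)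
      (auto simp: conv_add_left conv_add_right conv_scale_left conv_scale_right conv_0 Sd_add Sd_scale Sd_zero)
  then show ?thesis using f by blast
qed

lemma mod_ldual_obj:
  assumes X: "X \<in> mod_obj H"
  shows "mod_ldual H X \<in> mod_obj H"
proof -
  obtain n e \<phi> where c: "coord_basis X {..<n::nat} e \<phi>" using mod_basis[OF X] .
  note V = mod_vs[OF X]
  have cs: "car (mod_ldual H X) = car (dual_vs X)" "scl (mod_ldual H X) = scl (dual_vs X)"
    by (simp_all add: mod_ldual_def)
  have mem: "act (mod_ldual H X) h f \<in> car (dual_vs X)" if "h \<in> car H" "f \<in> car (dual_vs X)" for h f
    using that mod_act_mem[OF X antip_mem] vs_add[OF V] vs_scale[OF V] lin_add[OF mod_act_lin[OF X antip_mem]]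
      lin_scale[OF mod_act_lin[OF X antip_mem]]
    by (simp add: mod_ldual_def dual_vs_def lin_def)
  have add: "f + g \<in> car (dual_vs X)" "scl (dual_vs X) k f \<in> car (dual_vs X)"
    if "f \<in> car (dual_vs X)" "g \<in> car (dual_vs X)" for f g k
    using that vs_add[OF is_vs_dual[OF V]] vs_scale[OF is_vs_dual[OF V]] by auto
  show ?thesis
  proof (rule mod_objI[OF _ _ rep_mat_dual[OF mod_rep_mat[OF X c]]])
    show "is_vs (mod_ldual H X)" using is_vs_dual[OF V] by (simp add: is_vs_cong[OF cs])
    show "coord_basis (mod_ldual H X) {..<n} (\<lambda>i x. if x \<in> car X then \<phi> i x else 0) (\<lambda>i f. f (e i))"
      using coord_basis_dual[OF V c] by (simp add: coord_basis_cong[OF cs])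
    fix h assume h: "h \<in> car H"
    show "lin (mod_ldual H X) (mod_ldual H X) (act (mod_ldual H X) h)"
    proof (rule linI)
      fix f assume "f \<in> car (mod_ldual H X)"
      then show "act (mod_ldual H X) h f \<in> car (mod_ldual H X)" using mem h cs by simp
    next
      fix f g assume "f \<in> car (mod_ldual H X)" "g \<in> car (mod_ldual H X)"
      then show "act (mod_ldual H X) h (f + g) = act (mod_ldual H X) h f + act (mod_ldual H X) h g"
        using add(1)[of f g] cs by (auto simp: mod_ldual_def fun_eq_iff)
    next
      fix k f assume "f \<in> car (mod_ldual H X)"
      then show "act (mod_ldual H X) h (scl (mod_ldual H X) k f) = scl (mod_ldual H X) k (act (mod_ldual H X) h f)"
        using add(2)[of f f] cs by (auto simp: mod_ldual_def fun_eq_iff dual_vs_def)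
    qed
    fix j assume j: "j \<in> {..<n}"
    have ed: "(\<lambda>x. if x \<in> car X then \<phi> i x else 0) \<in> car (dual_vs X)" if "i \<in> {..<n}" for i
      using coord_mem[OF coord_basis_dual[OF V c] that] .
    show "act (mod_ldual H X) h (\<lambda>x. if x \<in> car X then \<phi> j x else 0) =
      (\<Sum>i\<in>{..<n}. scl (mod_ldual H X) (Sd (mcoef X (\<phi> j) (e i)) h) (\<lambda>x. if x \<in> car X then \<phi> i x else 0))"
    proof
      fix x
      show "act (mod_ldual H X) h (\<lambda>x. if x \<in> car X then \<phi> j x else 0) x =
        (\<Sum>i\<in>{..<n}. scl (mod_ldual H X) (Sd (mcoef X (\<phi> j) (e i)) h) (\<lambda>x. if x \<in> car X then \<phi> i x else 0)) x"
      proof (cases "x \<in> car X")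
        case True
        have "\<phi> j (act X (antip H h) x) = (\<Sum>i<n. \<phi> i x * \<phi> j (act X (antip H h) (e i)))"
          using coord_lin_expand[OF V is_vs_ground c lin_comp[OF mod_act_lin[OF X antip_mem[OF h]] coord_lin[OF c j]] True]
          by simp
        then show ?thesis
          using True h ed[OF j] mod_act_mem[OF X antip_mem[OF h] True] antip_mem[OF h]
          by (simp add: mod_ldual_def sum_fun_apply Sd_def mcoef_def dual_vs_def mult.commute)
      next
        case False
        then show ?thesis by (simp add: mod_ldual_def sum_fun_apply dual_vs_def)
      qed
    qed
  next
    fix a x assume "a \<notin> car H \<or> x \<notin> car (mod_ldual H X)"
    then show "act (mod_ldual H X) a x = 0" using cs by (auto simp: mod_ldual_def fun_eq_iff)
  qed
qed

text \<open>The coefficients of the left dual are the images of the coefficients under the antipode.\<close>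

lemma coefs_ldual:
  assumes X: "X \<in> mod_obj H"
  shows Sd_coefs: "f \<in> coefs X \<Longrightarrow> Sd f \<in> coefs (mod_ldual H X)"
    and coefs_ldual_subset: "funs.subspace A \<Longrightarrow> (\<And>f. f \<in> coefs X \<Longrightarrow> Sd f \<in> A) \<Longrightarrow> coefs (mod_ldual H X) \<subseteq> A"
proof -
  note V = mod_vs[OF X]
  have cs: "car (mod_ldual H X) = car (dual_vs X)" "scl (mod_ldual H X) = scl (dual_vs X)"
    by (simp_all add: mod_ldual_def)
  have eq: "Sd (mcoef X \<psi> x) = mcoef (mod_ldual H X) (\<lambda>f. f x) (\<lambda>x. if x \<in> car X then \<psi> x else 0)"
    and mem: "(\<lambda>x. if x \<in> car X then \<psi> x else 0) \<in> car (mod_ldual H X)"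
    if p: "lin X ground \<psi>" and x: "x \<in> car X" for \<psi> x
  proof -
    show m: "(\<lambda>x. if x \<in> car X then \<psi> x else 0) \<in> car (mod_ldual H X)"
      using p vs_add[OF V] vs_scale[OF V] unfolding cs by (simp add: dual_vs_def lin_def)
    show "Sd (mcoef X \<psi> x) = mcoef (mod_ldual H X) (\<lambda>f. f x) (\<lambda>x. if x \<in> car X then \<psi> x else 0)"
      using m x by (auto simp: fun_eq_iff Sd_def mcoef_def mod_ldual_def antip_mem mod_act_mem[OF X])
  qed
  have l: "lin (mod_ldual H X) ground (\<lambda>f. f x)" for x
    unfolding lin_def cs by (simp add: dual_vs_def)
  show "Sd f \<in> coefs (mod_ldual H X)" if fX: "f \<in> coefs X"
  proof -
    obtain \<psi> x where f: "f = mcoef X \<psi> x" "lin X ground \<psi>" "x \<in> car X" using fX by (auto simp: coefs_def)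
    show ?thesis unfolding f(1) eq[OF f(2,3)] by (rule mcoef_coefs[OF l mem[OF f(2,3)]])
  qed
  show "coefs (mod_ldual H X) \<subseteq> A" if A: "funs.subspace A" and s: "\<And>f. f \<in> coefs X \<Longrightarrow> Sd f \<in> A"
  proof -
    obtain n e \<phi> where c: "coord_basis X {..<n::nat} e \<phi>" using mod_basis[OF X] .
    have b: "coord_basis (mod_ldual H X) {..<n} (\<lambda>i x. if x \<in> car X then \<phi> i x else 0) (\<lambda>i f. f (e i))"
      using coord_basis_dual[OF V c] by (simp add: coord_basis_cong[OF cs])
    show ?thesis
    proof (rule coefs_basis_subset[OF mod_ldual_obj[OF X] b A])
      fix i j assume ij: "i \<in> {..<n}" "j \<in> {..<n}"
      show "mcoef (mod_ldual H X) (\<lambda>f. f (e i)) (\<lambda>x. if x \<in> car X then \<phi> j x else 0) \<in> A"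
        using s[OF mcoef_coefs[OF coord_lin[OF c ij(2)] coord_mem[OF c ij(1)]]]
        unfolding eq[OF coord_lin[OF c ij(2)] coord_mem[OF c ij(1)]] .
    qed
  qed
qed

lemma mod_unit_obj: "mod_unit H \<in> mod_obj H"
proof (rule mod_objI[OF _ _ rep_mat_eps])
  show "is_vs (mod_unit H)" using is_vs_ground by (simp add: is_vs_def mod_unit_def)
  show "coord_basis (mod_unit H) {()} (\<lambda>_. 1) (\<lambda>_ x. x)"
    by (auto simp: coord_basis_def mod_unit_def lin_def)
  show "lin (mod_unit H) (mod_unit H) (act (mod_unit H) h)" if "h \<in> car H" for h
    using that by (simp add: mod_unit_def lin_def algebra_simps)
  show "act (mod_unit H) h 1 = (\<Sum>i\<in>{()}. scl (mod_unit H) (eps h) 1)" if "h \<in> car H" for h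
    using that by (simp add: mod_unit_def eps_def)
qed (auto simp: mod_unit_def)

lemma coefs_unit: "coefs (mod_unit H) = {\<lambda>h. c * eps h | c. True}"
proof
  show "{\<lambda>h. c * eps h | c. True} \<subseteq> coefs (mod_unit H)"
  proof safe
    fix c
    have "mcoef (mod_unit H) (\<lambda>x. x) c = (\<lambda>h. c * eps h)"
      by (auto simp: mcoef_def mod_unit_def eps_def)
    moreover have "mcoef (mod_unit H) (\<lambda>x. x) c \<in> coefs (mod_unit H)"
      by (rule mcoef_coefs) (auto simp: mod_unit_def lin_def)
    ultimately show "(\<lambda>h. c * eps h) \<in> coefs (mod_unit H)" by simp
  qed
  show "coefs (mod_unit H) \<subseteq> {\<lambda>h. c * eps h | c. True}"
  proof
    fix f assume "f \<in> coefs (mod_unit H)"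
    then obtain \<psi> x where f: "f = mcoef (mod_unit H) \<psi> x" "lin (mod_unit H) ground \<psi>" by (auto simp: coefs_def)
    have p: "\<psi> c = c * \<psi> 1" for c
    proof -
      have "\<psi> (scl (mod_unit H) c 1) = scl ground c (\<psi> 1)"
        by (rule lin_scale[OF f(2)]) (simp add: mod_unit_def)
      moreover have "scl (mod_unit H) c 1 = c" by (simp add: mod_unit_def)
      ultimately show ?thesis by (simp only: ground_simps)
    qed
    have "f h = (x * \<psi> 1) * eps h" for h
      using p[of "counit H h * x"] by (simp add: f(1) mcoef_def mod_unit_def eps_def)
    then show "f \<in> {\<lambda>h. c * eps h | c. True}" by blast
  qed
qed

lemma mod_sum_obj:
  assumes X: "X \<in> mod_obj H" and Y: "Y \<in> mod_obj H"
  shows "mod_sum X Y \<in> mod_obj H"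
proof -
  obtain n e \<phi> where c: "coord_basis X {..<n::nat} e \<phi>" using mod_basis[OF X] .
  obtain m f \<psi> where d: "coord_basis Y {..<m::nat} f \<psi>" using mod_basis[OF Y] .
  note V = mod_vs[OF X] and W = mod_vs[OF Y]
  have cs: "car (mod_sum X Y) = car \<lparr>car = car X \<times> car Y, scl = (\<lambda>c (x, y). (scl X c x, scl Y c y))\<rparr>"
    "scl (mod_sum X Y) = scl \<lparr>car = car X \<times> car Y, scl = (\<lambda>c (x, y). (scl X c x, scl Y c y))\<rparr>"
    by (simp_all add: mod_sum_def)
  have vs: "is_vs (mod_sum X Y)" using is_vs_prod[OF V W] by (simp only: is_vs_cong[OF cs])
  have fd: "fin_dim_vs (mod_sum X Y)"
    by (rule coord_basis_fin_dim[OF vs, OF iffD2[OF coord_basis_cong[OF cs] coord_basis_prod[OF V W c d]]])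
  have "lin (mod_sum X Y) (mod_sum X Y) (act (mod_sum X Y) h)" if h: "h \<in> car H" for h
    using mod_act_mem[OF X h] mod_act_mem[OF Y h] lin_add[OF mod_act_lin[OF X h]] lin_add[OF mod_act_lin[OF Y h]]
      lin_scale[OF mod_act_lin[OF X h]] lin_scale[OF mod_act_lin[OF Y h]] vs_add[OF V] vs_add[OF W]
      vs_scale[OF V] vs_scale[OF W]
    by (auto simp: lin_def mod_sum_def)
  moreover have "lin H (mod_sum X Y) (\<lambda>h. act (mod_sum X Y) h p)" if p: "p \<in> car (mod_sum X Y)" for p
  proof -
    obtain x y where xy: "p = (x, y)" "x \<in> car X" "y \<in> car Y" using p by (auto simp: mod_sum_def)
    show ?thesis
      using xy(2,3) mod_act_mem[OF X _ xy(2)] mod_act_mem[OF Y _ xy(3)] lin_add[OF mod_act_lin_left[OF X xy(2)]]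
        lin_add[OF mod_act_lin_left[OF Y xy(3)]] lin_scale[OF mod_act_lin_left[OF X xy(2)]]
        lin_scale[OF mod_act_lin_left[OF Y xy(3)]]
      unfolding xy(1) by (simp add: lin_def mod_sum_def)
  qed
  ultimately have "bilin H (mod_sum X Y) (mod_sum X Y) (act (mod_sum X Y))" by (rule bilinI)
  then show ?thesis
    unfolding mod_obj_def using fd mod_unt[OF X] mod_unt[OF Y] mod_mul[OF X] mod_mul[OF Y]
      mod_outside[OF X] mod_outside[OF Y] mod_act_mem[OF X] mod_act_mem[OF Y]
    by (auto simp: mod_sum_def zero_prod_def)
qed

lemma coefs_sum_subset:
  assumes X: "X \<in> mod_obj H" and Y: "Y \<in> mod_obj H" and A: "funs.subspace A"
    and s: "coefs X \<subseteq> A" "coefs Y \<subseteq> A"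
  shows "coefs (mod_sum X Y) \<subseteq> A"
proof
  note V = mod_vs[OF X] and W = mod_vs[OF Y]
  fix f assume "f \<in> coefs (mod_sum X Y)"
  then obtain \<psi> x y where f: "f = mcoef (mod_sum X Y) \<psi> (x, y)" "lin (mod_sum X Y) ground \<psi>"
    "x \<in> car X" "y \<in> car Y" by (auto simp: coefs_def mod_sum_def)
  have add: "\<psi> (u, v) = \<psi> (u, 0) + \<psi> (0, v)" if "u \<in> car X" "v \<in> car Y" for u v
    using lin_add[OF f(2), of "(u, 0)" "(0, v)"] that vs_zero[OF V] vs_zero[OF W] by (simp add: mod_sum_def)
  interpret X: vector_space "scl X" using V by (simp add: is_vs_def)
  interpret Y: vector_space "scl Y" using W by (simp add: is_vs_def)
  have l1: "lin X ground (\<lambda>u. \<psi> (u, 0))"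
    using lin_add[OF f(2), of "(_, 0)" "(_, 0)"] lin_scale[OF f(2), of "(_, 0)"] vs_zero[OF W]
    by (simp add: lin_def mod_sum_def)
  have l2: "lin Y ground (\<lambda>v. \<psi> (0, v))"
    using lin_add[OF f(2), of "(0, _)" "(0, _)"] lin_scale[OF f(2), of "(0, _)"] vs_zero[OF V]
    by (simp add: lin_def mod_sum_def)
  have "f = mcoef X (\<lambda>u. \<psi> (u, 0)) x + mcoef Y (\<lambda>v. \<psi> (0, v)) y"
    using f(3,4) add mod_act_mem[OF X _ f(3)] mod_act_mem[OF Y _ f(4)]
    by (auto simp: f(1) mcoef_def mod_sum_def fun_eq_iff)
  also have "\<dots> \<in> A"
    using s mcoef_coefs[OF l1 f(3)] mcoef_coefs[OF l2 f(4)] by (intro funs.subspace_add[OF A]) auto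
  finally show "f \<in> A" .
qed

text \<open>Coordinates with respect to a basis identify a module with one on column vectors.  Thus every
  dual, tensor product or direct sum that is needed exists within the type in which words are formed.\<close>

lemma mod_realise:
  assumes X: "X \<in> mod_obj H"
  obtains Y :: "('k, 'h, nat \<Rightarrow> 'k) lmod" where "Y \<in> mod_obj H" "mod_iso H X Y"
proof -
  obtain n e \<phi> where c: "coord_basis X {..<n::nat} e \<phi>" using mod_basis[OF X] .
  note V = mod_vs[OF X]
  define m where "m = (\<lambda>i j. mcoef X (\<phi> i) (e j))"
  have r: "rep_mat {..<n} m" unfolding m_def by (rule mod_rep_mat[OF X c])
  define Y :: "('k, 'h, nat \<Rightarrow> 'k) lmod" where "Y = \<lparr>car = car (fin_space n), scl = scl (fin_space n),
    act = (\<lambda>h v i. if h \<in> car H \<and> v \<in> car (fin_space n) \<and> i < n then \<Sum>j<n. m i j h * v j else 0)\<rparr>"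
  have cs: "car Y = car (fin_space n)" "scl Y = scl (fin_space n)" by (simp_all add: Y_def)
  have Yo: "Y \<in> mod_obj H"
  proof (rule mod_objI[OF _ _ r])
    show "is_vs Y" using is_vs_fin_space by (simp only: is_vs_cong[OF cs])
    show "coord_basis Y {..<n} (\<lambda>i j. if j = i then 1 else 0) (\<lambda>i v. v i)"
      using coord_basis_fin_space by (simp only: coord_basis_cong[OF cs])
    show "lin Y Y (act Y h)" if "h \<in> car H" for h
      using that by (auto simp: Y_def lin_def fin_space_def algebra_simps sum.distrib sum_distrib_left fun_eq_iff)
    show "act Y h (\<lambda>k. if k = j then 1 else 0) = (\<Sum>i<n. scl Y (m i j h) (\<lambda>k. if k = i then 1 else 0))"
      if "h \<in> car H" "j \<in> {..<n}" for h j
    proof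
      fix i
      have "(\<Sum>k<n. m i k h * (if k = j then 1 else 0)) = m i j h"
        using that by (simp add: if_distrib sum.delta' cong: if_cong)
      moreover have "(\<Sum>k<n. m k j h * (if i = k then 1 else 0)) = (if i < n then m i j h else 0)"
        by (simp add: if_distrib sum.delta cong: if_cong)
      ultimately show "act Y h (\<lambda>k. if k = j then 1 else 0) i = (\<Sum>i<n. scl Y (m i j h) (\<lambda>k. if k = i then 1 else 0)) i"
        using that by (simp add: Y_def fin_space_def sum_fun_apply)
    qed
  qed (auto simp: Y_def fun_eq_iff)
  define f where "f = (\<lambda>x i. if x \<in> car X \<and> i < n then \<phi> i x else 0)"
  have fl: "lin X Y f"
    using coord_lin[OF c] vs_add[OF V] vs_scale[OF V]
    by (auto simp: f_def lin_def cs fin_space_def fun_eq_iff)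
  have "f \<in> mod_hom H X Y"
    unfolding mod_hom_def
  proof (intro CollectI conjI ballI allI impI)
    show "lin X Y f" by (rule fl)
    show "f x = 0" if "x \<notin> car X" for x using that by (auto simp: f_def)
    fix a x assume ax: "a \<in> car H" "x \<in> car X"
    show "f (act X a x) = act Y a (f x)"
    proof
      fix i
      show "f (act X a x) i = act Y a (f x) i"
      proof (cases "i < n")
        case True
        have "\<phi> i (act X a x) = (\<Sum>j<n. \<phi> j x * \<phi> i (act X a (e j)))"
          using coord_lin_expand[OF V is_vs_ground c lin_comp[OF mod_act_lin[OF X ax(1)] coord_lin[OF c]] ax(2)] True
          by simp
        also have "\<dots> = (\<Sum>j<n. m i j a * f x j)"
          using ax by (intro sum.cong) (simp_all add: m_def mcoef_def f_def)
        finally show ?thesis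
          using True ax mod_act_mem[OF X ax] lin_mem[OF fl ax(2)] by (simp add: f_def[THEN fun_cong, of "act X a x"] Y_def)
      qed (simp add: f_def Y_def)
    qed
  qed
  moreover have "bij_betw f (car X) (car Y)"
  proof (rule bij_betw_byWitness[where f' = "\<lambda>v. \<Sum>i<n. scl X (v i) (e i)"])
    show "\<forall>x\<in>car X. (\<Sum>i<n. scl X (f x i) (e i)) = x"
      using coord_expand[OF c] by (auto simp: f_def)
    show "\<forall>v\<in>car Y. f (\<Sum>i<n. scl X (v i) (e i)) = v"
    proof (intro ballI ext)
      fix v i assume v: "v \<in> car Y"
      have mem: "(\<Sum>i<n. scl X (v i) (e i)) \<in> car X" using coord_mem[OF c] by (intro vs_sum[OF V] vs_scale[OF V]) auto
      show "f (\<Sum>i<n. scl X (v i) (e i)) i = v i"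
      proof (cases "i < n")
        case True
        have "\<phi> i (\<Sum>j<n. scl X (v j) (e j)) = (\<Sum>j<n. \<phi> i (scl X (v j) (e j)))"
          using True coord_mem[OF c] by (intro lin_setsum[OF V is_vs_ground coord_lin[OF c]] vs_scale[OF V]) auto
        also have "\<dots> = (\<Sum>j<n. v j * (if i = j then 1 else 0))"
          using True coord_mem[OF c] coord_delta[OF c] lin_scale[OF coord_lin[OF c]] by (intro sum.cong) auto
        also have "\<dots> = v i" using True by (simp add: if_distrib sum.delta cong: if_cong)
        finally show ?thesis using True mem by (simp add: f_def)
      qed (use v in \<open>simp add: f_def cs fin_space_def\<close>)
    qed
    show "f ` car X \<subseteq> car Y" using lin_mem[OF fl] by blast
    show "(\<lambda>v. \<Sum>i<n. scl X (v i) (e i)) ` car Y \<subseteq> car X"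
      using coord_mem[OF c] by (auto intro!: vs_sum[OF V] vs_scale[OF V])
  qed
  ultimately have "mod_iso H X Y" unfolding mod_iso_def by blast
  then show ?thesis by (rule that[OF Yo])
qed

section \<open>The finite dual\<close>

text \<open>Each further functional lowers the dimension of the common kernel by at most one: if \<open>f\<close> does
  not vanish at \<open>b\<close>, then \<open>b\<close> and the kernel of \<open>f\<close> span everything.\<close>

lemma cofinite_kernel:
  assumes F: "finite F" "F \<subseteq> Hd"
  shows "\<exists>B. finite B \<and> B \<subseteq> car H \<and> Modules.module.span (scl H) ({h \<in> car H. \<forall>f\<in>F. f h = 0} \<union> B) = car H"
proof -
  interpret V: vector_space "scl H" using vs_H by (simp add: is_vs_def)
  have sH: "V.subspace (car H)" using vs_H by (simp add: is_vs_def)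
  show ?thesis
    using F
  proof (induction F rule: finite_induct)
    case empty
    show ?case using sH by (intro exI[of _ "{}"]) (simp add: V.span_eq_iff)
  next
    case (insert f F)
    define K where "K = {h \<in> car H. \<forall>f\<in>F. f h = 0}"
    define K' where "K' = {h \<in> car H. \<forall>f\<in>insert f F. f h = 0}"
    obtain B where B: "finite B" "B \<subseteq> car H" "V.span (K \<union> B) = car H" using insert by (auto simp: K_def)
    have f: "lin H ground f" using insert Hd_lin by blast
    have "\<exists>b\<in>car H. K \<subseteq> V.span (K' \<union> {b})"
    proof (cases "\<exists>b\<in>K. f b \<noteq> 0")
      case True
      then obtain b where b: "b \<in> K" "f b \<noteq> 0" by blast
      have "k \<in> V.span (K' \<union> {b})" if k: "k \<in> K" for k
      proof -
        define k' where "k' = k - scl H (f k / f b) b"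
        have mem: "k \<in> car H" "b \<in> car H" "scl H (f k / f b) b \<in> car H"
          using k b vs_scale[OF vs_H] by (auto simp: K_def)
        have "g k' = g k - (f k / f b) * g b" if "lin H ground g" for g
          unfolding k'_def using lin_diff[OF vs_H that mem(1,3)] lin_scale[OF that mem(2)] by simp
        note gk = this
        have "g k' = 0" if g: "g \<in> insert f F" for g
        proof (cases "g = f")
          case True
          then show ?thesis using gk[OF f] b(2) by simp
        next
          case False
          then have "g \<in> F" "g \<in> Hd" using g insert.prems by auto
          moreover from this have "g k = 0" "g b = 0" using k b(1) by (auto simp: K_def)
          ultimately show ?thesis using gk[OF Hd_lin, of g] by simp
        qed
        moreover have "k' \<in> car H" unfolding k'_def by (rule vs_diff[OF vs_H mem(1,3)])
        ultimately have "k' \<in> K'" by (simp add: K'_def)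
        moreover have "k = k' + scl H (f k / f b) b" by (simp add: k'_def)
        ultimately show ?thesis
          by (metis V.span_add V.span_base V.span_scale UnI1 UnI2 singletonI)
      qed
      then show ?thesis using b by (auto simp: K_def)
    next
      case False
      then have "K \<subseteq> K'" by (auto simp: K_def K'_def)
      then show ?thesis using vs_zero[OF vs_H] V.span_superset by blast
    qed
    then obtain b where b: "b \<in> car H" "K \<subseteq> V.span (K' \<union> {b})" by blast
    have "K \<union> B \<subseteq> V.span (K' \<union> insert b B)"
      using b(2) V.span_mono[of "K' \<union> {b}" "K' \<union> insert b B"] V.span_superset[of "K' \<union> insert b B"] by blast
    then have "car H \<subseteq> V.span (K' \<union> insert b B)" using B(3) V.span_minimal V.subspace_span by metis
    moreover have "V.span (K' \<union> insert b B) \<subseteq> car H"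
      using b B sH by (intro V.span_minimal) (auto simp: K'_def)
    ultimately show ?case using B b unfolding K'_def by (intro exI[of _ "insert b B"]) auto
  qed
qed

text \<open>The common kernel of all matrix entries is an ideal, and it is the annihilator of the representation.\<close>

lemma rep_mat_fin_dual:
  assumes c: "rep_mat I c" and ij: "i \<in> I" "j \<in> I"
  shows "c i j \<in> car (fin_dual_vs H)"
proof -
  interpret V: vector_space "scl H" using vs_H by (simp add: is_vs_def)
  (* the representation factors through the quotient by the common kernel K *)
  define F where "F = (\<lambda>(i,j). c i j) ` (I \<times> I)"
  define K where "K = {h \<in> car H. \<forall>f\<in>F. f h = 0}"
  have F: "finite F" "F \<subseteq> Hd" using rep_finite[OF c] rep_Hd[OF c] by (auto simp: F_def)
  have K: "c i j h = 0" "h \<in> car H" if "h \<in> K" "i \<in> I" "j \<in> I" for h i j using that by (auto simp: K_def F_def)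
  have "V.subspace K"
  proof (rule V.subspaceI)
    have Fl: "lin H ground f" if "f \<in> F" for f using that F(2) Hd_lin by blast
    have "f 0 = 0" if "f \<in> F" for f by (rule lin_0[OF vs_H is_vs_ground Fl[OF that]])
    then show "0 \<in> K" using vs_zero[OF vs_H] by (simp add: K_def)
    show "x + y \<in> K" if xy: "x \<in> K" "y \<in> K" for x y
    proof -
      have "f (x + y) = 0" if "f \<in> F" for f
      proof -
        have "f x = 0" "f y = 0" "x \<in> car H" "y \<in> car H" using xy that by (auto simp: K_def)
        then show ?thesis using lin_add[OF Fl[OF that], of x y] by simp
      qed
      then show ?thesis using xy vs_add[OF vs_H] by (simp add: K_def)
    qed
    show "scl H k x \<in> K" if x: "x \<in> K" for x k
    proof -
      have "f (scl H k x) = 0" if "f \<in> F" for f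
      proof -
        have "f x = 0" "x \<in> car H" using x that by (auto simp: K_def)
        then show ?thesis using lin_scale[OF Fl[OF that], of x k] by simp
      qed
      then show ?thesis using x vs_scale[OF vs_H] by (simp add: K_def)
    qed
  qed
  moreover have "mul H a x \<in> K \<and> mul H x a \<in> K" if "a \<in> car H" "x \<in> K" for a x
  proof -
    have x: "x \<in> car H" using that(2) by (simp add: K_def)
    have "c i j (mul H a x) = 0 \<and> c i j (mul H x a) = 0" if "i \<in> I" "j \<in> I" for i j
      using that K(1)[OF \<open>x \<in> K\<close>] by (simp add: rep_mul[OF c that] \<open>a \<in> car H\<close> x)
    then show ?thesis using mul_mem[OF x that(1)] mul_mem[OF that(1) x] by (auto simp: K_def F_def)
  qed
  moreover have "\<exists>B. finite B \<and> B \<subseteq> car H \<and> V.span (K \<union> B) = car H"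
    unfolding K_def by (rule cofinite_kernel[OF F])
  moreover have "K \<subseteq> car H" by (auto simp: K_def)
  ultimately have "cofinite_ideal H K" unfolding cofinite_ideal_def by blast
  moreover have "c i j \<in> {f \<in> Hd. \<forall>x\<in>K. f x = 0}" using K(1) ij rep_Hd[OF c ij] by simp
  ultimately show ?thesis by (auto simp: fin_dual_vs_def simp del: mem_Collect_eq)
qed

text \<open>A basis of \<open>I\<close> is extended to one of \<open>H\<close> by finitely many vectors; their coordinate
  functionals cut out \<open>I\<close>.\<close>

lemma cofinite_ideal_kernel:
  assumes I: "cofinite_ideal H I"
  shows "\<exists>F. finite F \<and> F \<subseteq> Hd \<and> I = {h \<in> car H. \<forall>f\<in>F. f h = 0}"
proof -
  interpret V: vector_space "scl H" using vs_H by (simp add: is_vs_def)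
  have sI: "V.subspace I" and IH: "I \<subseteq> car H" using I by (auto simp: cofinite_ideal_def)
  obtain B where B: "finite B" "V.span (I \<union> B) = car H" using I by (auto simp: cofinite_ideal_def)
  obtain A where A: "A \<subseteq> I" "V.independent A" "I \<subseteq> V.span A"
    using V.maximal_independent_subset by blast
  (* extending by vectors of B keeps the complement E - A finite *)
  obtain E where E: "A \<subseteq> E" "E \<subseteq> A \<union> B" "V.independent E" "A \<union> B \<subseteq> V.span E"
    using V.maximal_independent_subset_extend[OF _ A(2), of "A \<union> B"] by blast
  have "I \<union> B \<subseteq> V.span E"
    using A(3) E(4) V.span_mono[OF E(1)] by blast
  then have sE: "car H \<subseteq> V.span E" using V.span_minimal[OF _ V.subspace_span] unfolding B(2)[symmetric] by blast
  let ?r = "\<lambda>e h. if h \<in> car H then V.representation E h e else 0"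
  have "?r e \<in> Hd" for e
    using sE E(3) V.representation_add V.representation_scale
    by (intro restrict_Hd linI) (auto simp: subset_iff)
  moreover have "finite (E - A)" by (rule finite_subset[OF _ B(1)]) (use E(2) in blast)
  moreover have "I = {h \<in> car H. \<forall>e\<in>E - A. ?r e h = 0}"
  proof (intro equalityI subsetI)
    fix h assume h: "h \<in> I"
    have "V.representation E h e = 0" if "e \<notin> A" for e
      using that V.representation_extend[OF E(3) subsetD[OF A(3) h] E(1)] V.representation_ne_zero[of A h e] by auto
    then show "h \<in> {h \<in> car H. \<forall>e\<in>E - A. ?r e h = 0}" using h IH by auto
  next
    fix h assume h: "h \<in> {h \<in> car H. \<forall>e\<in>E - A. ?r e h = 0}"
    then have "h = (\<Sum>e | V.representation E h e \<noteq> 0. scl H (V.representation E h e) e)"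
      using V.sum_nonzero_representation_eq[OF E(3)] sE by auto
    also have "\<dots> \<in> I"
      using h A(1) V.representation_ne_zero[of E h] by (intro V.subspace_sum[OF sI] V.subspace_scale[OF sI]) auto
    finally show "h \<in> I" .
  qed
  ultimately show ?thesis by (intro exI[of _ "?r ` (E - A)"]) auto
qed

lemma cofinite_ideal_inter:
  assumes I: "cofinite_ideal H I" and J: "cofinite_ideal H J"
  shows "cofinite_ideal H (I \<inter> J)"
proof -
  interpret V: vector_space "scl H" using vs_H by (simp add: is_vs_def)
  obtain F where F: "finite F" "F \<subseteq> Hd" "I = {h \<in> car H. \<forall>f\<in>F. f h = 0}"
    using cofinite_ideal_kernel[OF I] by blast
  obtain G where G: "finite G" "G \<subseteq> Hd" "J = {h \<in> car H. \<forall>f\<in>G. f h = 0}"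
    using cofinite_ideal_kernel[OF J] by blast
  have "I \<inter> J = {h \<in> car H. \<forall>f\<in>F \<union> G. f h = 0}" unfolding F(3) G(3) by auto
  then have "\<exists>B. finite B \<and> B \<subseteq> car H \<and> V.span ((I \<inter> J) \<union> B) = car H"
    using cofinite_kernel[of "F \<union> G"] F(1,2) G(1,2) by simp
  then show ?thesis
    using I J V.subspace_inter unfolding cofinite_ideal_def by auto
qed

lemma scl_fin_dual: "scl (fin_dual_vs H) = (\<lambda>c f x. c * f x)" "scl (fin_dual H) = (\<lambda>c f x. c * f x)"
  and car_fin_dual: "car (fin_dual H) = car (fin_dual_vs H)"
  by (simp_all add: fin_dual_vs_def fin_dual_def dual_vs_def)

lemma fin_dual_Hd: "f \<in> car (fin_dual_vs H) \<Longrightarrow> f \<in> Hd"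
  by (auto simp: fin_dual_vs_def)

text \<open>Functionals that vanish on \<open>I\<close> and on \<open>J\<close> have a sum that vanishes on \<open>I \<inter> J\<close>.\<close>

lemma subspace_fin_dual: "funs.subspace (car (fin_dual_vs H))"
proof (rule funs.subspaceI)
  have z: "0 \<in> Hd" and sc: "f \<in> Hd \<Longrightarrow> (\<lambda>x. c * f x) \<in> Hd" and ad: "f \<in> Hd \<Longrightarrow> g \<in> Hd \<Longrightarrow> f + g \<in> Hd" for f g c
    using vs_zero[OF is_vs_dual[OF vs_H]] vs_scale[OF is_vs_dual[OF vs_H]] vs_add[OF is_vs_dual[OF vs_H]]
    by (auto simp: dual_vs_def)
  interpret V: vector_space "scl H" using vs_H by (simp add: is_vs_def)
  have sH: "V.subspace (car H)" using vs_H by (simp add: is_vs_def)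
  have "cofinite_ideal H (car H)"
    unfolding cofinite_ideal_def using sH mul_mem
    by (intro conjI exI[of _ "{}"]) (auto simp: V.span_eq_iff)
  then show "0 \<in> car (fin_dual_vs H)" using z by (force simp: fin_dual_vs_def)
  show "(\<lambda>x. c * f x) \<in> car (fin_dual_vs H)" if "f \<in> car (fin_dual_vs H)" for c f
    using that sc[of f c] by (auto simp: fin_dual_vs_def)
  show "f + g \<in> car (fin_dual_vs H)" if fg: "f \<in> car (fin_dual_vs H)" "g \<in> car (fin_dual_vs H)" for f g
  proof -
    obtain I where I: "cofinite_ideal H I" "f \<in> Hd" "\<forall>x\<in>I. f x = 0" using fg by (auto simp: fin_dual_vs_def)
    obtain J where J: "cofinite_ideal H J" "g \<in> Hd" "\<forall>x\<in>J. g x = 0" using fg by (auto simp: fin_dual_vs_def)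
    have "\<forall>x\<in>I \<inter> J. (f + g) x = 0" using I J by auto
    then show ?thesis using cofinite_ideal_inter[OF I(1) J(1)] ad[OF I(2) J(2)]
      unfolding fin_dual_vs_def by auto
  qed
qed

lemma is_vs_fin_dual: "is_vs (fin_dual_vs H)" "is_vs (fin_dual H)"
  using subspace_fin_dual vector_space_fun by (simp_all add: is_vs_def scl_fin_dual car_fin_dual)

lemma coefs_fin_dual:
  assumes X: "X \<in> mod_obj H"
  shows "coefs X \<subseteq> car (fin_dual_vs H)"
proof -
  obtain n e \<phi> where c: "coord_basis X {..<n::nat} e \<phi>" using mod_basis[OF X] .
  show ?thesis
    by (rule coefs_basis_subset[OF X c subspace_fin_dual rep_mat_fin_dual[OF mod_rep_mat[OF X c]]])
qed

text \<open>The property by which the coproduct of the finite dual is defined.\<close>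

definition comul_spec :: "('h \<Rightarrow> 'k) \<Rightarrow> ('k, 'h \<Rightarrow> 'k, 'h \<Rightarrow> 'k) tensor \<Rightarrow> bool" where
  "comul_spec f t \<longleftrightarrow> t \<in> car (tensor_vs (fin_dual_vs H) (fin_dual_vs H)) \<and>
     (\<forall>a\<in>car H. \<forall>b\<in>car H. tlift (fin_dual_vs H) (fin_dual_vs H) (\<lambda>f1 f2. f1 a * f2 b) t = f (mul H a b))"

lemma lin_eval: "scl V = (\<lambda>c f x. c * f x) \<Longrightarrow> lin V ground (\<lambda>f. f a)"
  by (simp add: lin_def)

lemma bilin_eval2: "bilin (fin_dual_vs H) (fin_dual_vs H) ground (\<lambda>f1 f2. f1 a * f2 b)"
  by (intro bilin_mult lin_eval scl_fin_dual)

text \<open>Evaluating the second factor, and then the values in the first one, separates tensors.\<close>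

lemma comul_spec_unique:
  assumes s: "comul_spec f s" and t: "comul_spec f t"
  shows "s = t"
proof (rule tensor_eval_unique[OF is_vs_fin_dual(1) is_vs_fin_dual(1) scl_fin_dual(1), where S = "car H"])
  let ?F = "fin_dual_vs H"
  show "w h = 0" if "w \<in> car ?F" "h \<notin> car H" for w h
    using Hd_zero[OF fin_dual_Hd[OF that(1)] that(2)] .
  show st: "s \<in> car (tensor_vs ?F ?F)" "t \<in> car (tensor_vs ?F ?F)" using s t by (auto simp: comul_spec_def)
  fix b assume b: "b \<in> car H"
  have bl: "bilin ?F ?F ?F (\<lambda>v w. scl ?F (w b) v)"
    by (rule bilin_scl[OF is_vs_fin_dual(1) lin_eval[OF scl_fin_dual(1)]])
  note tl = tensor_universal[OF is_vs_fin_dual(1) is_vs_fin_dual(1) is_vs_fin_dual(1) bl]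
  have ev: "tlift ?F ?F (\<lambda>v w. scl ?F (w b) v) u a = tlift ?F ?F (\<lambda>f1 f2. f1 a * f2 b) u"
    if "u \<in> car (tensor_vs ?F ?F)" for u a
  proof (rule tensor_lin_eq[OF is_vs_fin_dual(1) is_vs_fin_dual(1) is_vs_ground _ _ _ that])
    show "lin (tensor_vs ?F ?F) ground (\<lambda>u. tlift ?F ?F (\<lambda>v w. scl ?F (w b) v) u a)"
      by (rule lin_comp[OF tl(1) lin_eval[OF scl_fin_dual(1)]])
    show "lin (tensor_vs ?F ?F) ground (tlift ?F ?F (\<lambda>f1 f2. f1 a * f2 b))"
      by (rule tensor_universal(1)[OF is_vs_fin_dual(1) is_vs_fin_dual(1) is_vs_ground bilin_eval2])
    fix v w assume vw: "v \<in> car ?F" "w \<in> car ?F"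
    show "tlift ?F ?F (\<lambda>v w. scl ?F (w b) v) (tens ?F ?F v w) a = tlift ?F ?F (\<lambda>f1 f2. f1 a * f2 b) (tens ?F ?F v w)"
      unfolding tl(2)[OF vw] tensor_universal(2)[OF is_vs_fin_dual(1) is_vs_fin_dual(1) is_vs_ground bilin_eval2 vw]
      by (simp add: scl_fin_dual mult.commute)
  qed
  show "tlift ?F ?F (\<lambda>v w. scl ?F (w b) v) s = tlift ?F ?F (\<lambda>v w. scl ?F (w b) v) t"
  proof
    fix a
    show "tlift ?F ?F (\<lambda>v w. scl ?F (w b) v) s a = tlift ?F ?F (\<lambda>v w. scl ?F (w b) v) t a"
    proof (cases "a \<in> car H")
      case True
      then show ?thesis unfolding ev[OF st(1)] ev[OF st(2)] using s t b by (simp add: comul_spec_def)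
    next
      case False
      show ?thesis
        using Hd_zero[OF fin_dual_Hd[OF lin_mem[OF tl(1) st(1)]] False]
          Hd_zero[OF fin_dual_Hd[OF lin_mem[OF tl(1) st(2)]] False] by simp
    qed
  qed
qed

lemma comul_eqI: "comul_spec f t \<Longrightarrow> comul (fin_dual H) f = t"
  unfolding fin_dual_def
  by simp (rule the_equality, simp add: comul_spec_def, rule comul_spec_unique[of f], simp_all add: comul_spec_def)

lemma comul_spec_add: "comul_spec f s \<Longrightarrow> comul_spec g t \<Longrightarrow> comul_spec (f + g) (s + t)"
  and comul_spec_scale: "comul_spec f s \<Longrightarrow> comul_spec (\<lambda>x. c * f x) (tensor_scl c s)"
  using vs_add[OF is_vs_tensor_vs[of "fin_dual_vs H" "fin_dual_vs H"]]
    vs_scale[OF is_vs_tensor_vs[of "fin_dual_vs H" "fin_dual_vs H"]]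
    lin_add[OF tensor_universal(1)[OF is_vs_fin_dual(1) is_vs_fin_dual(1) is_vs_ground bilin_eval2]]
    lin_scale[OF tensor_universal(1)[OF is_vs_fin_dual(1) is_vs_fin_dual(1) is_vs_ground bilin_eval2]]
  by (simp_all add: comul_spec_def)

lemma comul_spec_mcoef:
  assumes X: "X \<in> mod_obj H" and c: "coord_basis X I e \<phi>" and p: "lin X ground \<psi>" and x: "x \<in> car X"
  shows "comul_spec (mcoef X \<psi> x)
    (\<Sum>k\<in>I. tens (fin_dual_vs H) (fin_dual_vs H) (mcoef X \<psi> (e k)) (mcoef X (\<phi> k) x))"
proof -
  have m: "mcoef X \<psi> (e k) \<in> car (fin_dual_vs H)" "mcoef X (\<phi> k) x \<in> car (fin_dual_vs H)" if "k \<in> I" for k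
    using coefs_fin_dual[OF X] mcoef_coefs[OF p coord_mem[OF c that]] mcoef_coefs[OF coord_lin[OF c that] x] by auto
  show ?thesis
    unfolding comul_spec_def
  proof (intro conjI ballI)
    show "(\<Sum>k\<in>I. tens (fin_dual_vs H) (fin_dual_vs H) (mcoef X \<psi> (e k)) (mcoef X (\<phi> k) x))
      \<in> car (tensor_vs (fin_dual_vs H) (fin_dual_vs H))"
      using m by (intro tens_sum_mem) auto
    fix a b assume ab: "a \<in> car H" "b \<in> car H"
    have "tlift (fin_dual_vs H) (fin_dual_vs H) (\<lambda>f1 f2. f1 a * f2 b)
      (\<Sum>k\<in>I. tens (fin_dual_vs H) (fin_dual_vs H) (mcoef X \<psi> (e k)) (mcoef X (\<phi> k) x)) =
      (\<Sum>k\<in>I. mcoef X \<psi> (e k) a * mcoef X (\<phi> k) x b)"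
      using m by (intro tlift_sum[OF is_vs_fin_dual(1) is_vs_fin_dual(1) is_vs_ground bilin_eval2 coord_finite[OF c]])
    then show "tlift (fin_dual_vs H) (fin_dual_vs H) (\<lambda>f1 f2. f1 a * f2 b)
      (\<Sum>k\<in>I. tens (fin_dual_vs H) (fin_dual_vs H) (mcoef X \<psi> (e k)) (mcoef X (\<phi> k) x)) = mcoef X \<psi> x (mul H a b)"
      by (simp add: mcoef_mul[OF X c p x ab])
  qed
qed

section \<open>The Hopf algebra spanned by the coefficients of tensor words\<close>

lemma iter_ldual_obj: "iter_ldual H M X \<Longrightarrow> X \<in> mod_obj H"
  by (induction rule: iter_ldual.induct) auto

lemma tensor_word_obj: "tensor_word H M L \<Longrightarrow> L \<in> mod_obj H"
  by (induction rule: tensor_word.induct) auto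

lemma sum_of_words_obj: "sum_of_words H M L \<Longrightarrow> L \<in> mod_obj H"
  by (induction rule: sum_of_words.induct) auto

definition word_coefs :: "('k, 'h, 'm::ab_group_add) lmod \<Rightarrow> ('h \<Rightarrow> 'k) set" where
  "word_coefs M = \<Union> {coefs L | L. tensor_word H M L}"

text \<open>This space will turn out to be the co-representation Hopf algebra of \<open>M\<close>.\<close>

definition word_span :: "('k, 'h, 'm::ab_group_add) lmod \<Rightarrow> ('h \<Rightarrow> 'k) set" where
  "word_span M = funs.span (word_coefs M)"

lemma subspace_word_span: "funs.subspace (word_span M)"
  by (simp add: word_span_def)

lemma word_coefs_word_span: "tensor_word H M L \<Longrightarrow> coefs L \<subseteq> word_span M"
  using funs.span_superset[of "word_coefs M"] by (auto simp: word_span_def word_coefs_def)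

lemma word_span_fin_dual: "word_span M \<subseteq> car (fin_dual_vs H)"
  unfolding word_span_def using coefs_fin_dual[OF tensor_word_obj]
  by (intro funs.span_minimal subspace_fin_dual) (auto simp: word_coefs_def)

lemma word_span_Hd: "f \<in> word_span M \<Longrightarrow> f \<in> Hd"
  using word_span_fin_dual fin_dual_Hd by blast

lemma word_span_induct [consumes 1, case_names subspace coef]:
  assumes "f \<in> word_span M" "funs.subspace {f. P f}" "\<And>L f. tensor_word H M L \<Longrightarrow> f \<in> coefs L \<Longrightarrow> P f"
  shows "P f"
  using assms(1) unfolding word_span_def
  by (rule funs.span_induct) (use assms(2,3) in \<open>auto simp: word_coefs_def\<close>)

lemma eps_word_span: "eps \<in> word_span M"
proof -
  obtain L :: "('k, 'h, nat \<Rightarrow> 'k) lmod" where L: "L \<in> mod_obj H" "mod_iso H (mod_unit H) L"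
    using mod_realise[OF mod_unit_obj] .
  have "(\<lambda>h. 1 * eps h) \<in> coefs (mod_unit H)" unfolding coefs_unit by blast
  then have "eps \<in> coefs L" using coefs_iso[OF mod_unit_obj mod_vs[OF L(1)] L(2)] by simp
  then show ?thesis using word_coefs_word_span[OF tensor_word.unit[OF L]] by blast
qed

lemma subspace_conv_left: "funs.subspace A \<Longrightarrow> funs.subspace {f. conv f g \<in> A}"
  and subspace_conv_right: "funs.subspace A \<Longrightarrow> funs.subspace {g. conv f g \<in> A}"
  and subspace_Sd: "funs.subspace A \<Longrightarrow> funs.subspace {f. Sd f \<in> A}"
  by (auto intro!: funs.subspaceI simp: conv_0 conv_add_left conv_add_right conv_scale_left conv_scale_right
      Sd_zero Sd_add Sd_scale funs.subspace_0 funs.subspace_add funs.subspace_scale)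

text \<open>A word may be multiplied from the left by one more factor.\<close>

lemma conv_iter_word_span:
  assumes X: "iter_ldual H M X" and u: "u \<in> coefs X" and w: "w \<in> word_span M"
  shows "conv u w \<in> word_span M"
  using w
proof (induction rule: word_span_induct)
  case subspace
  show ?case by (rule subspace_conv_right[OF subspace_word_span])
next
  case (coef L w)
  note Xo = iter_ldual_obj[OF X] and Lo = tensor_word_obj[OF coef(1)]
  obtain L' :: "('k, 'h, nat \<Rightarrow> 'k) lmod" where L': "L' \<in> mod_obj H" "mod_iso H (mod_tensor H X L) L'"
    using mod_realise[OF mod_tensor_obj[OF Xo Lo]] .
  have "conv u w \<in> coefs L'"
    using conv_coefs_tensor[OF Xo Lo u coef(2)] coefs_iso[OF mod_tensor_obj[OF Xo Lo] mod_vs[OF L'(1)] L'(2)] by simp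
  then show ?case using word_coefs_word_span[OF tensor_word.tensor[OF X coef(1) L']] by blast
qed

lemma iter_word_span:
  assumes "iter_ldual H M X"
  shows "coefs X \<subseteq> word_span M"
proof
  fix u assume u: "u \<in> coefs X"
  then have "conv u eps = u" using coefs_Hd[OF iter_ldual_obj[OF assms]] by (intro conv_eps_right) blast
  then show "u \<in> word_span M" using conv_iter_word_span[OF assms u eps_word_span] by simp
qed

text \<open>By induction on the word to which the left factor belongs: its factors are moved over to the right one by
  one, using associativity.\<close>

lemma conv_word_span:
  assumes f: "f \<in> word_span M" and g: "g \<in> word_span M"
  shows "conv f g \<in> word_span M"
  using f
proof (induction rule: word_span_induct)
  case subspace
  show ?case by (rule subspace_conv_left[OF subspace_word_span])
next
  case (coef L f)
  have "\<forall>f\<in>coefs L. \<forall>g\<in>word_span M. conv f g \<in> word_span M"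
    using coef(1)
  proof (induction rule: tensor_word.induct)
    case (unit L)
    show ?case
    proof (intro ballI)
      fix f g assume f: "f \<in> coefs L" and g: "g \<in> word_span M"
      obtain c where "f = (\<lambda>h. c * eps h)"
        using f coefs_iso[OF mod_unit_obj mod_vs[OF unit(1)] unit(2)] coefs_unit by auto
      then show "conv f g \<in> word_span M"
        using funs.subspace_scale[OF subspace_word_span g] by (simp add: conv_scale_left conv_eps_left[OF word_span_Hd[OF g]])
    qed
  next
    case (tensor X Y L)
    note Xo = iter_ldual_obj[OF tensor(1)] and Yo = tensor_word_obj[OF tensor(2)]
    show ?case
    proof (intro ballI)
      fix f g assume f: "f \<in> coefs L" and g: "g \<in> word_span M"
      have "coefs (mod_tensor H X Y) \<subseteq> {f. conv f g \<in> word_span M}"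
      proof (rule coefs_tensor_subset[OF Xo Yo subspace_conv_left[OF subspace_word_span]])
        fix u v assume u: "u \<in> coefs X" and v: "v \<in> coefs Y"
        have "conv (conv u v) g = conv u (conv v g)"
          using u v g coefs_Hd[OF Xo] coefs_Hd[OF Yo] by (intro conv_assoc word_span_Hd[of g]) auto
        also have "\<dots> \<in> word_span M" using tensor.IH v g by (intro conv_iter_word_span[OF tensor(1) u]) blast
        finally show "conv u v \<in> {f. conv f g \<in> word_span M}" by simp
      qed
      then show "conv f g \<in> word_span M"
        using f coefs_iso[OF mod_tensor_obj[OF Xo Yo] mod_vs[OF tensor.hyps(3)] tensor.hyps(4)] by blast
    qed
  qed
  then show ?case using coef(2) g by blast
qed

lemma Sd_iter_word_span:
  assumes X: "iter_ldual H M X" and f: "f \<in> coefs X"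
  shows "Sd f \<in> word_span M"
proof -
  note Xo = iter_ldual_obj[OF X]
  obtain Y :: "('k, 'h, nat \<Rightarrow> 'k) lmod" where Y: "Y \<in> mod_obj H" "mod_iso H (mod_ldual H X) Y"
    using mod_realise[OF mod_ldual_obj[OF Xo]] .
  have "Sd f \<in> coefs Y"
    using Sd_coefs[OF Xo f] coefs_iso[OF mod_ldual_obj[OF Xo] mod_vs[OF Y(1)] Y(2)] by simp
  then show ?thesis using iter_word_span[OF iter_ldual.dual[OF X Y]] by blast
qed

text \<open>By induction on the word.  As the antipode reverses products, the last factor comes first, which
  is why closure under products is needed here.\<close>

lemma Sd_word_span: "f \<in> word_span M \<Longrightarrow> Sd f \<in> word_span M"
proof (induction rule: word_span_induct)
  case subspace
  show ?case by (rule subspace_Sd[OF subspace_word_span])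
next
  case (coef L f)
  have "\<forall>f\<in>coefs L. Sd f \<in> word_span M"
    using coef(1)
  proof (induction rule: tensor_word.induct)
    case (unit L)
    show ?case
    proof
      fix f assume "f \<in> coefs L"
      then obtain c where "f = (\<lambda>h. c * eps h)"
        using coefs_iso[OF mod_unit_obj mod_vs[OF unit(1)] unit(2)] coefs_unit by auto
      then have "Sd f = (\<lambda>h. c * Sd eps h)" by (auto simp: Sd_def)
      then show "Sd f \<in> word_span M" using funs.subspace_scale[OF subspace_word_span eps_word_span] by (simp add: Sd_eps)
    qed
  next
    case (tensor X Y L)
    note Xo = iter_ldual_obj[OF tensor(1)] and Yo = tensor_word_obj[OF tensor(2)]
    show ?case
    proof
      have "coefs (mod_tensor H X Y) \<subseteq> {f. Sd f \<in> word_span M}"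
      proof (rule coefs_tensor_subset[OF Xo Yo subspace_Sd[OF subspace_word_span]])
        fix u v assume u: "u \<in> coefs X" and v: "v \<in> coefs Y"
        have "conv (Sd v) (Sd u) \<in> word_span M"
          using conv_word_span[OF _ Sd_iter_word_span[OF tensor(1) u]] v tensor.IH by blast
        then show "conv u v \<in> {f. Sd f \<in> word_span M}" by (simp add: Sd_conv_coefs[OF Xo Yo u v])
      qed
      then show "Sd f \<in> word_span M" if "f \<in> coefs L" for f
        using that coefs_iso[OF mod_tensor_obj[OF Xo Yo] mod_vs[OF tensor.hyps(3)] tensor.hyps(4)] by blast
    qed
  qed
  then show ?case using coef(2) by blast
qed

text \<open>The coproduct of a coefficient of a word involves coefficients of the same word only.\<close>

lemma comul_spec_word_span:
  assumes "f \<in> word_span M"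
  shows "\<exists>t\<in>car (tensor_vs ((fin_dual H)\<lparr>car := word_span M\<rparr>) ((fin_dual H)\<lparr>car := word_span M\<rparr>)). comul_spec f t"
  using assms
proof (induction rule: word_span_induct)
  let ?W = "(fin_dual H)\<lparr>car := word_span M\<rparr>"
  let ?T = "tensor_vs ?W ?W"
  case subspace
  show ?case
  proof (rule funs.subspaceI)
    have "tlift (fin_dual_vs H) (fin_dual_vs H) (\<lambda>f1 f2. f1 a * f2 b) 0 = 0" for a b
      by (rule lin_0[OF is_vs_tensor_vs is_vs_ground
            tensor_universal(1)[OF is_vs_fin_dual(1) is_vs_fin_dual(1) is_vs_ground bilin_eval2]])
    then have "comul_spec 0 0" using vs_zero[OF is_vs_tensor_vs] by (simp add: comul_spec_def)
    then show "0 \<in> {f. \<exists>t\<in>car ?T. comul_spec f t}" using vs_zero[OF is_vs_tensor_vs[of ?W ?W]] by blast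
    show "f + g \<in> {f. \<exists>t\<in>car ?T. comul_spec f t}"
      if "f \<in> {f. \<exists>t\<in>car ?T. comul_spec f t}" "g \<in> {f. \<exists>t\<in>car ?T. comul_spec f t}" for f g
      using that vs_add[OF is_vs_tensor_vs[of ?W ?W]] comul_spec_add by blast
    show "(\<lambda>x. c * f x) \<in> {f. \<exists>t\<in>car ?T. comul_spec f t}" if "f \<in> {f. \<exists>t\<in>car ?T. comul_spec f t}" for c f
      using that vs_scale[OF is_vs_tensor_vs[of ?W ?W]] comul_spec_scale unfolding tensor_vs_simps by blast
  qed
next
  case (coef L f)
  note Lo = tensor_word_obj[OF coef(1)]
  obtain n e \<phi> where c: "coord_basis L {..<n::nat} e \<phi>" using mod_basis[OF Lo] .
  obtain \<psi> x where f: "f = mcoef L \<psi> x" "lin L ground \<psi>" "x \<in> car L" using coef(2) by (auto simp: coefs_def)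
  let ?W = "(fin_dual H)\<lparr>car := word_span M\<rparr>"
  let ?t = "\<Sum>k<n. tens ?W ?W (mcoef L \<psi> (e k)) (mcoef L (\<phi> k) x)"
  have te: "tens ?W ?W = tens (fin_dual_vs H) (fin_dual_vs H)"
    by (rule tens_cong) (simp_all add: scl_fin_dual)
  have "comul_spec f ?t" unfolding te f(1) by (rule comul_spec_mcoef[OF Lo c f(2,3)])
  moreover have "?t \<in> car (tensor_vs ?W ?W)"
    using word_coefs_word_span[OF coef(1)] mcoef_coefs[OF f(2) coord_mem[OF c]] mcoef_coefs[OF coord_lin[OF c] f(3)]
    by (intro tens_sum_mem) auto
  ultimately show ?case by blast
qed

lemma base_word_span:
  assumes M: "M \<in> mod_obj H"
  shows "coefs M \<subseteq> word_span M"
proof -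
  obtain Y :: "('k, 'h, nat \<Rightarrow> 'k) lmod" where Y: "Y \<in> mod_obj H" "mod_iso H M Y"
    using mod_realise[OF M] .
  show ?thesis
    using iter_word_span[OF iter_ldual.base[OF Y]] coefs_iso[OF M mod_vs[OF Y(1)] Y(2)] by simp
qed

lemma hopf_subalgebra_word_span: "hopf_subalgebra (fin_dual H) (word_span M)"
  unfolding hopf_subalgebra_def scl_fin_dual car_fin_dual unt_fin_dual antip_fin_dual
proof (intro conjI ballI)
  show "word_span M \<subseteq> car (fin_dual_vs H)" by (rule word_span_fin_dual)
  show "funs.subspace (word_span M)" by (rule subspace_word_span)
  show "eps \<in> word_span M" by (rule eps_word_span)
  show "mul (fin_dual H) f g \<in> word_span M" if "f \<in> word_span M" "g \<in> word_span M" for f g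
    using conv_word_span[OF that] by (simp add: mul_fin_dual word_span_Hd[OF that(1)] word_span_Hd[OF that(2)])
  show "comul (fin_dual H) f \<in> car (tensor_vs ((fin_dual H)\<lparr>car := word_span M\<rparr>) ((fin_dual H)\<lparr>car := word_span M\<rparr>))"
    if "f \<in> word_span M" for f
    using comul_spec_word_span[OF that] comul_eqI by blast
  show "Sd f \<in> word_span M" if "f \<in> word_span M" for f by (rule Sd_word_span[OF that])
qed

text \<open>A Hopf subalgebra that contains the coefficients of \<open>M\<close> contains those of its iterated duals, by
  closure under the antipode, and those of words, by closure under products.\<close>

lemma word_span_least:
  assumes A: "hopf_subalgebra (fin_dual H) A" and M: "M \<in> mod_obj H" and c: "coefs M \<subseteq> A"
  shows "word_span M \<subseteq> A"
proof -
  have sA: "funs.subspace A" and AH: "A \<subseteq> car (fin_dual_vs H)" and e: "eps \<in> A"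
    and m: "\<And>f g. f \<in> A \<Longrightarrow> g \<in> A \<Longrightarrow> conv f g \<in> A" and s: "\<And>f. f \<in> A \<Longrightarrow> Sd f \<in> A"
    using A fin_dual_Hd mul_fin_dual
    unfolding hopf_subalgebra_def scl_fin_dual car_fin_dual unt_fin_dual antip_fin_dual
    by (auto simp: subset_iff)
  have it: "coefs X \<subseteq> A" if "iter_ldual H M X" for X
    using that
  proof (induction rule: iter_ldual.induct)
    case (base X)
    then show ?case using c coefs_iso[OF M mod_vs base(2)] by simp
  next
    case (dual X Y)
    note Xo = iter_ldual_obj[OF dual(1)]
    have "coefs (mod_ldual H X) \<subseteq> A" using s dual.IH by (intro coefs_ldual_subset[OF Xo sA]) blast
    then show ?case using coefs_iso[OF mod_ldual_obj[OF Xo] mod_vs[OF dual.hyps(2)] dual.hyps(3)] by simp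
  qed
  have wo: "coefs L \<subseteq> A" if "tensor_word H M L" for L
    using that
  proof (induction rule: tensor_word.induct)
    case (unit L)
    have "coefs (mod_unit H) \<subseteq> A" unfolding coefs_unit using funs.subspace_scale[OF sA e] by auto
    then show ?case using coefs_iso[OF mod_unit_obj mod_vs[OF unit(1)] unit(2)] by simp
  next
    case (tensor X Y L)
    note Xo = iter_ldual_obj[OF tensor(1)] and Yo = tensor_word_obj[OF tensor(2)]
    have "coefs (mod_tensor H X Y) \<subseteq> A"
      using it[OF tensor(1)] tensor.IH by (intro coefs_tensor_subset[OF Xo Yo sA] m) auto
    then show ?case
      using coefs_iso[OF mod_tensor_obj[OF Xo Yo] mod_vs[OF tensor.hyps(3)] tensor.hyps(4)] by simp
  qed
  show ?thesis
    unfolding word_span_def using wo by (intro funs.span_minimal sA) (auto simp: word_coefs_def)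
qed

text \<open>The functionals \<open>coeff H \<pi> i j\<close> are the entries of the coefficient matrix of \<open>M\<close>, so a subspace
  contains their span if and only if it contains all coefficients of \<open>M\<close>.\<close>

lemma car_corep_hopf:
  assumes M: "M \<in> mod_obj H" and r: "matrix_rep_of H M n \<pi>"
  shows "car (corep_hopf H n \<pi>) = word_span M"
proof -
  obtain e where e: "inj_on e {..<n}" "\<not> Modules.module.dependent (scl M) (e ` {..<n})"
     "Modules.module.span (scl M) (e ` {..<n}) = car M"
     "\<forall>h\<in>car H. \<forall>j<n. act M h (e j) = (\<Sum>i<n. scl M (\<pi> h $$ (i, j)) (e i))"
    using r by (auto simp: matrix_rep_of_def)
  note V = mod_vs[OF M]
  obtain \<phi> where c: "coord_basis M {..<n} e \<phi>"
    using coord_basis_of_independent[OF V finite_lessThan e(1-3)] .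
  have co: "coeff H \<pi> i j = mcoef M (\<phi> i) (e j)" if "i < n" "j < n" for i j
  proof
    fix h show "coeff H \<pi> i j h = mcoef M (\<phi> i) (e j) h"
    proof (cases "h \<in> car H")
      case True
      have "\<phi> i (act M h (e j)) = (\<Sum>k<n. \<phi> i (scl M (\<pi> h $$ (k, j)) (e k)))"
        using e(4) True that coord_mem[OF c]
        by (simp, intro lin_setsum[OF V is_vs_ground coord_lin[OF c]] vs_scale[OF V]) auto
      also have "\<dots> = (\<Sum>k<n. \<pi> h $$ (k, j) * (if i = k then 1 else 0))"
        using that coord_mem[OF c] coord_delta[OF c] lin_scale[OF coord_lin[OF c]] by (intro sum.cong) auto
      also have "\<dots> = \<pi> h $$ (i, j)" using that by (simp add: if_distrib sum.delta cong: if_cong)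
      finally show ?thesis using True by (simp add: coeff_def mcoef_def)
    qed (simp add: coeff_def mcoef_def)
  qed
  have iff: "cf H n \<pi> \<subseteq> A \<longleftrightarrow> coefs M \<subseteq> A" if A: "funs.subspace A" for A
  proof
    assume sub: "cf H n \<pi> \<subseteq> A"
    show "coefs M \<subseteq> A"
    proof (rule coefs_basis_subset[OF M c A])
      fix i j assume ij: "i \<in> {..<n}" "j \<in> {..<n}"
      have "coeff H \<pi> i j \<in> cf H n \<pi>"
        unfolding cf_def scl_fin_dual by (rule funs.span_base) (use ij in auto)
      then show "mcoef M (\<phi> i) (e j) \<in> A" using sub co[of i j] ij by auto
    qed
  next
    assume sub: "coefs M \<subseteq> A"
    have "coeff H \<pi> i j \<in> A" if "i < n" "j < n" for i j
    proof -
      have "mcoef M (\<phi> i) (e j) \<in> coefs M"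
        by (rule mcoef_coefs[OF coord_lin[OF c] coord_mem[OF c]]) (use that in auto)
      then show ?thesis using sub unfolding co[OF that] by blast
    qed
    then show "cf H n \<pi> \<subseteq> A" unfolding cf_def scl_fin_dual by (intro funs.span_minimal A) auto
  qed
  have "cf H n \<pi> \<subseteq> word_span M" using iff[OF subspace_word_span] base_word_span[OF M] by blast
  moreover have "word_span M \<subseteq> A" if "hopf_subalgebra (fin_dual H) A" "cf H n \<pi> \<subseteq> A" for A
  proof -
    have "funs.subspace A" using that(1) by (simp add: hopf_subalgebra_def scl_fin_dual)
    then show ?thesis using word_span_least[OF that(1) M] iff that(2) by blast
  qed
  ultimately show ?thesis using hopf_subalgebra_word_span[of M] unfolding corep_hopf_def by auto
qed

section \<open>The modules with coefficients in the co-representation Hopf algebra\<close>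

lemma gen_obj_coefs:
  assumes X: "X \<in> gen_obj H M"
  shows "coefs X \<subseteq> word_span M"
proof -
  obtain L where L: "sum_of_words H M L" "subquotient H X L" using X by (auto simp: gen_obj_def)
  have "coefs L \<subseteq> word_span M"
    using L(1)
  proof (induction rule: sum_of_words.induct)
    case (zero L)
    have "mcoef L \<psi> x = 0" if "lin L ground \<psi>" "x \<in> car L" for \<psi> x
    proof
      fix h
      have "h \<in> car H \<Longrightarrow> act L h x = 0" using mod_act_mem[OF zero(1) _ that(2)] zero(2) by (auto simp: mod_zero_def)
      then show "mcoef L \<psi> x h = 0 h"
        using lin_0[OF mod_vs[OF zero(1)] is_vs_ground that(1)] by (simp add: mcoef_def)
    qed
    then show ?case using funs.subspace_0[OF subspace_word_span[of M]] by (auto simp: coefs_def)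
  next
    case (sum X Y L)
    note Xo = tensor_word_obj[OF sum(1)] and Yo = sum_of_words_obj[OF sum(2)]
    have "coefs (mod_sum X Y) \<subseteq> word_span M"
      by (rule coefs_sum_subset[OF Xo Yo subspace_word_span word_coefs_word_span[OF sum(1)] sum.IH])
    then show ?case
      using coefs_iso[OF mod_sum_obj[OF Xo Yo] mod_vs[OF sum.hyps(3)] sum.hyps(4)] by simp
  qed
  then show ?thesis using coefs_subquotient[OF sum_of_words_obj[OF L(1)] L(2)] by blast
qed

lemma submodule_obj:
  assumes L: "L \<in> mod_obj H" and S: "Modules.module.subspace (scl L) S" "S \<subseteq> car L"
    and cl: "\<And>a x. a \<in> car H \<Longrightarrow> x \<in> S \<Longrightarrow> act L a x \<in> S"
  shows "\<lparr>car = S, scl = scl L, act = (\<lambda>a x. if x \<in> S then act L a x else 0)\<rparr> \<in> mod_obj H" (is "?A \<in> _")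
proof -
  interpret L: vector_space "scl L" using mod_vs[OF L] by (simp add: is_vs_def)
  have vs: "is_vs ?A" using L.vector_space_axioms S by (simp add: is_vs_def)
  obtain B where B: "finite B" "B \<subseteq> S" "L.span B = S" using fin_dim_subspace[OF mod_fin_dim[OF L] S] .
  have fd: "fin_dim_vs ?A" using vs B unfolding fin_dim_vs_def by auto
  have "bilin H ?A ?A (act ?A)"
  proof (rule bilinI)
    fix a assume a: "a \<in> car H"
    show "lin ?A ?A (act ?A a)"
    proof (rule linI)
      fix x y assume x: "x \<in> car ?A"
      show "act ?A a x \<in> car ?A" using x cl[OF a] by simp
      show "act ?A a (scl ?A c x) = scl ?A c (act ?A a x)" for c
        using x S lin_scale[OF mod_act_lin[OF L a]] L.subspace_scale[OF S(1)] by auto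
      assume y: "y \<in> car ?A"
      show "act ?A a (x + y) = act ?A a x + act ?A a y"
        using x y S lin_add[OF mod_act_lin[OF L a], of x y] L.subspace_add[OF S(1)] by auto
    qed
  next
    fix x assume x: "x \<in> car ?A"
    then have xL: "x \<in> car L" using S by auto
    show "lin H ?A (\<lambda>a. act ?A a x)"
      using x cl lin_add[OF mod_act_lin_left[OF L xL]] lin_scale[OF mod_act_lin_left[OF L xL]]
      by (intro linI) auto
  qed
  then show ?thesis
    unfolding mod_obj_def using fd S(2) cl mod_unt[OF L] mod_mul[OF L] mod_outside[OF L]
    by (auto simp: subset_iff)
qed

text \<open>For fixed vectors \<open>l p\<close> of a module, the map from families of elements of \<open>H\<close> to the module.\<close>

definition hsum :: "'i set \<Rightarrow> ('k, 'h, 'v::ab_group_add) lmod \<Rightarrow> ('i \<Rightarrow> 'v) \<Rightarrow> ('i \<Rightarrow> 'h) \<Rightarrow> 'v" where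
  "hsum P L l h = (\<Sum>p\<in>P. act L (h p) (l p))"

lemma hsum_lin:
  assumes L: "L \<in> mod_obj H" and l: "\<forall>p\<in>P. l p \<in> car L" and h: "\<forall>p\<in>P. h p \<in> car H"
  shows hsum_mem: "hsum P L l h \<in> car L"
    and hsum_add: "\<forall>p\<in>P. h' p \<in> car H \<Longrightarrow> hsum P L l (\<lambda>p. h p + h' p) = hsum P L l h + hsum P L l h'"
    and hsum_diff: "\<forall>p\<in>P. h' p \<in> car H \<Longrightarrow> hsum P L l (\<lambda>p. h p - h' p) = hsum P L l h - hsum P L l h'"
    and hsum_scale: "hsum P L l (\<lambda>p. scl H k (h p)) = scl L k (hsum P L l h)"
    and hsum_mul: "a \<in> car H \<Longrightarrow> hsum P L l (\<lambda>p. mul H a (h p)) = act L a (hsum P L l h)"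
proof -
  note V = mod_vs[OF L] and al = mod_act_lin_left[OF L bspec[OF l]]
  interpret L: vector_space "scl L" using V by (simp add: is_vs_def)
  have m: "act L (h p) (l p) \<in> car L" if "p \<in> P" for p using that h l by (simp add: mod_act_mem[OF L])
  show "hsum P L l h \<in> car L" unfolding hsum_def by (intro vs_sum[OF V] m)
  show "hsum P L l (\<lambda>p. h p + h' p) = hsum P L l h + hsum P L l h'"
    "hsum P L l (\<lambda>p. h p - h' p) = hsum P L l h - hsum P L l h'" if "\<forall>p\<in>P. h' p \<in> car H"
    unfolding hsum_def sum.distrib[symmetric] sum_subtractf[symmetric]
    using that h by (auto intro!: sum.cong simp: lin_add[OF al] lin_diff[OF vs_H al])
  show "hsum P L l (\<lambda>p. scl H k (h p)) = scl L k (hsum P L l h)"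
    unfolding hsum_def L.scale_sum_right using h by (auto intro!: sum.cong simp: lin_scale[OF al])
  assume a: "a \<in> car H"
  have "hsum P L l (\<lambda>p. mul H a (h p)) = (\<Sum>p\<in>P. act L a (act L (h p) (l p)))"
    unfolding hsum_def using a h l by (intro sum.cong) (simp_all add: mod_mul[OF L])
  also have "\<dots> = act L a (hsum P L l h)"
    unfolding hsum_def by (intro lin_setsum[OF V V mod_act_lin[OF L a], symmetric] m)
  finally show "hsum P L l (\<lambda>p. mul H a (h p)) = act L a (hsum P L l h)" .
qed

text \<open>The relations with coefficients in \<open>H\<close> that hold between the vectors \<open>l p\<close>.\<close>

definition relations :: "'i set \<Rightarrow> ('k, 'h, 'v::ab_group_add) lmod \<Rightarrow> ('i \<Rightarrow> 'v) \<Rightarrow> ('i \<Rightarrow> 'h) set" where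
  "relations P L l = {h. (\<forall>p\<in>P. h p \<in> car H) \<and> hsum P L l h = 0}"

text \<open>Write \<open>f\<close> as a combination of coefficients \<open>h \<mapsto> \<psi> (h z)\<close> of words \<open>Z\<close>.  Replacing
  \<open>L\<close> by \<open>Z \<oplus> L\<close> and the vector \<open>l q\<close> by \<open>(z, l q)\<close> adds the requirement
  \<open>h q \<cdot> z = 0\<close> to the relations, which makes the coefficient vanish at \<open>h q\<close>.  Only words are added on
  the left, so the result is again a sum of words, and no powers of \<open>L\<close> have to be formed.\<close>

lemma relations_extend:
  assumes P: "finite P" "q \<in> P" and f: "f \<in> word_span M"
    and L: "sum_of_words H M L" "\<And>p. p \<in> P \<Longrightarrow> l p \<in> car L"
  shows "\<exists>L' l'. sum_of_words H M L' \<and> (\<forall>p\<in>P. l' p \<in> car L') \<and>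
    relations P L' l' \<subseteq> {h \<in> relations P L l. f (h q) = 0}"
  using f unfolding word_span_def
proof (induction rule: funs.span_induct_alt)
  case base
  show ?case using L by (intro exI[of _ L] exI[of _ l]) auto
next
  case (step c x y)
  obtain L1 l1 where L1: "sum_of_words H M L1" "\<forall>p\<in>P. l1 p \<in> car L1"
    "relations P L1 l1 \<subseteq> {h \<in> relations P L l. y (h q) = 0}" using step.IH by blast
  obtain Z where Z: "tensor_word H M Z" "x \<in> coefs Z" using step by (auto simp: word_coefs_def)
  obtain \<psi> z where z: "x = mcoef Z \<psi> z" "lin Z ground \<psi>" "z \<in> car Z" using Z(2) by (auto simp: coefs_def)
  note Zo = tensor_word_obj[OF Z(1)] and Lo = sum_of_words_obj[OF L1(1)]
  note So = mod_sum_obj[OF Zo Lo]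
  obtain L' :: "('k, 'h, nat \<Rightarrow> 'k) lmod" where L': "L' \<in> mod_obj H" "mod_iso H (mod_sum Z L1) L'"
    using mod_realise[OF So] .
  obtain g where g: "g \<in> mod_hom H (mod_sum Z L1) L'" "bij_betw g (car (mod_sum Z L1)) (car L')"
    using L'(2) by (auto simp: mod_iso_def)
  (* z sits at position q only *)
  define v where "v = (\<lambda>p. (if p = q then z else 0, l1 p))"
  have v: "v p \<in> car (mod_sum Z L1)" if "p \<in> P" for p
    using that z(3) L1(2) vs_zero[OF mod_vs[OF Zo]] by (auto simp: v_def mod_sum_def)
  have gl: "lin (mod_sum Z L1) L' g" by (rule hom_lin[OF g(1)])
  have rel: "act Z (h q) z = 0 \<and> h \<in> relations P L1 l1" if h: "h \<in> relations P L' (\<lambda>p. g (v p))" for h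
  proof -
    have hm: "\<And>p. p \<in> P \<Longrightarrow> h p \<in> car H" using h by (simp add: relations_def)
    have av: "act (mod_sum Z L1) (h p) (v p) \<in> car (mod_sum Z L1)" if "p \<in> P" for p
      by (rule mod_act_mem[OF So hm[OF that] v[OF that]])
    have "0 = (\<Sum>p\<in>P. act L' (h p) (g (v p)))" using h by (simp add: relations_def hsum_def)
    also have "\<dots> = (\<Sum>p\<in>P. g (act (mod_sum Z L1) (h p) (v p)))"
      using hom_act[OF g(1) hm v] by (intro sum.cong) auto
    also have "\<dots> = g (\<Sum>p\<in>P. act (mod_sum Z L1) (h p) (v p))"
      by (intro lin_setsum[OF mod_vs[OF So] mod_vs[OF L'(1)] gl, symmetric] av)
    finally have "g (\<Sum>p\<in>P. act (mod_sum Z L1) (h p) (v p)) = g 0"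
      using lin_0[OF mod_vs[OF So] mod_vs[OF L'(1)] gl] by simp
    then have "(\<Sum>p\<in>P. act (mod_sum Z L1) (h p) (v p)) = 0"
      by (rule inj_onD[OF bij_betw_imp_inj_on[OF g(2)]])
        (rule vs_sum[OF mod_vs[OF So] av], assumption, rule vs_zero[OF mod_vs[OF So]])
    moreover have "act (mod_sum Z L1) (h p) (v p) = (if p = q then act Z (h q) z else 0, act L1 (h p) (l1 p))"
      if "p \<in> P" for p
      using that v[OF that] lin_0[OF mod_vs[OF Zo] mod_vs[OF Zo] mod_act_lin[OF Zo hm[OF that]]]
      by (auto simp: mod_sum_def v_def)
    ultimately have "(\<Sum>p\<in>P. if p = q then act Z (h q) z else 0, \<Sum>p\<in>P. act L1 (h p) (l1 p)) = (0, 0)"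
      by (simp add: sum_Pair[symmetric] zero_prod_def)
    then show ?thesis using P hm by (simp add: relations_def hsum_def)
  qed
  show ?case
  proof (intro exI conjI)
    show "sum_of_words H M L'" by (rule sum_of_words.sum[OF Z(1) L1(1) L'])
    show "\<forall>p\<in>P. g (v p) \<in> car L'" using lin_mem[OF gl v] by blast
    show "relations P L' (\<lambda>p. g (v p)) \<subseteq> {h \<in> relations P L l. ((\<lambda>h. c * x h) + y) (h q) = 0}"
    proof
      fix h assume h: "h \<in> relations P L' (\<lambda>p. g (v p))"
      have "\<psi> 0 = 0" by (rule lin_0[OF mod_vs[OF Zo] is_vs_ground z(2)])
      then have "x (h q) = 0" using rel[OF h] by (simp add: z(1) mcoef_def)
      then show "h \<in> {h \<in> relations P L l. ((\<lambda>h. c * x h) + y) (h q) = 0}"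
        using rel[OF h] L1(3) by auto
    qed
  qed
qed

lemma relations_kill:
  assumes P: "finite P" and T: "finite T" "T \<subseteq> word_span M \<times> P"
  shows "\<exists>L l. sum_of_words H M L \<and> (\<forall>p\<in>P. l p \<in> car L) \<and>
    (\<forall>h\<in>relations P L l. \<forall>(f, q)\<in>T. f (h q) = 0)"
  using T
proof (induction T rule: finite_induct)
  case empty
  (* the empty sum of words *)
  define L :: "('k, 'h, nat \<Rightarrow> 'k) lmod"
    where "L = \<lparr>car = {0}, scl = (\<lambda>c v i. c * v i), act = (\<lambda>_ _. 0)\<rparr>"
  have vs: "is_vs L"
    unfolding is_vs_def L_def by (simp add: vector_space_fun)
  have "fin_dim_vs L"
    unfolding fin_dim_vs_def using vs by (auto simp: L_def intro!: exI[of _ "{}"])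
  then have "L \<in> mod_obj H"
    by (auto simp: mod_obj_def bilin_def lin_def L_def fun_eq_iff)
  then have "sum_of_words H M L" by (rule sum_of_words.zero) (simp add: mod_zero_def L_def)
  then show ?case by (intro exI[of _ L] exI[of _ "\<lambda>_. 0"]) (auto simp: L_def)
next
  case (insert t T)
  obtain f q where t: "t = (f, q)" "f \<in> word_span M" "q \<in> P" using insert.prems by auto
  obtain L l where L: "sum_of_words H M L" "\<forall>p\<in>P. l p \<in> car L"
    "\<forall>h\<in>relations P L l. \<forall>(f, q)\<in>T. f (h q) = 0" using insert by auto
  obtain L' l' where L': "sum_of_words H M L'" "\<forall>p\<in>P. l' p \<in> car L'"
    "relations P L' l' \<subseteq> {h \<in> relations P L l. f (h q) = 0}"
    using relations_extend[OF P t(3) t(2) L(1)] L(2) by blast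
  have "\<forall>h\<in>relations P L' l'. \<forall>(f, q)\<in>insert t T. f (h q) = 0"
  proof (intro ballI)
    fix h s assume h: "h \<in> relations P L' l'" and s: "s \<in> insert t T"
    have "h \<in> relations P L l" "f (h q) = 0" using h L'(3) by auto
    then show "case s of (f, q) \<Rightarrow> f (h q) = 0" using s L(3) t(1) by auto
  qed
  then show ?case using L'(1,2) by blast
qed

text \<open>For a basis \<open>e\<close> of \<open>X\<close>, choose \<open>L\<close> and \<open>l\<close> such that every relation between the
  vectors \<open>l p\<close> kills all coefficients of \<open>X\<close>, the argument of the coefficients of \<open>e j\<close> being the
  \<open>j\<close>-th component of the relation.  Then \<open>\<Sum> h\<^sub>p l\<^sub>p \<mapsto> \<Sum> h\<^sub>p e\<^sub>p\<close> is well
  defined on the submodule generated by the \<open>l p\<close>, and it is onto since the \<open>e p\<close> generate \<open>X\<close>.\<close>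

lemma gen_objI:
  assumes X: "X \<in> mod_obj H" and c: "coefs X \<subseteq> word_span M"
  shows "X \<in> gen_obj H M"
proof -
  obtain n e \<phi> where b: "coord_basis X {..<n::nat} e \<phi>" using mod_basis[OF X] .
  note V = mod_vs[OF X]
  note eX = coord_mem[OF b]
  define T where "T = (\<lambda>(i, j). (mcoef X (\<phi> i) (e j), j)) ` ({..<n} \<times> {..<n})"
  have "T \<subseteq> word_span M \<times> {..<n}"
    using c mcoef_coefs[OF coord_lin[OF b] eX] by (auto simp: T_def)
  then obtain L l where L: "sum_of_words H M L" "\<forall>p\<in>{..<n}. l p \<in> car L"
    "\<forall>h\<in>relations {..<n} L l. \<forall>(f, q)\<in>T. f (h q) = 0"
    using relations_kill[of "{..<n}" T M] by (auto simp: T_def)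
  note Lo = sum_of_words_obj[OF L(1)]
  note VL = mod_vs[OF Lo]
  interpret L: vector_space "scl L" using VL by (simp add: is_vs_def)
  interpret X: vector_space "scl X" using V by (simp add: is_vs_def)
  interpret H: vector_space "scl H" using vs_H by (simp add: is_vs_def)
  have kill: "act X (h j) (e j) = 0" if h: "h \<in> relations {..<n} L l" and j: "j < n" for h j
  proof -
    have hj: "h j \<in> car H" using h j by (simp add: relations_def)
    have "mcoef X (\<phi> i) (e j) (h j) = 0" if "i < n" for i
    proof -
      have "(mcoef X (\<phi> i) (e j), j) \<in> T" using that j by (force simp: T_def)
      then show ?thesis using L(3) h by blast
    qed
    then show ?thesis using act_expand[OF X b hj, of "e j"] eX j by simp
  qed
  (* families h of elements of H, and the two linear maps h \<mapsto> \<Sum> h_p l_p and h \<mapsto> \<Sum> h_p e_p *)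
  define cH where "cH = {h. \<forall>p\<in>{..<n}. h p \<in> car H}"
  define sL where "sL = hsum {..<n} L l"
  define sX where "sX = hsum {..<n} X e"
  have cH_add: "(\<lambda>p. h p + h' p) \<in> cH" and cH_diff: "(\<lambda>p. h p - h' p) \<in> cH"
    and cH_scale: "(\<lambda>p. scl H k (h p)) \<in> cH" if "h \<in> cH" "h' \<in> cH" for h h' k
    using that vs_add[OF vs_H] vs_diff[OF vs_H] vs_scale[OF vs_H] by (auto simp: cH_def)
  have cH_mul: "(\<lambda>p. mul H a (h p)) \<in> cH" if "a \<in> car H" "h \<in> cH" for a h
    using that mul_mem by (auto simp: cH_def)
  have cD: "\<forall>p\<in>{..<n}. h p \<in> car H" if "h \<in> cH" for h using that by (simp add: cH_def)
  have eX': "\<forall>p\<in>{..<n}. e p \<in> car X" using eX by blast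
  note hL = hsum_lin[OF Lo L(2) cD, folded sL_def] and hX = hsum_lin[OF X eX' cD, folded sX_def]
  have sL_lin: "sL (\<lambda>p. h p + h' p) = sL h + sL h'" "sL (\<lambda>p. h p - h' p) = sL h - sL h'"
      "sL (\<lambda>p. scl H k (h p)) = scl L k (sL h)"
    and sX_lin: "sX (\<lambda>p. h p + h' p) = sX h + sX h'" "sX (\<lambda>p. h p - h' p) = sX h - sX h'"
      "sX (\<lambda>p. scl H k (h p)) = scl X k (sX h)" if "h \<in> cH" "h' \<in> cH" for h h' k
    using that by (simp_all add: hL hX cD)
  have sL_mul: "sL (\<lambda>p. mul H a (h p)) = act L a (sL h)"
    and sX_mul: "sX (\<lambda>p. mul H a (h p)) = act X a (sX h)" if "a \<in> car H" "h \<in> cH" for a h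
    using that by (simp_all add: hL hX)
  have sL_mem: "sL h \<in> car L" and sX_mem: "sX h \<in> car X" if "h \<in> cH" for h
    using that by (simp_all add: hL hX)
  have wd: "sX h = sX h'" if "h \<in> cH" "h' \<in> cH" "sL h = sL h'" for h h'
  proof -
    have "(\<lambda>p. h p - h' p) \<in> relations {..<n} L l"
      using cH_diff[OF that(1,2)] sL_lin(2)[OF that(1,2)] that(3) by (simp add: relations_def cH_def sL_def)
    then have "sX (\<lambda>p. h p - h' p) = 0" unfolding sX_def hsum_def by (intro sum.neutral) (use kill in force)
    then show ?thesis using sX_lin(2)[OF that(1,2)] by simp
  qed
  (* S is the submodule generated by the l p; the choice in q does not matter by wd *)
  define S where "S = sL ` cH"
  define q where "q = (\<lambda>s. if s \<in> S then sX (SOME h. h \<in> cH \<and> sL h = s) else 0)"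
  have q: "q (sL h) = sX h" if "h \<in> cH" for h
  proof -
    have "\<exists>h'. h' \<in> cH \<and> sL h' = sL h" using that by blast
    from someI_ex[OF this] have "sX (SOME h'. h' \<in> cH \<and> sL h' = sL h) = sX h" using wd that by blast
    then show ?thesis using that by (simp add: q_def S_def)
  qed
  have S: "L.subspace S"
  proof (rule L.subspaceI)
    have "(\<lambda>_. 0) \<in> cH" using vs_zero[OF vs_H] by (simp add: cH_def)
    moreover from this have "sL (\<lambda>_. 0) = 0" using sL_lin(2)[of "\<lambda>_. 0" "\<lambda>_. 0"] by simp
    ultimately show "0 \<in> S" unfolding S_def by (metis imageI)
    show "x + y \<in> S" if "x \<in> S" "y \<in> S" for x y
      using that sL_lin(1) cH_add unfolding S_def by (metis (no_types, lifting) imageE imageI)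
    show "scl L k x \<in> S" if "x \<in> S" for k x
      using that sL_lin(3) cH_scale unfolding S_def by (metis (no_types, lifting) imageE imageI)
  qed
  have SL: "S \<subseteq> car L" using sL_mem by (auto simp: S_def)
  have Scl: "act L a x \<in> S" if "a \<in> car H" "x \<in> S" for a x
    using that sL_mul cH_mul unfolding S_def by (metis (no_types, lifting) imageE imageI)
  define A where "A = \<lparr>car = S, scl = scl L, act = (\<lambda>a x. if x \<in> S then act L a x else 0)\<rparr>"
  have Ao: "A \<in> mod_obj H" unfolding A_def by (rule submodule_obj[OF Lo S SL Scl])
  have "(\<lambda>x. if x \<in> S then x else 0) \<in> mod_hom H A L"
    using Scl SL L.subspace_add[OF S] L.subspace_scale[OF S] by (auto simp: mod_hom_def lin_def A_def)
  moreover have "inj_on (\<lambda>x. if x \<in> S then x else 0) (car A)" by (auto simp: inj_on_def A_def)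
  moreover have "q \<in> mod_hom H A X"
    unfolding mod_hom_def
  proof (intro CollectI conjI ballI allI impI)
    show "lin A X q"
    proof (rule linI)
      fix x assume "x \<in> car A"
      then obtain h where h: "h \<in> cH" "x = sL h" by (auto simp: A_def S_def)
      show "q x \<in> car X" using h q sX_mem by simp
      show "q (scl A k x) = scl X k (q x)" for k
        using h q[OF h(1)] q[OF cH_scale[OF h(1) h(1)]] sL_lin(3)[OF h(1) h(1)] sX_lin(3)[OF h(1) h(1)]
        by (simp add: A_def)
      fix y assume "y \<in> car A"
      then obtain h' where h': "h' \<in> cH" "y = sL h'" by (auto simp: A_def S_def)
      show "q (x + y) = q x + q y"
        using h h' q[OF h(1)] q[OF h'(1)] q[OF cH_add[OF h(1) h'(1)]] sL_lin(1)[OF h(1) h'(1)] sX_lin(1)[OF h(1) h'(1)]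
        by simp
    qed
    fix a x assume a: "a \<in> car H" and "x \<in> car A"
    then obtain h where h: "h \<in> cH" "x = sL h" by (auto simp: A_def S_def)
    have "act A a x = sL (\<lambda>p. mul H a (h p))" using h sL_mul[OF a h(1)] by (simp add: A_def S_def)
    then show "q (act A a x) = act X a (q x)"
      using h q[OF h(1)] q[OF cH_mul[OF a h(1)]] sX_mul[OF a h(1)] by simp
  next
    show "q x = 0" if "x \<notin> car A" for x using that by (simp add: q_def A_def)
  qed
  moreover have "q ` car A = car X"
  proof
    show "q ` car A \<subseteq> car X" using q sX_mem by (auto simp: A_def S_def)
    show "car X \<subseteq> q ` car A"
    proof
      fix x assume x: "x \<in> car X"
      (* the scalars of the expansion of x, viewed as multiples of the unit of H *)
      let ?h = "\<lambda>p. scl H (\<phi> p x) (unt H)"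
      have h: "?h \<in> cH" using vs_scale[OF vs_H unt_mem] by (simp add: cH_def)
      have "sX ?h = (\<Sum>p<n. scl X (\<phi> p x) (e p))"
        using lin_scale[OF mod_act_lin_left[OF X eX] unt_mem] mod_unt[OF X eX]
        by (auto simp: sX_def hsum_def intro!: sum.cong)
      also have "\<dots> = x" using coord_expand[OF b x] by simp
      finally have "q (sL ?h) = x" using q[OF h] by simp
      moreover have "sL ?h \<in> car A" using h by (simp add: A_def S_def)
      ultimately show "x \<in> q ` car A" by (metis imageI)
    qed
  qed
  ultimately have "subquotient H X L" unfolding subquotient_def using Ao by blast
  then show ?thesis using X L(1) by (auto simp: gen_obj_def)
qed

section \<open>Comodules\<close>

abbreviation Hfin where "Hfin \<equiv> fin_dual H"

text \<open>The co-representation Hopf algebra, described without reference to a matrix representation.\<close>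

definition word_hopf :: "('k, 'h, 'm::ab_group_add) lmod \<Rightarrow> ('k, 'h \<Rightarrow> 'k) hopf" where
  "word_hopf M = Hfin\<lparr>car := word_span M\<rparr>"

lemma word_hopf_simps [simp]: "car (word_hopf M) = word_span M" "scl (word_hopf M) = scl Hfin" "mul (word_hopf M) = mul Hfin" "unt (word_hopf M) = unt Hfin"
  "comul (word_hopf M) = comul Hfin" "counit (word_hopf M) = counit Hfin"
  by (simp_all add: word_hopf_def)

lemma corep_hopf_eq: "M \<in> mod_obj H \<Longrightarrow> matrix_rep_of H M n \<pi> \<Longrightarrow> corep_hopf H n \<pi> = word_hopf M"
  using car_corep_hopf[of M n \<pi>] by (simp add: corep_hopf_def word_hopf_def)

lemma is_vs_word_hopf: "is_vs (word_hopf M)"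
  by (simp add: is_vs_def scl_fin_dual vector_space_fun subspace_word_span)

lemma word_hopf_sub: "car (word_hopf M) \<subseteq> car Hfin"
  using word_span_fin_dual car_fin_dual by simp

lemma tens_word_hopf: "tens X (word_hopf M) = tens X Hfin"
  by (rule tens_cong) simp_all

lemma tensor_word_hopf_sub: "is_vs X \<Longrightarrow> car (tensor_vs X (word_hopf M)) \<subseteq> car (tensor_vs X Hfin)"
  by (rule tensor_car_mono) (use word_hopf_sub in auto)

text \<open>Evaluation of \<open>X \<otimes> H\<degree>\<close> at \<open>h\<close>; it takes the coaction at \<open>x\<close> to \<open>h x\<close>.\<close>

definition ev :: "('k, 'v::ab_group_add, 'z) vspace_scheme \<Rightarrow> 'h \<Rightarrow> ('k, 'v, 'h \<Rightarrow> 'k) tensor \<Rightarrow> 'v" where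
  "ev X h = tlift X Hfin (\<lambda>x0 x1. scl X (x1 h) x0)"

lemma bilin_ev: "is_vs X \<Longrightarrow> scl W = (\<lambda>c f x. c * f x) \<Longrightarrow> bilin X W X (\<lambda>x0 x1. scl X (x1 h) x0)"
  by (rule bilin_scl[OF _ lin_eval])

lemma lin_ev: "is_vs X \<Longrightarrow> lin (tensor_vs X Hfin) X (ev X h)"
  unfolding ev_def by (rule tensor_universal(1)[OF _ is_vs_fin_dual(2) _ bilin_ev[OF _ scl_fin_dual(2)]])

lemma lin_ev_word_hopf:
  assumes "is_vs X"
  shows "lin (tensor_vs X (word_hopf M)) X (ev X h)"
  using lin_ev[OF assms, of h] tensor_word_hopf_sub[OF assms, of M]
  by (auto simp: lin_def subset_iff)

lemma ev_sum:
  assumes "is_vs X" "finite I" "\<And>i. i \<in> I \<Longrightarrow> x i \<in> car X" "\<And>i. i \<in> I \<Longrightarrow> f i \<in> car Hfin"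
  shows "ev X h (\<Sum>i\<in>I. tens X Hfin (x i) (f i)) = (\<Sum>i\<in>I. scl X (f i h) (x i))"
  unfolding ev_def
  by (rule tlift_sum[OF assms(1) is_vs_fin_dual(2) assms(1) bilin_ev[OF assms(1) scl_fin_dual(2)] assms(2-4)])

lemma ev_word_hopf: "is_vs X \<Longrightarrow> t \<in> car (tensor_vs X (word_hopf M)) \<Longrightarrow> tlift X (word_hopf M) (\<lambda>x0 x1. scl X (x1 h) x0) t = ev X h t"
  unfolding ev_def
  by (rule tlift_mono[symmetric, OF _ is_vs_word_hopf _ is_vs_fin_dual(2) _ bilin_ev[OF _ scl_fin_dual(2)]]) (use word_hopf_sub in auto)

lemma ev_unique:
  assumes X: "is_vs X" and st: "s \<in> car (tensor_vs X Hfin)" "t \<in> car (tensor_vs X Hfin)"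
    and eq: "\<And>h. h \<in> car H \<Longrightarrow> ev X h s = ev X h t"
  shows "s = t"
  by (rule tensor_eval_unique[OF X is_vs_fin_dual(2) scl_fin_dual(2) _ st, where S = "car H"])
    (use eq Hd_zero fin_dual_Hd car_fin_dual in \<open>auto simp: ev_def\<close>)

lemma coact_eqI:
  assumes X: "is_vs X" and x: "x \<in> car X" and t: "t \<in> car (tensor_vs X Hfin)"
    and eq: "\<And>h. h \<in> car H \<Longrightarrow> ev X h t = act X h x"
  shows "coact (to_comod H X) x = t"
proof -
  have "(THE t. t \<in> car (tensor_vs X Hfin) \<and> (\<forall>h\<in>car H. act X h x = ev X h t)) = t"
  proof (rule the_equality)
    show "t \<in> car (tensor_vs X Hfin) \<and> (\<forall>h\<in>car H. act X h x = ev X h t)" using t eq by simp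
    show "s = t" if "s \<in> car (tensor_vs X Hfin) \<and> (\<forall>h\<in>car H. act X h x = ev X h s)" for s
      using that eq by (intro ev_unique[OF X _ t]) auto
  qed
  then show ?thesis using x by (simp add: to_comod_def ev_def)
qed

lemma to_comod_simps [simp]: "car (to_comod H X) = car X" "scl (to_comod H X) = scl X"
  by (simp_all add: to_comod_def)

text \<open>The coaction in coordinates; the comodule axioms are checked on this formula.\<close>

lemma coact_basis:
  assumes X: "X \<in> mod_obj H" and c: "coord_basis X I e \<phi>" and x: "x \<in> car X"
  shows "coact (to_comod H X) x = (\<Sum>i\<in>I. tens X Hfin (e i) (mcoef X (\<phi> i) x))"
proof (rule coact_eqI[OF mod_vs[OF X] x])
  have m: "mcoef X (\<phi> i) x \<in> car Hfin" if "i \<in> I" for i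
    using coefs_fin_dual[OF X] mcoef_coefs[OF coord_lin[OF c that] x] car_fin_dual by auto
  show "(\<Sum>i\<in>I. tens X Hfin (e i) (mcoef X (\<phi> i) x)) \<in> car (tensor_vs X Hfin)"
    using coord_mem[OF c] m by (intro tens_sum_mem)
  show "ev X h (\<Sum>i\<in>I. tens X Hfin (e i) (mcoef X (\<phi> i) x)) = act X h x" if "h \<in> car H" for h
    using ev_sum[OF mod_vs[OF X] coord_finite[OF c] coord_mem[OF c] m] act_expand[OF X c that x] by simp
qed

lemma ev_coact:
  assumes X: "X \<in> mod_obj H" and h: "h \<in> car H" and x: "x \<in> car X"
  shows "ev X h (coact (to_comod H X) x) = act X h x"
    and "coact (to_comod H X) x \<in> car (tensor_vs X Hfin)"
proof -
  obtain n e \<phi> where c: "coord_basis X {..<n::nat} e \<phi>" using mod_basis[OF X] .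
  have m: "mcoef X (\<phi> i) x \<in> car Hfin" if "i \<in> {..<n}" for i
    using coefs_fin_dual[OF X] mcoef_coefs[OF coord_lin[OF c that] x] car_fin_dual by auto
  show "ev X h (coact (to_comod H X) x) = act X h x"
    unfolding coact_basis[OF X c x]
    using ev_sum[OF mod_vs[OF X] coord_finite[OF c] coord_mem[OF c] m] act_expand[OF X c h x] by simp
  show "coact (to_comod H X) x \<in> car (tensor_vs X Hfin)"
    unfolding coact_basis[OF X c x] using coord_mem[OF c] m by (intro tens_sum_mem)
qed

lemma lin_mcoef:
  assumes X: "X \<in> mod_obj H" and p: "lin X ground \<psi>" and A: "coefs X \<subseteq> word_span M"
  shows "lin X (word_hopf M) (mcoef X \<psi>)"
proof (rule linI)
  fix x assume x: "x \<in> car X"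
  show "mcoef X \<psi> x \<in> car (word_hopf M)" using mcoef_coefs[OF p x] A by auto
  show "mcoef X \<psi> (scl X c x) = scl (word_hopf M) c (mcoef X \<psi> x)" for c
    using x lin_scale[OF mod_act_lin[OF X]] lin_scale[OF p] mod_act_mem[OF X]
    by (auto simp: mcoef_def scl_fin_dual fun_eq_iff)
  fix y assume y: "y \<in> car X"
  show "mcoef X \<psi> (x + y) = mcoef X \<psi> x + mcoef X \<psi> y"
    using x y lin_add[OF mod_act_lin[OF X]] lin_add[OF p] mod_act_mem[OF X]
    by (auto simp: mcoef_def fun_eq_iff)
qed

lemma lin_coact:
  assumes X: "X \<in> mod_obj H" and A: "coefs X \<subseteq> word_span M"
  shows "lin X (tensor_vs X (word_hopf M)) (coact (to_comod H X))"
proof -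
  obtain n e \<phi> where c: "coord_basis X {..<n::nat} e \<phi>" using mod_basis[OF X] .
  have "lin X (tensor_vs X (word_hopf M)) (\<lambda>x. \<Sum>i<n. tens X (word_hopf M) (e i) (mcoef X (\<phi> i) x))"
    by (intro lin_sum_fun[OF is_vs_tensor_vs] lin_comp[OF lin_mcoef[OF X coord_lin[OF c] A]
          bilin_right[OF bilin_tens coord_mem[OF c]]])
  then show ?thesis
    by (rule lin_cong_fun[OF mod_vs[OF X]]) (simp add: coact_basis[OF X c] tens_word_hopf)
qed

lemma lin_comul_word_hopf: "lin (word_hopf M) (tensor_vs (word_hopf M) (word_hopf M)) (comul Hfin)"
proof (rule linI)
  have sp: "comul_spec f (comul Hfin f) \<and> comul Hfin f \<in> car (tensor_vs (word_hopf M) (word_hopf M))" if "f \<in> word_span M" for f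
    using comul_spec_word_span[OF that] comul_eqI unfolding word_hopf_def by blast
  fix f assume f: "f \<in> car (word_hopf M)"
  show "comul Hfin f \<in> car (tensor_vs (word_hopf M) (word_hopf M))" using sp f by simp
  show "comul Hfin (scl (word_hopf M) c f) = scl (tensor_vs (word_hopf M) (word_hopf M)) c (comul Hfin f)" for c
    using comul_eqI[OF comul_spec_scale] sp f by (simp add: scl_fin_dual)
  fix g assume g: "g \<in> car (word_hopf M)"
  show "comul Hfin (f + g) = comul Hfin f + comul Hfin g"
    using comul_eqI[OF comul_spec_add] sp f g by simp
qed

lemma comul_word_hopf_spec:
  assumes f: "f \<in> word_span M" and a: "a \<in> car H" and b: "b \<in> car H"
  shows "tlift (word_hopf M) (word_hopf M) (\<lambda>f1 f2. f1 a * f2 b) (comul Hfin f) = f (mul H a b)"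
proof -
  have "comul_spec f (comul Hfin f)" using comul_spec_word_span[OF f] comul_eqI by blast
  moreover have "tlift (fin_dual_vs H) (fin_dual_vs H) (\<lambda>f1 f2. f1 a * f2 b) (comul Hfin f) =
    tlift (word_hopf M) (word_hopf M) (\<lambda>f1 f2. f1 a * f2 b) (comul Hfin f)"
    using lin_mem[OF lin_comul_word_hopf, of f M] f word_span_fin_dual
    by (intro tlift_mono[OF is_vs_word_hopf is_vs_word_hopf is_vs_fin_dual(1) is_vs_fin_dual(1) is_vs_ground bilin_eval2])
      (simp_all add: scl_fin_dual)
  ultimately show ?thesis using a b by (simp add: comul_spec_def)
qed

lemma counit_fin_dual: "counit Hfin f = f (unt H)"
  by (simp add: fin_dual_def)

text \<open>Both sides of coassociativity at \<open>x\<close> are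
  \<open>\<Sum> e j \<otimes> (c j i \<otimes> c i x)\<close>, where \<open>c j i\<close> and \<open>c i x\<close> are the coefficients of
  \<open>e i\<close> and of \<open>x\<close>.\<close>

lemma to_comod_obj:
  fixes X :: "('k, 'h, 'v::ab_group_add) lmod"
  assumes X: "X \<in> mod_obj H" and A: "coefs X \<subseteq> word_span M"
  shows "to_comod H X \<in> comod_obj (word_hopf M)"
proof -
  let ?D = "word_hopf M" and ?\<rho> = "coact (to_comod H X)"
  obtain n e \<phi> where c: "coord_basis X {..<n::nat} e \<phi>" using mod_basis[OF X] .
  note V = mod_vs[OF X]
  have mm: "mcoef X (\<phi> i) x \<in> word_span M" if "i < n" "x \<in> car X" for i x
    using mcoef_coefs[OF coord_lin[OF c] that(2)] A that(1) by auto
  have em: "e i \<in> car X" if "i < n" for i using coord_mem[OF c] that by simp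
  have rho: "?\<rho> x = (\<Sum>i<n. tens X ?D (e i) (mcoef X (\<phi> i) x))" if "x \<in> car X" for x
    by (simp add: coact_basis[OF X c that] tens_word_hopf)
  have coassoc: "tassoc X ?D ?D (tmap X ?D (tensor_vs X ?D) ?D ?\<rho> id (?\<rho> x)) =
      tmap X ?D X (tensor_vs ?D ?D) id (comul ?D) (?\<rho> x)" if x: "x \<in> car X" for x
  proof -
    have "tassoc X ?D ?D (tmap X ?D (tensor_vs X ?D) ?D ?\<rho> id (?\<rho> x)) =
      (\<Sum>i<n. \<Sum>j<n. tens X (tensor_vs ?D ?D) (e j) (tens ?D ?D (mcoef X (\<phi> j) (e i)) (mcoef X (\<phi> i) x)))"
      unfolding rho[OF x] by (rule tassoc_tmap_sum[OF V is_vs_word_hopf lin_coact[OF X A]]) (use em mm x rho in auto)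
    also have "\<dots> = (\<Sum>j<n. \<Sum>i<n. tens X (tensor_vs ?D ?D) (e j) (tens ?D ?D (mcoef X (\<phi> j) (e i)) (mcoef X (\<phi> i) x)))"
      by (rule sum.swap)
    also have "\<dots> = tmap X ?D X (tensor_vs ?D ?D) id (comul ?D) (?\<rho> x)"
      unfolding rho[OF x] word_hopf_simps
    proof (rule tmap_right_sum[OF V is_vs_word_hopf lin_comul_word_hopf, symmetric])
      fix j assume j: "j \<in> {..<n}"
      have "tens (fin_dual_vs H) (fin_dual_vs H) = tens ?D ?D" by (rule tens_cong) (simp_all add: scl_fin_dual)
      then show "comul Hfin (mcoef X (\<phi> j) x) = (\<Sum>i<n. tens ?D ?D (mcoef X (\<phi> j) (e i)) (mcoef X (\<phi> i) x))"
        using comul_eqI[OF comul_spec_mcoef[OF X c coord_lin[OF c j] x]] by simp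
    qed (use em mm x in auto)
    finally show ?thesis .
  qed
  have counit: "tlift X ?D (\<lambda>x0 d. scl X (counit ?D d) x0) (?\<rho> x) = x" if x: "x \<in> car X" for x
  proof -
    have "tlift X ?D (\<lambda>x0 d. scl X (counit ?D d) x0) (?\<rho> x) = (\<Sum>i<n. scl X (counit ?D (mcoef X (\<phi> i) x)) (e i))"
      unfolding rho[OF x] using em mm x
      by (intro tlift_sum[OF V is_vs_word_hopf V bilin_scl[OF V]]) (auto simp: counit_fin_dual lin_def scl_fin_dual)
    also have "\<dots> = (\<Sum>i<n. scl X (\<phi> i x) (e i))"
      using unt_mem mod_unt[OF X x] by (simp add: counit_fin_dual mcoef_def)
    also have "\<dots> = x" using coord_expand[OF c x] by simp
    finally show ?thesis .
  qed
  have tv: "tensor_vs (to_comod H X) ?D = tensor_vs X ?D" by (rule tensor_vs_cong) simp_all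
  have "tassoc (to_comod H X) ?D ?D = tassoc X ?D ?D" by (rule tassoc_cong) simp_all
  moreover have "tmap (to_comod H X) ?D (tensor_vs X ?D) ?D = tmap X ?D (tensor_vs X ?D) ?D"
    by (rule tmap_cong) simp_all
  moreover have "tmap (to_comod H X) ?D (to_comod H X) (tensor_vs ?D ?D) = tmap X ?D X (tensor_vs ?D ?D)"
    by (rule tmap_cong) simp_all
  moreover have "tlift (to_comod H X) ?D = (tlift X ?D :: _ \<Rightarrow> _ \<Rightarrow> 'v)" by (rule tlift_cong) simp_all
  moreover have "fin_dim_vs (to_comod H X)" using mod_fin_dim[OF X] by (simp add: fin_dim_vs_def is_vs_def)
  moreover have "lin (to_comod H X) (tensor_vs X ?D) ?\<rho>"
    using lin_coact[OF X A] by (simp add: lin_def)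
  moreover have "?\<rho> x = 0" if "x \<notin> car X" for x using that by (simp add: to_comod_def)
  ultimately show ?thesis
    unfolding comod_obj_def by (simp add: tv coassoc counit del: word_hopf_simps(5,6))
qed

lemma to_comod_inj:
  assumes X: "X \<in> mod_obj H" and Y: "Y \<in> mod_obj H" and eq: "to_comod H X = to_comod H Y"
  shows "X = (Y :: ('k, 'h, 'v::ab_group_add) lmod)"
proof (rule lmod.equality)
  have c: "car X = car Y" and s: "scl X = scl Y" using eq by (simp_all add: to_comod_def)
  show "car X = car Y" "scl X = scl Y" "lmod.more X = lmod.more Y" using c s by simp_all
  have e: "ev X = ev Y" unfolding ev_def[abs_def] by (simp add: tlift_cong[OF c s] s)
  show "act X = act Y"
  proof (intro ext)
    fix h x
    show "act X h x = act Y h x"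
    proof (cases "h \<in> car H \<and> x \<in> car X")
      case True
      then show ?thesis
        using ev_coact(1)[OF X, of h x] ev_coact(1)[OF Y, of h x] eq e c by simp
    next
      case False
      then show ?thesis using mod_outside[OF X, of h x] mod_outside[OF Y, of h x] c by auto
    qed
  qed
qed

text \<open>In a basis \<open>e\<close> of the comodule the coaction is
  \<open>e j \<mapsto> \<Sum> e i \<otimes> c i j\<close>, and \<open>h\<close> acts by the matrix \<open>c i j h\<close>.  Coassociativity, compared at
  the coefficient of \<open>e i\<close> and evaluated at two elements of \<open>H\<close>, says that these matrices multiply; the
  counit axiom says that \<open>c i j\<close> is a Kronecker symbol at the unit of \<open>H\<close>.\<close>

lemma to_comod_surj:
  fixes Z :: "('k, 'h \<Rightarrow> 'k, 'v::ab_group_add) rcomod"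
  assumes Z: "Z \<in> comod_obj (word_hopf M)"
  obtains X :: "('k, 'h, 'v) lmod" where "X \<in> mod_obj H" "coefs X \<subseteq> word_span M" "to_comod H X = Z"
proof -
  let ?D = "word_hopf M" and ?\<rho> = "coact Z"
  have fd: "fin_dim_vs Z" and rl: "lin Z (tensor_vs Z ?D) ?\<rho>"
    and ca: "\<And>x. x \<in> car Z \<Longrightarrow> tassoc Z ?D ?D (tmap Z ?D (tensor_vs Z ?D) ?D ?\<rho> id (?\<rho> x)) =
          tmap Z ?D Z (tensor_vs ?D ?D) id (comul ?D) (?\<rho> x)"
    and cu: "\<And>x. x \<in> car Z \<Longrightarrow> tlift Z ?D (\<lambda>x0 d. scl Z (counit ?D d) x0) (?\<rho> x) = x"
    and out: "\<And>x. x \<notin> car Z \<Longrightarrow> ?\<rho> x = 0"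
    using Z unfolding comod_obj_def by blast+
  have V: "is_vs Z" using fd by (simp add: fin_dim_vs_def)
  interpret Z: vector_space "scl Z" using V by (simp add: is_vs_def)
  obtain n e \<phi> where b: "coord_basis Z {..<n::nat} e \<phi>" using fin_dim_coord_basis[OF fd] .
  note em = coord_mem[OF b] and rm = lin_mem[OF rl]
  have rF: "?\<rho> z \<in> car (tensor_vs Z Hfin)" if "z \<in> car Z" for z using rm[OF that] tensor_word_hopf_sub[OF V] by blast
  define c where "c = (\<lambda>i j. tlift Z ?D (\<lambda>v d. scl ?D (\<phi> i v) d) (?\<rho> (e j)))"
  have cD: "c i j \<in> car ?D" if "i \<in> {..<n}" "j \<in> {..<n}" for i j
    unfolding c_def by (rule tensor_basis_expand(2)[OF V is_vs_word_hopf b rm[OF em[OF that(2)]] that(1)])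
  have rho: "?\<rho> (e j) = (\<Sum>i<n. tens Z ?D (e i) (c i j))" if "j \<in> {..<n}" for j
    unfolding c_def by (rule tensor_basis_expand(1)[OF V is_vs_word_hopf b rm[OF em[OF that]]])
  have ev_rho: "ev Z h (?\<rho> (e j)) = (\<Sum>i<n. scl Z (c i j h) (e i))" if "j \<in> {..<n}" for h j
    unfolding rho[OF that] tens_word_hopf using em cD[OF _ that] word_hopf_sub by (intro ev_sum[OF V]) auto
  have c_mul: "c i j (mul H x y) = (\<Sum>k<n. c i k x * c k j y)"
    if ij: "i \<in> {..<n}" "j \<in> {..<n}" and xy: "x \<in> car H" "y \<in> car H" for i j x y
  proof -
    (* evaluation of u \<otimes> (f \<otimes> g) at x and y, followed by the i-th coordinate of u *)
    let ?E = "tlift ?D ?D (\<lambda>f g. f x * g y)"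
    let ?\<Theta> = "tlift Z (tensor_vs ?D ?D) (\<lambda>u t. \<phi> i u * ?E t)"
    have bE: "bilin ?D ?D ground (\<lambda>f g. f x * g y)" by (intro bilin_mult lin_eval) (simp_all add: scl_fin_dual)
    note E = tensor_universal[OF is_vs_word_hopf is_vs_word_hopf is_vs_ground bE]
    note \<Theta> = tensor_universal[OF V is_vs_tensor_vs is_vs_ground bilin_mult[OF coord_lin[OF b ij(1)] E(1)]]
    note \<Theta>_sum = lin_setsum[OF is_vs_tensor_vs is_vs_ground \<Theta>(1)]
    have L: "tassoc Z ?D ?D (tmap Z ?D (tensor_vs Z ?D) ?D ?\<rho> id (?\<rho> (e j))) =
      (\<Sum>k<n. \<Sum>l<n. tens Z (tensor_vs ?D ?D) (e l) (tens ?D ?D (c l k) (c k j)))"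
      unfolding rho[OF ij(2)] by (rule tassoc_tmap_sum[OF V is_vs_word_hopf rl]) (use em cD rho ij in auto)
    have "?\<Theta> \<dots> = (\<Sum>k<n. \<Sum>l<n. ?\<Theta> (tens Z (tensor_vs ?D ?D) (e l) (tens ?D ?D (c l k) (c k j))))"
      by (subst \<Theta>_sum, intro vs_sum[OF is_vs_tensor_vs] tens_mem em cD ij, assumption+,
          intro sum.cong refl \<Theta>_sum tens_mem em cD ij)
    also have "\<dots> = (\<Sum>k<n. \<Sum>l<n. if l = i then c l k x * c k j y else 0)"
      using em cD ij coord_delta[OF b ij(1)] by (intro sum.cong refl) (simp add: \<Theta>(2) E(2) tens_mem)
    also have "\<dots> = (\<Sum>k<n. c i k x * c k j y)" using ij by simp
    finally have l: "?\<Theta> (\<Sum>k<n. \<Sum>l<n. tens Z (tensor_vs ?D ?D) (e l) (tens ?D ?D (c l k) (c k j))) = \<dots>" .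
    have cm: "comul Hfin (c l j) \<in> car (tensor_vs ?D ?D)" if "l \<in> {..<n}" for l
      by (rule lin_mem[OF lin_comul_word_hopf cD[OF that ij(2)]])
    have "tmap Z ?D Z (tensor_vs ?D ?D) id (comul ?D) (?\<rho> (e j)) =
      (\<Sum>l<n. tens Z (tensor_vs ?D ?D) (id (e l)) (comul Hfin (c l j)))"
      unfolding rho[OF ij(2)] word_hopf_simps using em cD ij lin_id[of Z Z]
      by (intro tmap_sum[OF V is_vs_word_hopf _ lin_comul_word_hopf]) (auto simp: id_def)
    then have "?\<Theta> (tmap Z ?D Z (tensor_vs ?D ?D) id (comul ?D) (?\<rho> (e j))) =
      (\<Sum>l<n. ?\<Theta> (tens Z (tensor_vs ?D ?D) (e l) (comul Hfin (c l j))))"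
      by (simp only: id_apply, intro \<Theta>_sum tens_mem em cm)
    also have "\<dots> = (\<Sum>l<n. if l = i then c l j (mul H x y) else 0)"
      using em cm cD ij coord_delta[OF b ij(1)] comul_word_hopf_spec[where M = M, OF _ xy]
      by (intro sum.cong refl) (simp add: \<Theta>(2))
    also have "\<dots> = c i j (mul H x y)" using ij by simp
    finally show ?thesis using L l ca[OF em[OF ij(2)]] by simp
  qed
  have c_unt: "c i j (unt H) = (if i = j then 1 else 0)" if ij: "i \<in> {..<n}" "j \<in> {..<n}" for i j
  proof -
    have "e j = (\<Sum>k<n. scl Z (c k j (unt H)) (e k))"
      using cu[OF em[OF ij(2)]] ev_word_hopf[OF V rm[OF em[OF ij(2)]], of "unt H"] ev_rho[OF ij(2)]
      by (simp add: counit_fin_dual)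
    then have "\<phi> i (e j) = (\<Sum>k<n. \<phi> i (scl Z (c k j (unt H)) (e k)))"
      using lin_setsum[OF V is_vs_ground coord_lin[OF b ij(1)], of "{..<n}"] vs_scale[OF V em] by simp
    also have "\<dots> = (\<Sum>k<n. if i = k then c k j (unt H) else 0)"
      using lin_scale[OF coord_lin[OF b ij(1)] em] coord_delta[OF b ij(1)] by (intro sum.cong refl) simp
    finally show ?thesis using coord_delta[OF b ij] ij by simp
  qed
  have rep: "rep_mat {..<n} c"
    unfolding rep_mat_def using cD c_mul c_unt word_span_Hd[of _ M] by simp
  define X :: "('k, 'h, 'v) lmod" where "X = \<lparr>car = car Z, scl = scl Z,
    act = (\<lambda>h z. if h \<in> car H \<and> z \<in> car Z then ev Z h (?\<rho> z) else 0)\<rparr>"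
  have cs: "car X = car Z" "scl X = scl Z" by (simp_all add: X_def)
  have VX: "is_vs X" using V by (simp only: is_vs_cong[OF cs])
  have bX: "coord_basis X {..<n} e \<phi>" using b by (simp only: coord_basis_cong[OF cs])
  have act_e: "act X h (e j) = (\<Sum>i<n. scl X (c i j h) (e i))" if "h \<in> car H" "j \<in> {..<n}" for h j
    using that em ev_rho[OF that(2)] by (simp add: X_def)
  have Xo: "X \<in> mod_obj H"
  proof (rule mod_objI[OF VX bX rep _ act_e])
    fix h assume h: "h \<in> car H"
    have "lin Z Z (\<lambda>z. ev Z h (?\<rho> z))"
      by (rule lin_comp[OF rl lin_ev_word_hopf[OF V]])
    then have "lin Z Z (act X h)" by (rule lin_cong_fun[OF V]) (simp add: X_def h)
    then show "lin X X (act X h)" by (simp only: lin_cong[OF cs cs])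
  qed (auto simp: X_def)
  have "coefs X \<subseteq> word_span M"
  proof (rule coefs_basis_subset[OF Xo bX subspace_word_span])
    fix i j assume ij: "i \<in> {..<n}" "j \<in> {..<n}"
    have "mcoef X (\<phi> i) (e j) = c i j"
    proof
      fix h show "mcoef X (\<phi> i) (e j) h = c i j h"
      proof (cases "h \<in> car H")
        case True
        have "\<phi> i (act X h (e j)) = (\<Sum>k<n. \<phi> i (scl X (c k j h) (e k)))"
          unfolding act_e[OF True ij(2)] using em cs
          by (intro lin_setsum[OF VX is_vs_ground coord_lin[OF bX ij(1)]] vs_scale[OF VX]) simp
        also have "\<dots> = (\<Sum>k<n. if i = k then c k j h else 0)"
          using lin_scale[OF coord_lin[OF bX ij(1)]] coord_mem[OF bX] coord_delta[OF bX ij(1)] by (intro sum.cong refl) simp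
        finally show ?thesis using ij True by (simp add: mcoef_def)
      next
        case False
        then show ?thesis using Hd_zero[OF rep_Hd[OF rep ij]] by (simp add: mcoef_def)
      qed
    qed
    then show "mcoef X (\<phi> i) (e j) \<in> word_span M" using cD[OF ij] by simp
  qed
  moreover have "to_comod H X = Z"
  proof (rule rcomod.equality)
    show "car (to_comod H X) = car Z" "scl (to_comod H X) = scl Z" "rcomod.more (to_comod H X) = rcomod.more Z"
      by (simp_all add: cs)
    have e: "ev X = ev Z" unfolding ev_def[abs_def] by (simp add: tlift_cong[OF cs(1,2)] cs(2))
    have tv: "tensor_vs X Hfin = tensor_vs Z Hfin" by (rule tensor_vs_cong) (simp_all add: cs)
    show "coact (to_comod H X) = coact Z"
    proof
      fix z
      show "coact (to_comod H X) z = coact Z z"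
      proof (cases "z \<in> car Z")
        case True
        show ?thesis by (rule coact_eqI[OF VX]) (use True rF e tv in \<open>auto simp: cs X_def\<close>)
      qed (use out in \<open>simp add: to_comod_def cs\<close>)
    qed
  qed
  ultimately show ?thesis using that Xo by blast
qed

text \<open>The two sides of the comodule condition for \<open>f\<close> evaluate at \<open>h\<close> to \<open>h (f x)\<close> and to
  \<open>f (h x)\<close>.\<close>

lemma mod_hom_eq_comod_hom:
  assumes X: "X \<in> mod_obj H" "coefs X \<subseteq> word_span M" and Y: "Y \<in> mod_obj H" "coefs Y \<subseteq> word_span M"
  shows "mod_hom H X Y = comod_hom (word_hopf M) (to_comod H X) (to_comod H Y)"
proof -
  let ?D = "word_hopf M"
  have tm: "tmap (to_comod H X) ?D (to_comod H Y) ?D = tmap X ?D Y ?D" by (rule tmap_cong) simp_all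
  have key: "(\<forall>a\<in>car H. f (act X a x) = act Y a (f x)) \<longleftrightarrow>
      coact (to_comod H Y) (f x) = tmap X ?D Y ?D f id (coact (to_comod H X) x)"
    if f: "lin X Y f" and x: "x \<in> car X" for f x
  proof -
    have fx: "f x \<in> car Y" by (rule lin_mem[OF f x])
    have lid: "lin ?D ?D id" by (simp add: lin_def)
    note V = mod_vs[OF X(1)] and W = mod_vs[OF Y(1)]
    have cX: "coact (to_comod H X) x \<in> car (tensor_vs X ?D)" by (rule lin_mem[OF lin_coact[OF X] x])
    have tF: "tmap X ?D Y ?D f id (coact (to_comod H X) x) \<in> car (tensor_vs Y Hfin)"
      using lin_mem[OF lin_tmap[OF V is_vs_word_hopf f lid] cX] tensor_word_hopf_sub[OF W] by blast
    obtain r :: nat and v d where t: "\<And>i. i < r \<Longrightarrow> v i \<in> car X" "\<And>i. i < r \<Longrightarrow> d i \<in> car ?D"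
      "coact (to_comod H X) x = (\<Sum>i<r. tens X ?D (v i) (d i))" using tensor_decomp[OF V cX] by blast
    have dF: "d i \<in> car Hfin" if "i < r" for i using t(2)[OF that] word_hopf_sub by auto
    have "tmap X ?D Y ?D f id (coact (to_comod H X) x) = (\<Sum>i<r. tens Y ?D (f (v i)) (id (d i)))"
      unfolding t(3) using t(1,2) by (intro tmap_sum[OF V is_vs_word_hopf f lid]) auto
    then have evY: "ev Y h (tmap X ?D Y ?D f id (coact (to_comod H X) x)) = (\<Sum>i<r. scl Y (d i h) (f (v i)))" for h
      unfolding tens_word_hopf using dF t(1) lin_mem[OF f] by (simp only: id_apply, intro ev_sum[OF W]) auto
    have evX: "ev X h (coact (to_comod H X) x) = (\<Sum>i<r. scl X (d i h) (v i))" for h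
      unfolding t(3) tens_word_hopf using dF t(1) by (intro ev_sum[OF V]) auto
    have fs: "f (\<Sum>i<r. scl X (d i h) (v i)) = (\<Sum>i<r. scl Y (d i h) (f (v i)))" for h
      using lin_setsum[OF V W f, of "{..<r}" "\<lambda>i. scl X (d i h) (v i)"] vs_scale[OF V] t(1) lin_scale[OF f] by simp
    have e: "ev Y h (tmap X ?D Y ?D f id (coact (to_comod H X) x)) = f (act X h x)" if "h \<in> car H" for h
      unfolding evY fs[symmetric] evX[symmetric] ev_coact(1)[OF X(1) that x] by (rule refl)
    show ?thesis
    proof
      assume "\<forall>a\<in>car H. f (act X a x) = act Y a (f x)"
      then show "coact (to_comod H Y) (f x) = tmap X ?D Y ?D f id (coact (to_comod H X) x)"
        using e by (intro coact_eqI[OF W fx tF]) simp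
    next
      assume "coact (to_comod H Y) (f x) = tmap X ?D Y ?D f id (coact (to_comod H X) x)"
      then show "\<forall>a\<in>car H. f (act X a x) = act Y a (f x)"
        using e ev_coact(1)[OF Y(1) _ fx] by auto
    qed
  qed
  have l: "lin (to_comod H X) (to_comod H Y) f = lin X Y f" for f by (simp add: lin_def)
  have "(\<forall>a\<in>car H. \<forall>x\<in>car X. f (act X a x) = act Y a (f x)) \<longleftrightarrow>
      (\<forall>x\<in>car X. coact (to_comod H Y) (f x) = tmap X ?D Y ?D f id (coact (to_comod H X) x))"
    if "lin X Y f" for f
    using key[OF that] by blast
  then show ?thesis
    unfolding mod_hom_def comod_hom_def tm l to_comod_simps by (intro Collect_cong conj_cong refl)
qed

lemma bilin_mul_word_hopf: "bilin (word_hopf M) (word_hopf M) (word_hopf M) conv"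
  using conv_word_span by (intro bilinI linI)
    (auto simp: conv_add_left conv_add_right conv_scale_left conv_scale_right scl_fin_dual)

text \<open>Both coactions are linear, so they may be compared on pure tensors.  There both are the double sum
  \<open>G\<close>: for the module because coefficients of a tensor product are products of coefficients, for the comodule by
  expanding the two given coactions.\<close>

lemma to_comod_tensor:
  assumes X: "X \<in> mod_obj H" "coefs X \<subseteq> word_span M" and Y: "Y \<in> mod_obj H" "coefs Y \<subseteq> word_span M"
  shows "to_comod H (mod_tensor H X Y) = comod_tensor (word_hopf M) (to_comod H X) (to_comod H Y)"
proof -
  let ?D = "word_hopf M" and ?XY = "mod_tensor H X Y" and ?T = "tensor_vs X Y"
  note V = mod_vs[OF X(1)] and W = mod_vs[OF Y(1)]
  obtain n e \<phi> where c: "coord_basis X {..<n::nat} e \<phi>" using mod_basis[OF X(1)] .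
  obtain m f \<psi> where d: "coord_basis Y {..<m::nat} f \<psi>" using mod_basis[OF Y(1)] .
  have em: "e i \<in> car X" if "i < n" for i using coord_mem[OF c] that by simp
  have fm: "f j \<in> car Y" if "j < m" for j using coord_mem[OF d] that by simp
  have xm: "mcoef X (\<phi> i) x \<in> word_span M" if "i < n" "x \<in> car X" for i x
    using mcoef_coefs[OF coord_lin[OF c] that(2)] X(2) that(1) by auto
  have ym: "mcoef Y (\<psi> j) y \<in> word_span M" if "j < m" "y \<in> car Y" for j y
    using mcoef_coefs[OF coord_lin[OF d] that(2)] Y(2) that(1) by auto
  have tX: "tens (to_comod H X) (to_comod H Y) = tens X Y" by (rule tens_cong) simp_all
  have tv: "tensor_vs (to_comod H X) (to_comod H Y) = ?T" by (rule tensor_vs_cong) simp_all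
  have sub: "coefs ?XY \<subseteq> word_span M"
    using X(2) Y(2) by (intro coefs_tensor_subset[OF X(1) Y(1) subspace_word_span] conv_word_span) auto
  have l: "lin ?T (tensor_vs ?T ?D) (coact (to_comod H ?XY))"
  proof -
    have "tensor_vs ?XY ?D = tensor_vs ?T ?D" by (rule tensor_vs_cong) simp_all
    then show ?thesis using lin_coact[OF mod_tensor_obj[OF X(1) Y(1)] sub] by (simp add: lin_def)
  qed
  define G where "G = (\<lambda>x y. \<Sum>i<n. \<Sum>j<m. tens ?T ?D (tens X Y (e i) (f j)) (conv (mcoef X (\<phi> i) x) (mcoef Y (\<psi> j) y)))"
  have bG: "bilin X Y (tensor_vs ?T ?D) G"
  proof -
    have b: "bilin X Y (tensor_vs ?T ?D) (\<lambda>x y. tens ?T ?D (tens X Y (e i) (f j)) (conv (mcoef X (\<phi> i) x) (mcoef Y (\<psi> j) y)))"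
      if "i \<in> {..<n}" "j \<in> {..<m}" for i j
    proof -
      have t: "tens X Y (e i) (f j) \<in> car ?T" using that em fm by (intro tens_mem) auto
      show ?thesis
        by (rule lin_bilin[OF bilin_comp[OF bilin_mul_word_hopf lin_mcoef[OF X(1) coord_lin[OF c that(1)] X(2)]
                lin_mcoef[OF Y(1) coord_lin[OF d that(2)] Y(2)]] bilin_right[OF bilin_tens t]])
    qed
    show ?thesis
      unfolding G_def using bilin_right[OF b] bilin_left[OF b]
      by (intro bilinI lin_sum_fun[OF is_vs_tensor_vs]) auto
  qed
  have co: "coact (to_comod H ?XY) (tens X Y x y) = G x y" if xy: "x \<in> car X" "y \<in> car Y" for x y
  proof -
    have "coact (to_comod H ?XY) (tens X Y x y) = (\<Sum>p\<in>{..<n} \<times> {..<m}.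
        tens ?XY Hfin (case p of (i,j) \<Rightarrow> tens X Y (e i) (f j))
          (mcoef ?XY (case p of (i,j) \<Rightarrow> tlift X Y (\<lambda>x y. \<phi> i x * \<psi> j y)) (tens X Y x y)))"
      using tens_mem[OF xy] by (intro coact_basis[OF mod_tensor_obj[OF X(1) Y(1)] coord_basis_mod_tensor[OF X(1) Y(1) c d]]) simp
    also have "\<dots> = (\<Sum>p\<in>{..<n} \<times> {..<m}. tens ?T ?D (tens X Y (e (fst p)) (f (snd p)))
        (conv (mcoef X (\<phi> (fst p)) x) (mcoef Y (\<psi> (snd p)) y)))"
    proof (rule sum.cong[OF refl])
      fix p assume p: "p \<in> {..<n} \<times> {..<m}"
      have t: "tens ?XY Hfin = tens ?T ?D" by (rule tens_cong) simp_all
      have "conv (mcoef X (\<phi> (fst p)) x) (mcoef Y (\<psi> (snd p)) y) =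
        mcoef ?XY (tlift X Y (\<lambda>x y. \<phi> (fst p) x * \<psi> (snd p) y)) (tens X Y x y)"
        using p by (intro conv_mcoef[OF X(1) Y(1) _ _ xy] coord_lin[OF c] coord_lin[OF d]) auto
      then show "tens ?XY Hfin (case p of (i,j) \<Rightarrow> tens X Y (e i) (f j))
          (mcoef ?XY (case p of (i,j) \<Rightarrow> tlift X Y (\<lambda>x y. \<phi> i x * \<psi> j y)) (tens X Y x y)) =
        tens ?T ?D (tens X Y (e (fst p)) (f (snd p))) (conv (mcoef X (\<phi> (fst p)) x) (mcoef Y (\<psi> (snd p)) y))"
        unfolding t split_beta by simp
    qed
    also have "\<dots> = G x y" by (simp add: G_def sum.cartesian_product split_beta)
    finally show ?thesis .
  qed
  define B where "B = (\<lambda>x y. tlift X ?D (\<lambda>x0 x1. tlift Y ?D (\<lambda>y0 y1. tens ?T ?D (tens X Y x0 y0) (mul ?D x1 y1))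
    (coact (to_comod H Y) y)) (coact (to_comod H X) x))"
  have BG: "B x y = G x y" if xy: "x \<in> car X" "y \<in> car Y" for x y
  proof -
    have mc: "mul Hfin u v = conv u v" if "u \<in> word_span M" "v \<in> word_span M" for u v
      using that by (simp add: mul_fin_dual word_span_Hd[of _ M])
    have b1: "bilin Y ?D (tensor_vs ?T ?D) (\<lambda>y0 y1. tens ?T ?D (tens X Y x0 y0) (mul ?D x1 y1))"
      if "x0 \<in> car X" "x1 \<in> car ?D" for x0 x1
    proof (rule bilin_cong_fun[OF W is_vs_word_hopf])
      show "bilin Y ?D (tensor_vs ?T ?D) (\<lambda>y0 y1. tens ?T ?D (tens X Y x0 y0) (conv x1 y1))"
        by (rule bilin_comp[OF bilin_tens bilin_right[OF bilin_tens that(1)] bilin_right[OF bilin_mul_word_hopf that(2)]])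
    qed (use that mc in auto)
    have in1: "tlift Y ?D (\<lambda>y0 y1. tens ?T ?D (tens X Y x0 y0) (mul ?D x1 y1)) (coact (to_comod H Y) y) =
      (\<Sum>j<m. tens ?T ?D (tens X Y x0 (f j)) (conv x1 (mcoef Y (\<psi> j) y)))"
      if x01: "x0 \<in> car X" "x1 \<in> car ?D" for x0 x1
    proof -
      have "coact (to_comod H Y) y = (\<Sum>j<m. tens Y ?D (f j) (mcoef Y (\<psi> j) y))"
        by (simp add: coact_basis[OF Y(1) d xy(2)] tens_word_hopf)
      then have "tlift Y ?D (\<lambda>y0 y1. tens ?T ?D (tens X Y x0 y0) (mul ?D x1 y1)) (coact (to_comod H Y) y) =
        (\<Sum>j<m. tens ?T ?D (tens X Y x0 (f j)) (mul ?D x1 (mcoef Y (\<psi> j) y)))"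
        using fm ym[OF _ xy(2)]
        by (simp only:, intro tlift_sum[OF W is_vs_word_hopf is_vs_tensor_vs[of ?T ?D] b1[OF x01]]) auto
      then show ?thesis using mc ym[OF _ xy(2)] x01 by simp
    qed
    have b2: "bilin X ?D (tensor_vs ?T ?D) (\<lambda>x0 x1. tlift Y ?D (\<lambda>y0 y1. tens ?T ?D (tens X Y x0 y0) (mul ?D x1 y1))
        (coact (to_comod H Y) y))"
    proof (rule bilin_cong_fun[OF V is_vs_word_hopf _ in1])
      have b: "bilin X ?D (tensor_vs ?T ?D) (\<lambda>x0 x1. tens ?T ?D (tens X Y x0 (f j)) (conv x1 (mcoef Y (\<psi> j) y)))"
        if "j \<in> {..<m}" for j
        by (rule bilin_comp[OF bilin_tens bilin_left[OF bilin_tens] bilin_left[OF bilin_mul_word_hopf]])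
          (use that fm ym xy in auto)
      show "bilin X ?D (tensor_vs ?T ?D) (\<lambda>x0 x1. \<Sum>j<m. tens ?T ?D (tens X Y x0 (f j)) (conv x1 (mcoef Y (\<psi> j) y)))"
        using bilin_right[OF b] bilin_left[OF b] by (intro bilinI lin_sum_fun[OF is_vs_tensor_vs]) auto
    qed
    have "coact (to_comod H X) x = (\<Sum>i<n. tens X ?D (e i) (mcoef X (\<phi> i) x))"
      by (simp add: coact_basis[OF X(1) c xy(1)] tens_word_hopf)
    then have "B x y = (\<Sum>i<n. tlift Y ?D (\<lambda>y0 y1. tens ?T ?D (tens X Y (e i) y0) (mul ?D (mcoef X (\<phi> i) x) y1))
        (coact (to_comod H Y) y))"
      unfolding B_def using em xm[OF _ xy(1)]
      by (simp only:, intro tlift_sum[OF V is_vs_word_hopf is_vs_tensor_vs[of ?T ?D] b2]) auto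
    then show ?thesis using in1 em xm[OF _ xy(1)] by (simp add: G_def)
  qed
  have bB: "bilin X Y (tensor_vs ?T ?D) B" by (rule bilin_cong_fun[OF V W bG BG])
  show ?thesis
  proof (rule rcomod.equality)
    show "car (to_comod H ?XY) = car (comod_tensor ?D (to_comod H X) (to_comod H Y))"
      "scl (to_comod H ?XY) = scl (comod_tensor ?D (to_comod H X) (to_comod H Y))"
      "rcomod.more (to_comod H ?XY) = rcomod.more (comod_tensor ?D (to_comod H X) (to_comod H Y))"
      by (simp_all add: comod_tensor_def tv)
    have cB: "coact (comod_tensor ?D (to_comod H X) (to_comod H Y)) = (\<lambda>t. if t \<in> car ?T then tlift X Y B t else 0)"
      by (simp add: comod_tensor_def tv tX B_def tlift_cong[of "to_comod H X" X "to_comod H Y" Y]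
        tlift_cong[of "to_comod H X" X ?D ?D] tlift_cong[of "to_comod H Y" Y ?D ?D]
        del: word_hopf_simps cong: if_cong)
    show "coact (to_comod H ?XY) = coact (comod_tensor ?D (to_comod H X) (to_comod H Y))"
    proof
      fix t
      show "coact (to_comod H ?XY) t = coact (comod_tensor ?D (to_comod H X) (to_comod H Y)) t"
      proof (cases "t \<in> car ?T")
        case True
        have "coact (to_comod H ?XY) t = tlift X Y B t"
          by (rule tensor_universal(3)[OF V W is_vs_tensor_vs[of ?T ?D] bB l _ True]) (simp add: co BG)
        then show ?thesis using True by (simp add: cB)
      next
        case False
        then have "coact (to_comod H ?XY) t = 0" by (simp add: to_comod_def)
        then show ?thesis using False by (simp add: cB)
      qed
    qed
  qed
qed

lemma to_comod_unit: "to_comod H (mod_unit H) = comod_unit (word_hopf M)"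
proof (rule rcomod.equality)
  show "car (to_comod H (mod_unit H)) = car (comod_unit (word_hopf M))"
    "scl (to_comod H (mod_unit H)) = scl (comod_unit (word_hopf M))"
    "rcomod.more (to_comod H (mod_unit H)) = rcomod.more (comod_unit (word_hopf M))"
    by (simp_all add: comod_unit_def mod_unit_def)
  have V: "is_vs (mod_unit H)" by (rule mod_vs[OF mod_unit_obj])
  have t: "tens ground (word_hopf M) = tens (mod_unit H) Hfin" by (rule tens_cong) (simp_all add: mod_unit_def)
  show "coact (to_comod H (mod_unit H)) = coact (comod_unit (word_hopf M))"
  proof
    fix c
    have c: "c \<in> car (mod_unit H)" by (simp add: mod_unit_def)
    have e: "eps \<in> car Hfin" using eps_word_span word_span_fin_dual car_fin_dual by blast
    have "coact (to_comod H (mod_unit H)) c = tens (mod_unit H) Hfin c eps"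
    proof (rule coact_eqI[OF V c tens_mem[OF c e]])
      fix h assume "h \<in> car H"
      then show "ev (mod_unit H) h (tens (mod_unit H) Hfin c eps) = act (mod_unit H) h c"
        using ev_sum[OF V, of "{()}" "\<lambda>_. c" "\<lambda>_. eps" h] c e by (simp add: mod_unit_def eps_def)
    qed
    then show "coact (to_comod H (mod_unit H)) c = coact (comod_unit (word_hopf M)) c"
      by (simp add: comod_unit_def t unt_fin_dual)
  qed
qed

end

theorem proposition13p1:
  fixes H :: "('k::field, 'h::ab_group_add) hopf"
    and M :: "('k, 'h, 'm::ab_group_add) lmod"
    and n :: nat
    and \<pi> :: "'h \<Rightarrow> 'k mat"
  assumes "hopf_algebra H"
    and "M \<in> mod_obj H"
    and "matrix_rep_of H M n \<pi>"
  shows "bij_betw (to_comod H) (gen_obj H M :: ('k, 'h, 'v::ab_group_add) lmod set)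
           (comod_obj (corep_hopf H n \<pi>))
    \<and> (\<forall>(X :: ('k, 'h, 'v) lmod) \<in> gen_obj H M. \<forall>(Y :: ('k, 'h, 'w::ab_group_add) lmod) \<in> gen_obj H M.
         mod_hom H X Y = comod_hom (corep_hopf H n \<pi>) (to_comod H X) (to_comod H Y)
         \<and> mod_tensor H X Y \<in> gen_obj H M
         \<and> to_comod H (mod_tensor H X Y) =
             comod_tensor (corep_hopf H n \<pi>) (to_comod H X) (to_comod H Y))
    \<and> mod_unit H \<in> gen_obj H M
    \<and> to_comod H (mod_unit H) = comod_unit (corep_hopf H n \<pi>)"
proof -
  interpret hopf_alg H by unfold_locales (rule assms(1))
  have D: "corep_hopf H n \<pi> = word_hopf M" by (rule corep_hopf_eq[OF assms(2,3)])
  have go: "X \<in> mod_obj H" if "X \<in> gen_obj H M" for X :: "('k, 'h, 'x::ab_group_add) lmod"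
    using that by (simp add: gen_obj_def)
  have "bij_betw (to_comod H) (gen_obj H M :: ('k, 'h, 'v) lmod set) (comod_obj (word_hopf M))"
    unfolding bij_betw_def
  proof (intro conjI subset_antisym subsetI)
    show "inj_on (to_comod H) (gen_obj H M :: ('k, 'h, 'v) lmod set)"
      by (intro inj_onI to_comod_inj[OF go go])
    show "Z \<in> comod_obj (word_hopf M)" if "Z \<in> to_comod H ` (gen_obj H M :: ('k, 'h, 'v) lmod set)" for Z
      using that to_comod_obj[OF go gen_obj_coefs] by blast
    show "Z \<in> to_comod H ` (gen_obj H M :: ('k, 'h, 'v) lmod set)" if Z: "Z \<in> comod_obj (word_hopf M)" for Z
    proof -
      obtain X :: "('k, 'h, 'v) lmod" where X: "X \<in> mod_obj H" "coefs X \<subseteq> word_span M" "to_comod H X = Z"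
        using to_comod_surj[OF Z] .
      then show ?thesis using gen_objI[OF X(1,2)] by blast
    qed
  qed
  moreover have "mod_hom H X Y = comod_hom (word_hopf M) (to_comod H X) (to_comod H Y)
      \<and> mod_tensor H X Y \<in> gen_obj H M
      \<and> to_comod H (mod_tensor H X Y) = comod_tensor (word_hopf M) (to_comod H X) (to_comod H Y)"
    if "X \<in> gen_obj H M" "Y \<in> gen_obj H M" for X :: "('k, 'h, 'v) lmod" and Y :: "('k, 'h, 'w) lmod"
  proof -
    note X = go[OF that(1)] gen_obj_coefs[OF that(1)] and Y = go[OF that(2)] gen_obj_coefs[OF that(2)]
    have "coefs (mod_tensor H X Y) \<subseteq> word_span M"
      using X(2) Y(2) by (intro coefs_tensor_subset[OF X(1) Y(1) subspace_word_span] conv_word_span) auto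
    then show ?thesis
      using mod_hom_eq_comod_hom[OF X Y] to_comod_tensor[OF X Y] gen_objI[OF mod_tensor_obj[OF X(1) Y(1)]] by blast
  qed
  moreover have "mod_unit H \<in> gen_obj H M"
    using funs.subspace_scale[OF subspace_word_span eps_word_span]
    by (intro gen_objI[OF mod_unit_obj]) (auto simp: coefs_unit)
  ultimately show ?thesis
    unfolding D using to_comod_unit[of M] by blast
qed

end
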